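(* In the setting of the context (all assumptions listed there being in force), there exists a deviability $\hat{\mathbf{\Pi}}$ on $\mathbb{R}_+^K$ such that, for every bounded set $B\subset\mathbb{R}_+^K$, $$\lim_{t\to\infty}\ \sup_{x\in B}\ \sup_{y\in\mathbb{R}_+^K}\bigl|\mathbf{\Pi}_{x,t}(y)-\hat{\mathbf{\Pi}}(y)\bigr|=0 .$$ Furthermore, given $y\in\mathbb{R}_+^K$, $\mathbf{\Pi}_{x,t}(y)=\hat{\mathbf{\Pi}}(y)$ for all $t$ great enough and all $x\in B$. The deviability $\hat{\mathbf{\Pi}}$ is a unique stationary deviability for the semigroup $\mathbf{\Pi}_{x,t}$, meaning that it is the unique deviability on $\mathbb{R}_+^K$ such that, for all $y\in\mathbb{R}_+^K$ and $t\in\mathbb{R}_+$, $$\hat{\mathbf{\Pi}}(y)=\sup_{x\in\mathbb{R}_+^K}\mathbf{\Pi}_{x,t}(y)\,\hat{\mathbf{\Pi}}(x).$$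
   Context: **Data and assumptions.** $K\in\mathbb{N}$, $\mathcal{K}=\{1,\dots,K\}$. For each $k\in\mathcal{K}$, $\xi_k$ and $\eta_k$ are nonnegative random variables (generic interarrival and service times of station $k$ of a generalised Jackson network), and $P=(p_{kl})_{k,l=1}^K$ is a row-substochastic (routing) matrix of spectral radius less than $1$. For every $k$: $\mathbf{P}(\xi_k=0)=\mathbf{P}(\eta_k=0)=0$; $\mathbf{E}e^{\theta\xi_k}<\infty$ and $\mathbf{E}e^{\theta\eta_k}<\infty$ for some $\theta>0$; the cumulative distribution functions of $\xi_k$ and $\eta_k$ are right-differentiable at $0$ with positive derivatives. With $\lambda_k=1/\mathbf{E}\xi_k$, $\mu_k=1/\mathbf{E}\eta_k$, $\lambda=(\lambda_1,\dots,\lambda_K)^T$, $\mu=(\mu_1,\dots,\mu_K)^T$: $\mu>(I-P^T)^{-1}\lambda$ entrywise ($I$ is the $K\times K$ identity matrix). In addition: 1. there is $\overline\eta>0$ such that $\mathbf{E}(\eta_k-u\mid\eta_k>u)\le\overline\eta$ for all $k\in\mathcal{K}$ and $u>0$; 2. $\mathbf{P}(\xi_k>u)>0$ for all $k\in\mathcal{K}$ and $u>0$; 3. for each $k\in\mathcal{K}$ there exist a nonnegative function $f_k$ on $\mathbb{R}_+$ with $\int_0^\infty f_k(u)\,du>0$ and $m_k\in\mathbb{N}$ such that $\mathbf{P}(\sum_{i=1}^{m_k}\xi_{k,i}\in[v,w])\ge\int_v^wf_k(u)\,du$ whenever $0\le v\le w$, where $\xi_{k,1},\dots,\xi_{k,m_k}$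 are i.i.d. copies of $\xi_k$. **The functional $\mathbf{I}_x$.** Let $\beta_k=\sup\{\theta\in\mathbb{R}_+:\mathbf{E}e^{\theta\xi_k}<\infty\}$, $\gamma_k=\sup\{\theta\in\mathbb{R}_+:\mathbf{E}e^{\theta\eta_k}<\infty\}$; $\pi(u)=u\ln u-u+1$ for $u>0$, $\pi(0)=1$, $\pi(\infty)=\infty$. Let $\mathbb{S}_+^{K\times K}$ be the set of row-substochastic $K\times K$ matrices. For $\alpha,\delta\in\mathbb{R}_+^K$, $\varrho\in\mathbb{S}_+^{K\times K}$ with rows $\varrho_k$, and $J\subset\mathcal{K}$ with $J^c=\mathcal{K}\setminus J$, let $$\psi^A_k(\alpha_k)=\sup_{\theta<\beta_k}\bigl(\theta-\alpha_k\ln\mathbf{E}e^{\theta\xi_k}\bigr),\qquad \psi^S_k(\delta_k)=\sup_{\theta<\gamma_k}\bigl(\theta-\delta_k\ln\mathbf{E}e^{\theta\eta_k}\bigr),$$ $$\psi^R_k(\varrho_k)=\sum_{l=1}^K\pi\Bigl(\frac{\varrho_{kl}}{p_{kl}}\Bigr)p_{kl}+\pi\Bigl(\frac{1-\sum_{l}\varrho_{kl}}{1-\sum_{l}p_{kl}}\Bigr)\Bigl(1-\sum_{l=1}^Kp_{kl}\Bigr),$$ $$\psi_J(\alpha,\delta,\varrho)=\sum_{k=1}^K\psi^A_k(\alpha_k)+\sum_{k\in J^c}\psi^S_k(\delta_k)+\sum_{k\in J}\psi^S_k(\delta_k)1_{\{\delta_k>\mu_k\}}+\sum_{k=1}^K\delta_k\psi^R_k(\varrho_k).$$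 Conventions: in $\psi^R_k$ a term $\pi(a/b)b$ with $b=0$ equals $0$ if $a=0$ and $\infty$ if $a>0$; elsewhere $\infty\cdot0=0$. For $y\in\mathbb{R}^K$, $$\Psi_J(y)=\inf\{\psi_J(\alpha,\delta,\varrho):(\alpha,\delta,\varrho)\in\mathbb{R}_+^K\times\mathbb{R}_+^K\times\mathbb{S}_+^{K\times K},\ y=\alpha+(\varrho^T-I)\delta\}.$$ Let $F_J=\{x\in\mathbb{R}_+^K:x_k=0\text{ for }k\in J,\ x_k>0\text{ for }k\notin J\}$ ($F_\emptyset$ is the interior of $\mathbb{R}_+^K$) and $L(x,y)=\sum_{J\subset\mathcal{K}}1_{F_J}(x)\Psi_J(y)$ for $x\in\mathbb{R}_+^K$, $y\in\mathbb{R}^K$. $\mathbb{D}(\mathbb{R}_+,\mathbb{R}_+^K)$ is the Skorohod space of right-continuous functions with left-hand limits. For $x\in\mathbb{R}_+^K$, $\mathbf{I}_x(q)=\int_0^\infty L(q(t),\dot q(t))\,dt$ if $q\in\mathbb{D}(\mathbb{R}_+,\mathbb{R}_+^K)$ is absolutely continuous with $q(0)=x$, and $\mathbf{I}_x(q)=\infty$ otherwise. **Deviabilities.** An idempotent probability on a set $\Upsilon$ is a function $\mathbf{\Pi}$ from the power set of $\Upsilon$ to $[0,1]$ with $\mathbf{\Pi}(\Gamma)=\sup_{\upsilon\in\Gamma}\mathbf{\Pi}(\{\upsilon\})$ for all $\Gamma\subset\Upsilon$ and $\mathbf{\Pi}(\Upsilon)=1$; one writes $\mathbf{\Pi}(\upsilon)=\mathbf{\Pi}(\{\upsilon\})$.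 If $\Upsilon$ is a metric space and the sets $\{\upsilon:\mathbf{\Pi}(\upsilon)\ge\kappa\}$ are compact for all $\kappa\in(0,1]$, then $\mathbf{\Pi}$ is called a deviability. **The semigroup.** $\mathbf{\Pi}^Q_x(q)=e^{-\mathbf{I}_x(q)}$ for $q\in\mathbb{D}(\mathbb{R}_+,\mathbb{R}_+^K)$, and, for $x,y\in\mathbb{R}_+^K$ and $t\in\mathbb{R}_+$, $\mathbf{\Pi}_{x,t}(y)=\sup_{q:\,q(t)=y}\mathbf{\Pi}^Q_x(q)$. It satisfies $\mathbf{\Pi}_{x,u+v}(y)=\sup_{z\in\mathbb{R}_+^K}\mathbf{\Pi}_{x,u}(z)\mathbf{\Pi}_{z,v}(y)$. *)

theory Defs
  imports "HOL-Probability.Probability"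
begin

section \<open>Deviabilities\<close>

text \<open>Set functions are only looked at on subsets of the carrier \<open>U\<close>. The supremum is taken in
  \<open>[0, \<infinity>]\<close>, so that it is \<open>0\<close> for the empty set.\<close>

definition idempotent_probability :: "'a set \<Rightarrow> ('a set \<Rightarrow> real) \<Rightarrow> bool" where
  "idempotent_probability U D \<longleftrightarrow>
     (\<forall>G. G \<subseteq> U \<longrightarrow> 0 \<le> D G \<and> D G \<le> 1 \<and> ennreal (D G) = (SUP v\<in>G. ennreal (D {v}))) \<and>
     D U = 1"

definition deviability :: "'a::metric_space set \<Rightarrow> ('a set \<Rightarrow> real) \<Rightarrow> bool" where
  "deviability U D \<longleftrightarrow>
     idempotent_probability U D \<and> (\<forall>\<kappa>\<in>{0<..1}. compact {v \<in> U. \<kappa> \<le> D {v}})"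

section \<open>Vectors, matrices and paths\<close>

definition orthant :: "(real ^ 'n) set" where
  "orthant = {x. \<forall>k. 0 \<le> x $ k}"

text \<open>\<open>A $ k\<close> is the \<open>k\<close>-th row of \<open>A\<close>.\<close>

definition row_substochastic :: "real ^ 'n ^ 'n \<Rightarrow> bool" where
  "row_substochastic A \<longleftrightarrow> (\<forall>k l. 0 \<le> A $ k $ l) \<and> (\<forall>k. (\<Sum>l\<in>UNIV. A $ k $ l) \<le> 1)"

definition complex_spectrum :: "real ^ 'n ^ 'n \<Rightarrow> complex set" where
  "complex_spectrum A =
     {c. \<exists>v :: complex ^ 'n. v \<noteq> 0 \<and> (\<chi> i j. complex_of_real (A $ i $ j)) *v v = c *s v}"

definition spectral_radius :: "real ^ 'n ^ 'n \<Rightarrow> real" where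
  "spectral_radius A = Max (cmod ` complex_spectrum A)"

definition absolutely_continuous_on_Icc :: "(real \<Rightarrow> 'b::metric_space) \<Rightarrow> real \<Rightarrow> real \<Rightarrow> bool" where
  "absolutely_continuous_on_Icc f a b \<longleftrightarrow>
     (\<forall>\<epsilon>>0. \<exists>\<delta>>0. \<forall>(n::nat) l r.
        (\<forall>i<n. a \<le> l i \<and> l i \<le> r i \<and> r i \<le> b) \<and>
        disjoint_family_on (\<lambda>i. {l i<..<r i}) {..<n} \<and> (\<Sum>i<n. r i - l i) < \<delta>
        \<longrightarrow> (\<Sum>i<n. dist (f (l i)) (f (r i))) < \<epsilon>)"

text \<open>A path on the half-line is a function on \<open>\<real>\<close> whose values at negative times are irrelevant.
  On the half-line, absolute continuity means absolute continuity on bounded intervals.\<close>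

definition absolutely_continuous_path :: "(real \<Rightarrow> 'b::metric_space) \<Rightarrow> bool" where
  "absolutely_continuous_path q \<longleftrightarrow> (\<forall>T\<ge>0. absolutely_continuous_on_Icc q 0 T)"

definition skorohod_paths :: "(real \<Rightarrow> real ^ 'n) set" where
  "skorohod_paths =
     {q. (\<forall>t\<ge>0. q t \<in> orthant \<and> continuous (at_right t) q) \<and>
         (\<forall>t>0. \<exists>l. (q \<longlongrightarrow> l) (at_left t))}"

section \<open>Rate functions\<close>

definition exp_moment_bound :: "'a measure \<Rightarrow> ('a \<Rightarrow> real) \<Rightarrow> ereal" where
  "exp_moment_bound M X =
     (SUP \<theta>\<in>{\<theta>. 0 \<le> \<theta> \<and> integrable M (\<lambda>\<omega>. exp (\<theta> * X \<omega>))}. ereal \<theta>)"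

text \<open>The supremum is over all real \<open>\<theta>\<close> below the bound, negative ones included.\<close>

definition renewal_rate :: "'a measure \<Rightarrow> ('a \<Rightarrow> real) \<Rightarrow> real \<Rightarrow> ereal" where
  "renewal_rate M X a =
     (SUP \<theta>\<in>{\<theta>. ereal \<theta> < exp_moment_bound M X}.
        ereal (\<theta> - a * ln (\<integral>\<omega>. exp (\<theta> * X \<omega>) \<partial>M)))"

definition entropy_fun :: "real \<Rightarrow> real" where
  "entropy_fun u = (if u = 0 then 1 else u * ln u - u + 1)"

text \<open>\<open>\<pi>(a / b) b\<close> with its conventions for \<open>b = 0\<close>.\<close>

definition entropy_term :: "real \<Rightarrow> real \<Rightarrow> ereal" where
  "entropy_term a b =
     (if b = 0 then (if a = 0 then 0 else \<infinity>) else ereal (entropy_fun (a / b) * b))"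

definition routing_rate :: "real ^ 'n \<Rightarrow> real ^ 'n \<Rightarrow> ereal" where
  "routing_rate p r =
     (\<Sum>l\<in>UNIV. entropy_term (r $ l) (p $ l)) +
     entropy_term (1 - (\<Sum>l\<in>UNIV. r $ l)) (1 - (\<Sum>l\<in>UNIV. p $ l))"

definition exp_minus :: "ennreal \<Rightarrow> real" where
  "exp_minus I = (if I = \<infinity> then 0 else exp (- enn2real I))"

section \<open>The generalised Jackson network\<close>

text \<open>\<open>\<xi> k\<close> and \<open>\<eta> k\<close> are generic interarrival and service times; i.i.d. copies of \<open>\<xi> k\<close> are
  realised as the coordinates of a product of copies of its law. In \<open>residual_service\<close> the
  quotient is \<open>\<^bold>E(\<eta>\<^sub>k - u | \<eta>\<^sub>k > u)\<close>, required only where the condition has positive probability.\<close>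

locale jackson_network = prob_space M for M :: "'a measure" +
  fixes \<xi> \<eta> :: "'n::finite \<Rightarrow> 'a \<Rightarrow> real"
    and P :: "real ^ 'n ^ 'n"
  assumes random_variables:
      "\<And>k. random_variable borel (\<xi> k)" "\<And>k. random_variable borel (\<eta> k)"
    and nonnegative:
      "\<And>k \<omega>. \<omega> \<in> space M \<Longrightarrow> 0 \<le> \<xi> k \<omega>" "\<And>k \<omega>. \<omega> \<in> space M \<Longrightarrow> 0 \<le> \<eta> k \<omega>"
    and routing: "row_substochastic P" "spectral_radius P < 1"
    and no_atom_at_0:
      "\<And>k. prob {\<omega> \<in> space M. \<xi> k \<omega> = 0} = 0" "\<And>k. prob {\<omega> \<in> space M. \<eta> k \<omega> = 0} = 0"
    and exponential_moments:
      "\<And>k. \<exists>\<theta>>0. integrable M (\<lambda>\<omega>. exp (\<theta> * \<xi> k \<omega>))"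
      "\<And>k. \<exists>\<theta>>0. integrable M (\<lambda>\<omega>. exp (\<theta> * \<eta> k \<omega>))"
    and cdf_derivatives:
      "\<And>k. \<exists>d>0. (cdf (distr M borel (\<xi> k)) has_real_derivative d) (at 0 within {0..})"
      "\<And>k. \<exists>d>0. (cdf (distr M borel (\<eta> k)) has_real_derivative d) (at 0 within {0..})"
    and stability:
      "\<And>k. (matrix_inv (mat 1 - transpose P) *v (\<chi> i. 1 / expectation (\<xi> i))) $ k
             < 1 / expectation (\<eta> k)"
    and residual_service:
      "\<exists>C>0. \<forall>k. \<forall>u>0. 0 < prob {\<omega> \<in> space M. u < \<eta> k \<omega>} \<longrightarrow>
         (\<integral>\<omega>\<in>{\<omega> \<in> space M. u < \<eta> k \<omega>}. (\<eta> k \<omega> - u) \<partial>M)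
           / prob {\<omega> \<in> space M. u < \<eta> k \<omega>} \<le> C"
    and unbounded_interarrival:
      "\<And>k u. 0 < u \<Longrightarrow> 0 < prob {\<omega> \<in> space M. u < \<xi> k \<omega>}"
    and spread_out:
      "\<And>k. \<exists>(f :: real \<Rightarrow> real) (m :: nat).
         f \<in> borel_measurable lebesgue \<and> (\<forall>u\<ge>0. 0 \<le> f u) \<and>
         0 < (\<integral>\<^sup>+u\<in>{0..}. ennreal (f u) \<partial>lebesgue) \<and> 0 < m \<and>
         (\<forall>v w. 0 \<le> v \<and> v \<le> w \<longrightarrow>
            (\<integral>\<^sup>+u\<in>{v..w}. ennreal (f u) \<partial>lebesgue)
              \<le> emeasure (\<Pi>\<^sub>M i\<in>{..<m}. distr M borel (\<xi> k))
                  {z \<in> space (\<Pi>\<^sub>M i\<in>{..<m}. distr M borel (\<xi> k)). (\<Sum>i<m. z i) \<in> {v..w}})"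
begin

text \<open>\<open>\<psi>\<^sub>J(\<alpha>, \<delta>, \<rho>)\<close>\<close>

definition rate :: "'n set \<Rightarrow> real ^ 'n \<Rightarrow> real ^ 'n \<Rightarrow> real ^ 'n ^ 'n \<Rightarrow> ereal" where
  "rate J \<alpha> \<delta> \<rho> =
     (\<Sum>k\<in>UNIV. renewal_rate M (\<xi> k) (\<alpha> $ k)) +
     (\<Sum>k\<in>- J. renewal_rate M (\<eta> k) (\<delta> $ k)) +
     (\<Sum>k\<in>J. if \<delta> $ k > 1 / expectation (\<eta> k) then renewal_rate M (\<eta> k) (\<delta> $ k) else 0) +
     (\<Sum>k\<in>UNIV. ereal (\<delta> $ k) * routing_rate (P $ k) (\<rho> $ k))"

text \<open>\<open>\<Psi>\<^sub>J(y)\<close>\<close>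

definition min_rate :: "'n set \<Rightarrow> real ^ 'n \<Rightarrow> ereal" where
  "min_rate J y =
     Inf {rate J \<alpha> \<delta> \<rho> | \<alpha> \<delta> \<rho>. \<alpha> \<in> orthant \<and> \<delta> \<in> orthant \<and> row_substochastic \<rho> \<and>
            y = \<alpha> + (transpose \<rho> - mat 1) *v \<delta>}"

definition face :: "'n set \<Rightarrow> (real ^ 'n) set" where
  "face J = {x \<in> orthant. (\<forall>k\<in>J. x $ k = 0) \<and> (\<forall>k. k \<notin> J \<longrightarrow> 0 < x $ k)}"

definition lagrangian :: "real ^ 'n \<Rightarrow> real ^ 'n \<Rightarrow> ereal" where
  "lagrangian x y = (\<Sum>J\<in>UNIV. indicator (face J) x * min_rate J y)"

text \<open>The Lagrangian is nonnegative, so \<open>e2ennreal\<close> loses nothing. An absolutely continuous path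
  is differentiable almost everywhere; the value of \<open>vector_derivative\<close> elsewhere does not matter.\<close>

definition action :: "real ^ 'n \<Rightarrow> (real \<Rightarrow> real ^ 'n) \<Rightarrow> ennreal" where
  "action x q =
     (if q \<in> skorohod_paths \<and> absolutely_continuous_path q \<and> q 0 = x
      then \<integral>\<^sup>+t\<in>{0..}. e2ennreal (lagrangian (q t) (vector_derivative q (at t within {0..}))) \<partial>lebesgue
      else \<infinity>)"

text \<open>\<open>\<Pi>\<^bsub>x,t\<^esub>(y)\<close>\<close>

definition transition :: "real ^ 'n \<Rightarrow> real \<Rightarrow> real ^ 'n \<Rightarrow> real" where
  "transition x t y = (SUP q\<in>{q \<in> skorohod_paths. q t = y}. exp_minus (action x q))"

definition stationary :: "((real ^ 'n) set \<Rightarrow> real) \<Rightarrow> bool" where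
  "stationary D \<longleftrightarrow>
     (\<forall>y\<in>orthant. \<forall>t\<ge>0. D {y} = (SUP x\<in>orthant. transition x t y * D {x}))"

end

end

theory Submission
  imports Defs
begin

text \<open>Write the transition density as \<open>exp (- c)\<close>, where \<open>c\<close> is the least cost of moving from \<open>x\<close> to
  \<open>y\<close> in time \<open>t\<close>. Three properties of \<open>c\<close> suffice. Fluid paths reach \<open>0\<close> at no cost within a time
  proportional to \<open>|x|\<close> and stay there. Straight lines have cost at most proportional to their length,
  so that the potential \<open>V y = inf\<^sub>t c(0, t, y)\<close> is finite and Lipschitz. A linear Lyapunov function \<open>U\<close>
  with \<open>L(q, q') \<ge> (U \<circ> q)' + \<epsilon>\<close> off \<open>0\<close>, found by exponential tilting with a \<open>P\<close>-harmonic extension to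
  the empty stations, makes time spent away from \<open>0\<close> costly. Hence a path of cost at most \<open>C\<close> visits
  \<open>0\<close>, and its last excursion from \<open>0\<close> has duration at most \<open>C / \<epsilon>\<close>; so \<open>c(x, t, y) = V y\<close> as soon as
  \<open>t\<close> is large in terms of \<open>C > V y\<close> and \<open>|x|\<close>. The limit deviability has density \<open>exp (- V)\<close>.

  The Lyapunov bound is integrated along paths by means of Lebesgue's theorem that functions of
  bounded variation are differentiable almost everywhere.\<close>

section \<open>Functions of bounded variation and absolutely continuous functions\<close>

text \<open>Equality at finite \<open>t\<close>, rather than in the limit, rests on monotonicity:
  waiting at \<open>0\<close> is free, so \<open>c(0, t, y)\<close> is nonincreasing in
  \<open>t\<close>, and as cheap excursions are short it has reached its infimum once
  \<open>t\<close> exceeds their longest duration. Where \<open>V y \<ge> C\<close> nothing has to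
  be computed: for large \<open>t\<close> both densities are at most \<open>exp (- C)\<close>, which
  makes the convergence uniform in \<open>y\<close>. Uniqueness uses compact level sets: where a
  stationary deviability is at least \<kappa>, \<open>x\<close> ranges over a bounded set, and all
  other \<open>x\<close> contribute less than \<kappa>.

  Two obstacles shape the analysis of paths. The Lagrangian jumps between faces, and its values
  along a path are not known to form a measurable function; so costs are lower integrals throughout.
  Paths are merely absolutely continuous; so the inequality for \<open>U\<close> holds only almost
  everywhere and must be integrated back. One linear \<open>U\<close> can serve all faces because a
  path that is differentiable at an interior time has a velocity tangent to the face it then lies
  in.\<close>

definition interval_partition :: "(nat \<Rightarrow> real) \<Rightarrow> nat \<Rightarrow> real \<Rightarrow> real \<Rightarrow> bool" where
  "interval_partition p n a b \<longleftrightarrow> mono_on {..n} p \<and> p 0 = a \<and> p n = b"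

definition partition_sum :: "(real \<Rightarrow> real) \<Rightarrow> (nat \<Rightarrow> real) \<Rightarrow> nat \<Rightarrow> real" where
  "partition_sum f p n = (\<Sum>i<n. \<bar>f (p (Suc i)) - f (p i)\<bar>)"

definition bounded_variation_on_Icc :: "(real \<Rightarrow> real) \<Rightarrow> real \<Rightarrow> real \<Rightarrow> bool" where
  "bounded_variation_on_Icc f a b \<longleftrightarrow>
     (\<exists>B. \<forall>p n. interval_partition p n a b \<longrightarrow> partition_sum f p n \<le> B)"

definition variation :: "(real \<Rightarrow> real) \<Rightarrow> real \<Rightarrow> real \<Rightarrow> real" where
  "variation f a x = Sup {partition_sum f p n | p n. interval_partition p n a x}"

lemma interval_partition_bounds:
  assumes "interval_partition p n a b" "i \<le> n"
  shows "a \<le> p i" "p i \<le> b"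
  using assms unfolding interval_partition_def mono_on_def by force+

lemma interval_partition_Suc:
  assumes "interval_partition p n a b" "i < n"
  shows "p i \<le> p (Suc i)"
  using assms unfolding interval_partition_def mono_on_def by auto

lemma interval_partition_extend:
  assumes "interval_partition p n a x" "x \<le> y"
  shows "interval_partition (p(Suc n := y)) (Suc n) a y"
    "partition_sum f (p(Suc n := y)) (Suc n) = partition_sum f p n + \<bar>f y - f x\<bar>"
proof -
  show "interval_partition (p(Suc n := y)) (Suc n) a y"
    using assms interval_partition_bounds[OF assms(1)]
    unfolding interval_partition_def mono_on_def
    by (auto simp: le_Suc_eq intro: order_trans[OF _ assms(2)])
  have "(\<Sum>i<n. \<bar>f ((p(Suc n := y)) (Suc i)) - f ((p(Suc n := y)) i)\<bar>) = partition_sum f p n"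
    unfolding partition_sum_def by (intro sum.cong) auto
  then show "partition_sum f (p(Suc n := y)) (Suc n) = partition_sum f p n + \<bar>f y - f x\<bar>"
    using assms by (simp add: partition_sum_def interval_partition_def)
qed

lemma interval_partition_trivial:
  assumes "a \<le> b"
  shows "interval_partition (\<lambda>i. if i = 0 then a else b) 1 a b"
  using assms by (auto simp: interval_partition_def mono_on_def)

lemma bounded_variation_on_Icc_mono:
  assumes "bounded_variation_on_Icc f a b" "x \<le> b"
  shows "bounded_variation_on_Icc f a x"
proof -
  obtain B where B: "\<And>p n. interval_partition p n a b \<Longrightarrow> partition_sum f p n \<le> B"
    using assms(1) by (auto simp: bounded_variation_on_Icc_def)
  have "partition_sum f p n \<le> B" if "interval_partition p n a x" for p n
    using B[OF interval_partition_extend(1)[OF that assms(2)]]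
      interval_partition_extend(2)[OF that assms(2), of f] by simp
  then show ?thesis by (auto simp: bounded_variation_on_Icc_def)
qed

lemma partition_sum_le_variation:
  assumes "bounded_variation_on_Icc f a x" "interval_partition p n a x"
  shows "partition_sum f p n \<le> variation f a x"
  unfolding variation_def
  by (rule cSup_upper) (use assms in \<open>auto simp: bounded_variation_on_Icc_def bdd_above_def\<close>)

lemma variation_approx:
  assumes "a \<le> x" "0 < e"
  obtains p n where "interval_partition p n a x" "variation f a x - e < partition_sum f p n"
proof -
  have "{partition_sum f p n | p n. interval_partition p n a x} \<noteq> {}"
    using interval_partition_trivial[OF assms(1)] by blast
  moreover have "variation f a x - e < Sup {partition_sum f p n | p n. interval_partition p n a x}"
    using assms by (simp add: variation_def)
  ultimately show thesis
    using less_cSupE that by blast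
qed

lemma variation_increment:
  assumes "bounded_variation_on_Icc f a b" "a \<le> x" "x \<le> y" "y \<le> b"
  shows "\<bar>f y - f x\<bar> \<le> variation f a y - variation f a x"
proof (rule field_le_epsilon)
  fix e :: real assume "0 < e"
  then obtain p n where p: "interval_partition p n a x" "variation f a x - e < partition_sum f p n"
    using variation_approx[of a x e f] assms by auto
  have "partition_sum f p n + \<bar>f y - f x\<bar> \<le> variation f a y"
    using partition_sum_le_variation[OF bounded_variation_on_Icc_mono[OF assms(1,4)]
        interval_partition_extend(1)[OF p(1) assms(3)]] interval_partition_extend(2)[OF p(1) assms(3), of f]
    by simp
  with p(2) show "\<bar>f y - f x\<bar> \<le> variation f a y - variation f a x + e" by simp
qed

text \<open>The definition numbers the intervals by naturals; enumerating an arbitrary finite index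
  set allows families indexed by the pieces of a tagged division.\<close>

lemma absolutely_continuous_on_IccD:
  assumes "absolutely_continuous_on_Icc f a b" "0 < e"
  shows "\<exists>d>0. \<forall>(I::'i set) l r. finite I \<and> (\<forall>i\<in>I. a \<le> l i \<and> l i \<le> r i \<and> r i \<le> b) \<and>
        disjoint_family_on (\<lambda>i. {l i<..<r i}) I \<and> (\<Sum>i\<in>I. r i - l i) < d
        \<longrightarrow> (\<Sum>i\<in>I. dist (f (l i)) (f (r i))) < e"
proof -
  obtain d where "d > 0" and d: "\<And>(n::nat) l r.
        (\<forall>i<n. a \<le> l i \<and> l i \<le> r i \<and> r i \<le> b) \<and>
        disjoint_family_on (\<lambda>i. {l i<..<r i}) {..<n} \<and> (\<Sum>i<n. r i - l i) < d
        \<Longrightarrow> (\<Sum>i<n. dist (f (l i)) (f (r i))) < e"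
    using assms unfolding absolutely_continuous_on_Icc_def by meson
  have "(\<Sum>i\<in>I. dist (f (l i)) (f (r i))) < e"
    if I: "finite I" and lr: "\<And>i. i \<in> I \<Longrightarrow> a \<le> l i \<and> l i \<le> r i \<and> r i \<le> b"
      and dis: "disjoint_family_on (\<lambda>i. {l i<..<r i}) I" and s: "(\<Sum>i\<in>I. r i - l i) < d"
    for I :: "'i set" and l r
  proof -
    obtain h where h: "bij_betw h {..<card I} I"
      using ex_bij_betw_nat_finite[OF I] by (auto simp: atLeast0LessThan)
    have hI: "h i \<in> I" if "i < card I" for i
      using h that by (auto simp: bij_betw_def)
    have "(\<Sum>i<card I. dist (f (l (h i))) (f (r (h i)))) < e"
    proof (rule d, intro conjI allI impI)
      show "disjoint_family_on (\<lambda>i. {l (h i)<..<r (h i)}) {..<card I}"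
        using dis h hI unfolding disjoint_family_on_def bij_betw_def inj_on_def
        by (metis lessThan_iff)
      show "(\<Sum>i<card I. r (h i) - l (h i)) < d"
        using s sum.reindex_bij_betw[OF h, of "\<lambda>i. r i - l i"] by simp
    qed (use lr hI in auto)
    then show ?thesis
      using sum.reindex_bij_betw[OF h, of "\<lambda>i. dist (f (l i)) (f (r i))"] by simp
  qed
  note main = this
  show ?thesis
    by (intro exI[of _ d] conjI allI impI \<open>d > 0\<close>, elim conjE, rule main) auto
qed

lemma interval_partition_disjoint:
  assumes "interval_partition p n a b"
  shows "disjoint_family_on (\<lambda>i. {p i<..<p (Suc i)}) {..<n}"
  unfolding disjoint_family_on_def
proof (intro ballI impI)
  have *: "{p i<..<p (Suc i)} \<inter> {p j<..<p (Suc j)} = {}" if "i < j" "j < n" for i j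
  proof -
    have "p (Suc i) \<le> p j"
      using assms that unfolding interval_partition_def mono_on_def by auto
    then show ?thesis by auto
  qed
  fix i j assume "i \<in> {..<n}" "j \<in> {..<n}" "i \<noteq> j"
  then show "{p i<..<p (Suc i)} \<inter> {p j<..<p (Suc j)} = {}"
    using *[of i j] *[of j i] by (cases "i < j") auto
qed

text \<open>Partitions of an interval shorter than \<open>d\<close> have partition sums below
  \<open>1\<close>, so the bound grows by at most \<open>1\<close> with each step of length
  \<open>d/2\<close>; halving \<open>d\<close> leaves room for the strict inequality.\<close>

lemma absolutely_continuous_imp_bounded_variation:
  fixes f :: "real \<Rightarrow> real"
  assumes "absolutely_continuous_on_Icc f a b" "a \<le> b"
  shows "bounded_variation_on_Icc f a b"
proof -
  obtain d where "0 < d" and d: "\<And>(I::nat set) l r. finite I \<and> (\<forall>i\<in>I. a \<le> l i \<and> l i \<le> r i \<and> r i \<le> b) \<and>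
        disjoint_family_on (\<lambda>i. {l i<..<r i}) I \<and> (\<Sum>i\<in>I. r i - l i) < d
        \<Longrightarrow> (\<Sum>i\<in>I. dist (f (l i)) (f (r i))) < 1"
    using absolutely_continuous_on_IccD[OF assms(1) zero_less_one, where 'i = nat] by blast
  have short: "partition_sum f p n < 1"
    if "interval_partition p n c e" "a \<le> c" "e \<le> b" "e - c < d" for p n c e
  proof -
    have "(\<Sum>i<n. p (Suc i) - p i) = e - c"
      using that(1) by (simp add: sum_lessThan_telescope interval_partition_def)
    moreover have "a \<le> p i \<and> p i \<le> p (Suc i) \<and> p (Suc i) \<le> b" if "i < n" for i
      using that interval_partition_bounds[of p n c e i] interval_partition_bounds[of p n c e "Suc i"]
        interval_partition_Suc[of p n c e i] \<open>interval_partition p n c e\<close> \<open>a \<le> c\<close> \<open>e \<le> b\<close> by simp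
    ultimately have "(\<Sum>i<n. dist (f (p i)) (f (p (Suc i)))) < 1"
      using d[of "{..<n}" p "\<lambda>i. p (Suc i)"] interval_partition_disjoint[OF that(1)] that(4) by simp
    then show ?thesis
      by (simp add: partition_sum_def dist_real_def abs_minus_commute)
  qed
  have "\<forall>p n x. interval_partition p n a x \<and> x \<le> b \<and> x \<le> a + real k * (d/2) \<longrightarrow> partition_sum f p n \<le> real k"
    for k
  proof (induction k)
    case 0
    show ?case
    proof (intro allI impI)
      fix p n x assume *: "interval_partition p n a x \<and> x \<le> b \<and> x \<le> a + real 0 * (d/2)"
      then have "p i = a" if "i \<le> n" for i
        using interval_partition_bounds[of p n a x i] that by auto
      then have "partition_sum f p n = 0" by (auto simp: partition_sum_def intro!: sum.neutral)
      then show "partition_sum f p n \<le> real 0" by simp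
    qed
  next
    case (Suc k)
    show ?case
    proof (intro allI impI)
      fix p n x assume *: "interval_partition p n a x \<and> x \<le> b \<and> x \<le> a + real (Suc k) * (d/2)"
      then have p: "interval_partition p n a x" by simp
      \<comment> \<open>The partition is cut at \<open>c\<close> by truncating its points from above
        and from below. Partitions may repeat points, so \<open>c\<close> need not be inserted, and
        only the piece across \<open>c\<close> uses the triangle inequality.\<close>
      define c where "c = min x (a + real k * (d/2))"
      have "a \<le> x" using interval_partition_bounds[OF p, of 0] by auto
      then have c: "a \<le> c" "c \<le> x" using \<open>0 < d\<close> by (auto simp: c_def)
      have p1: "interval_partition (\<lambda>i. min (p i) c) n a c"
        using p c unfolding interval_partition_def mono_on_def by (auto simp: min_def intro: order_trans)
      have p2: "interval_partition (\<lambda>i. max (p i) c) n c x"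
        using p c unfolding interval_partition_def mono_on_def by (auto simp: max_def intro: order_trans)
      have "partition_sum f p n \<le> partition_sum f (\<lambda>i. min (p i) c) n + partition_sum f (\<lambda>i. max (p i) c) n"
        unfolding partition_sum_def sum.distrib[symmetric]
      proof (rule sum_mono)
        fix i assume "i \<in> {..<n}"
        then have "p i \<le> p (Suc i)" using interval_partition_Suc[OF p] by auto
        then show "\<bar>f (p (Suc i)) - f (p i)\<bar>
           \<le> \<bar>f (min (p (Suc i)) c) - f (min (p i) c)\<bar> + \<bar>f (max (p (Suc i)) c) - f (max (p i) c)\<bar>"
          by (auto simp: min_def max_def)
      qed
      moreover have "partition_sum f (\<lambda>i. min (p i) c) n \<le> real k"
      proof -
        have "c \<le> b" "c \<le> a + real k * (d/2)" using * c by (auto simp: c_def)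
        with p1 show ?thesis using Suc.IH by blast
      qed
      moreover have "partition_sum f (\<lambda>i. max (p i) c) n < 1"
      proof (rule short[OF p2 c(1)])
        have "real (Suc k) * (d/2) = real k * (d/2) + d/2" by (simp add: algebra_simps)
        then have "x \<le> a + (real k * (d/2) + d/2)" using * by metis
        then show "x - c < d" using \<open>0 < d\<close> unfolding c_def min_def by (cases "x \<le> a + real k * (d/2)") simp_all
      qed (use * in simp)
      ultimately show "partition_sum f p n \<le> real (Suc k)" by simp
    qed
  qed
  note bound = this
  obtain k :: nat where "(b - a) / (d/2) \<le> real k"
    using real_arch_simple by blast
  then have "b \<le> a + real k * (d/2)"
    using \<open>0 < d\<close> pos_divide_le_eq[of "d/2" "b - a" "real k"] by simp
  then have "partition_sum f p n \<le> real k" if "interval_partition p n a b" for p n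
    using bound[rule_format, of p n b k] that by simp
  then show ?thesis unfolding bounded_variation_on_Icc_def by blast
qed

section \<open>Vitali coverings and Lebesgue's differentiation theorem\<close>

text \<open>Induction removes the interval with the largest left end: by disjointness all others end
  before it, so the induction hypothesis applies to them up to that point.\<close>

lemma sum_disjoint_increments_le:
  fixes h :: "real \<Rightarrow> real"
  assumes "mono_on {a..b} h" "finite C" "a \<le> b"
    "\<And>i. i \<in> C \<Longrightarrow> a \<le> l i \<and> l i < r i \<and> r i \<le> b"
    "pairwise (\<lambda>i j. disjnt {l i..r i} {l j..r j}) C"
  shows "(\<Sum>i\<in>C. h (r i) - h (l i)) \<le> h b - h a"
  using assms
proof (induction "card C" arbitrary: C b)
  case 0
  then show ?case by (auto simp: mono_on_def)
next
  case (Suc n)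
  then have ne: "C \<noteq> {}" by auto
  have "Max (l ` C) \<in> l ` C" using Suc.prems(2) ne by simp
  then obtain i where "i \<in> C" "l i = Max (l ` C)" by auto
  then have i: "i \<in> C" "\<And>j. j \<in> C \<Longrightarrow> l j \<le> l i"
    using Suc.prems(2) by auto
  have il: "a \<le> l i" "l i < r i" "r i \<le> b" using Suc.prems(4)[OF i(1)] by auto
  have r: "r j \<le> l i" if "j \<in> C - {i}" for j
  proof (rule ccontr)
    assume "\<not> r j \<le> l i"
    moreover have "disjnt {l i..r i} {l j..r j}"
      using Suc.prems(5) i that by (auto simp: pairwise_def)
    ultimately show False
      using i(2)[of j] that il unfolding disjnt_iff by (metis Diff_iff atLeastAtMost_iff nle_le less_imp_le order_refl)
  qed
  have "(\<Sum>j\<in>C - {i}. h (r j) - h (l j)) \<le> h (l i) - h a"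
  proof (rule Suc.hyps(1))
    show "n = card (C - {i})" using Suc.hyps(2) i Suc.prems(2) by simp
    show "mono_on {a..l i} h" using Suc.prems(1) il by (auto intro: mono_on_subset)
    show "pairwise (\<lambda>i j. disjnt {l i..r i} {l j..r j}) (C - {i})"
      using Suc.prems(5) by (rule pairwise_subset) auto
  qed (use Suc.prems r il in auto)
  moreover have "h (r i) \<le> h b"
    using Suc.prems(1) il by (auto simp: mono_on_def)
  moreover have "(\<Sum>i\<in>C. h (r i) - h (l i)) = h (r i) - h (l i) + (\<Sum>j\<in>C - {i}. h (r j) - h (l j))"
    by (rule sum.remove[OF Suc.prems(2) i(1)])
  ultimately show ?case by linarith
qed

text \<open>Vitali's theorem selects countably many disjoint intervals that cover \<open>S\<close>
  up to a null set, and their total length is controlled by finite subfamilies. So it suffices to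
  bound finite disjoint families of eligible intervals; \<open>Q\<close> expresses
  eligibility.\<close>

lemma Vitali_cover_outer_measure_le:
  fixes S :: "real set"
  assumes cover: "\<And>x d. \<lbrakk>x \<in> S; 0 < d\<rbrakk> \<Longrightarrow> \<exists>s t. s \<le> x \<and> x \<le> t \<and> s < t \<and> t - s < d \<and> Q s t"
    and bound: "\<And>C. \<lbrakk>finite C; \<And>s t. (s, t) \<in> C \<Longrightarrow> s < t \<and> Q s t;
        pairwise (\<lambda>i j. disjnt {fst i..snd i} {fst j..snd j}) C\<rbrakk> \<Longrightarrow> (\<Sum>(s, t)\<in>C. t - s) \<le> B"
  shows "\<exists>T. S \<subseteq> T \<and> T \<in> lmeasurable \<and> measure lebesgue T \<le> B"
proof -
  define K where "K = {(s, t) | s t :: real. s < t \<and> Q s t}"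
  define ctr where "ctr = (\<lambda>(s, t). (s + t) / 2 :: real)"
  define rad where "rad = (\<lambda>(s, t). (t - s) / 2 :: real)"
  have cb: "cball (ctr i) (rad i) = {fst i..snd i}" for i
    by (cases i) (auto simp: ctr_def rad_def cball_eq_atLeastAtMost field_simps)
  have rpos: "0 < rad i" if "i \<in> K" for i using that by (auto simp: K_def rad_def)
  have cov: "\<exists>i. i \<in> K \<and> x \<in> cball (ctr i) (rad i) \<and> rad i < d" if x: "x \<in> S" "0 < d" for x d
  proof -
    obtain s t where "s \<le> x \<and> x \<le> t \<and> s < t \<and> t - s < d \<and> Q s t" using cover[OF x] by blast
    then have "(s, t) \<in> K \<and> x \<in> cball (ctr (s, t)) (rad (s, t)) \<and> rad (s, t) < d"
      unfolding cb by (auto simp: K_def rad_def)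
    then show ?thesis by blast
  qed
  obtain C where C: "countable C" "C \<subseteq> K"
     "pairwise (\<lambda>i j. disjnt (cball (ctr i) (rad i)) (cball (ctr j) (rad j))) C"
     "negligible (S - (\<Union>i \<in> C. cball (ctr i) (rad i)))"
    by (rule Vitali_covering_theorem_cballs[of K rad S ctr, OF rpos cov])
  define W where "W = (\<Union>i\<in>C. {fst i..snd i})"
  have mW: "W \<in> lmeasurable \<and> measure lebesgue W \<le> B"
  proof (unfold W_def, rule conjI)
    have *: "measure lebesgue (\<Union>i\<in>F. {fst i..snd i}) \<le> B" if F: "F \<subseteq> C" "finite F" for F
    proof -
      have "measure lebesgue (\<Union>i\<in>F. {fst i..snd i}) \<le> (\<Sum>i\<in>F. measure lebesgue {fst i..snd i})"
        by (rule measure_UNION_le) (use F in auto)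
      also have "\<dots> = (\<Sum>(s, t)\<in>F. t - s)"
        using F C(2) by (intro sum.cong) (auto simp: K_def less_imp_le split: prod.splits)
      also have "\<dots> \<le> B"
        using F C(2,3) by (intro bound) (auto simp: K_def cb intro: pairwise_subset)
      finally show ?thesis .
    qed
    show "(\<Union>i\<in>C. {fst i..snd i}) \<in> lmeasurable"
      by (rule fmeasurable_UN_bound[OF C(1), of _ _ B]) (use * in auto)
    show "measure lebesgue (\<Union>i\<in>C. {fst i..snd i}) \<le> B"
      by (rule measure_UN_bound[OF C(1), of _ _ B]) (use * in auto)
  qed
  let ?N = "S - (\<Union>i \<in> C. cball (ctr i) (rad i))"
  have "S \<subseteq> W \<union> ?N" by (auto simp: W_def cb)
  moreover have "W \<union> ?N \<in> lmeasurable"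
    using mW C(4) by (auto intro: fmeasurable.Un negligible_imp_measurable)
  moreover have "measure lebesgue (W \<union> ?N) \<le> B"
    using mW measure_Un_le[of W lebesgue ?N] C(4)
      negligible_imp_measure0[OF C(4)] by (simp add: fmeasurableD negligible_imp_sets)
  ultimately show ?thesis by blast
qed

lemma partition_point_between:
  assumes "interval_partition p n a b" "a < x" "x < b" "x \<notin> p ` {..n}"
  obtains i where "i < n" "p i < x" "x < p (Suc i)"
proof -
  have "\<exists>i<n. p i < x \<and> x < p (Suc i)"
  proof (rule ccontr)
    assume *: "\<not> (\<exists>i<n. p i < x \<and> x < p (Suc i))"
    have "i \<le> n \<Longrightarrow> p i < x" for i
    proof (induction i)
      case 0
      then show ?case using assms by (simp add: interval_partition_def)
    next
      case (Suc i)
      then have "p (Suc i) \<noteq> x" using assms(4) by auto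
      with Suc * show ?case by (metis Suc_le_lessD less_imp_le linorder_neqE_linordered_idom)
    qed
    from this[of n] show False using assms by (simp add: interval_partition_def)
  qed
  then show thesis using that by blast
qed

text \<open>On each piece of a nearly optimal partition the variation exceeds the increment of \<open>f\<close> by
  little, whereas intervals on which \<open>f\<close> moves against the increment contribute twice.\<close>

lemma negligible_opposite_slopes:
  assumes bv: "bounded_variation_on_Icc f a b" and "a < b" "0 < r"
  shows "negligible {x \<in> {a<..<b}.
    (\<forall>d>0. \<exists>s t. s \<le> x \<and> x \<le> t \<and> s < t \<and> t - s < d \<and> f t - f s \<le> - r * (t - s)) \<and>
    (\<forall>d>0. \<exists>s t. s \<le> x \<and> x \<le> t \<and> s < t \<and> t - s < d \<and> f t - f s \<ge> r * (t - s))}"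
    (is "negligible ?E")
  unfolding negligible_outer_le
proof (intro allI impI)
  fix e :: real assume "0 < e"
  let ?v = "variation f a"
  obtain p n where p: "interval_partition p n a b" and pe: "?v b - 2 * r * e < partition_sum f p n"
    using variation_approx[of a b "2 * r * e" f] \<open>0 < e\<close> assms by auto
  have va: "0 \<le> ?v a"
    using partition_sum_le_variation[OF bounded_variation_on_Icc_mono[OF bv], of a "\<lambda>_. a" 0] \<open>a < b\<close>
    by (simp add: partition_sum_def interval_partition_def mono_on_def)
  define sg where "sg i = (if f (p i) \<le> f (p (Suc i)) then 1 else - 1 :: real)" for i
  \<comment> \<open>On piece \<open>i\<close> the function \<open>h i\<close> is nondecreasing. On
    an interval where \<open>f\<close> moves against the direction \<open>sg i\<close> it gains at
    least \<open>2 * r * (t - s)\<close>: the variation gains \<open>r * (t - s)\<close> and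
    \<open>sg i * f\<close> loses as much. Over all pieces the gain is below
    \<open>2 * r * e\<close>, by the choice of the partition.\<close>
  define h where "h i x = ?v x - sg i * f x" for i x
  define Q where "Q s t \<longleftrightarrow> (\<exists>i<n. p i \<le> s \<and> t \<le> p (Suc i) \<and> 2 * r * (t - s) \<le> h i t - h i s)" for s t
  have pb: "a \<le> p i" "p i \<le> b" if "i \<le> n" for i
    using interval_partition_bounds[OF p that] .
  have inc: "\<bar>f t - f s\<bar> \<le> ?v t - ?v s" if "i < n" "p i \<le> s" "s \<le> t" "t \<le> p (Suc i)" for i s t
    using variation_increment[OF bv, of s t] that pb[of i] pb[of "Suc i"] by simp
  have hmono: "mono_on {p i..p (Suc i)} (h i)" if "i < n" for i
    unfolding mono_on_def h_def sg_def
  proof (intro allI impI)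
    fix s t assume "s \<in> {p i..p (Suc i)} \<and> t \<in> {p i..p (Suc i)} \<and> s \<le> t"
    then have "\<bar>f t - f s\<bar> \<le> ?v t - ?v s" using inc[OF that, of s t] by auto
    then show "?v s - (if f (p i) \<le> f (p (Suc i)) then 1 else - 1) * f s
        \<le> ?v t - (if f (p i) \<le> f (p (Suc i)) then 1 else - 1) * f t"
      by (auto split: if_splits)
  qed
  have "\<exists>T. ?E - p ` {..n} \<subseteq> T \<and> T \<in> lmeasurable \<and> measure lebesgue T \<le> e"
  proof (rule Vitali_cover_outer_measure_le[where Q = Q])
    fix x d :: real assume x: "x \<in> ?E - p ` {..n}" and "0 < d"
    then obtain i where i: "i < n" "p i < x" "x < p (Suc i)"
      using partition_point_between[OF p, of x] by auto
    \<comment> \<open>Intervals shorter than the distance from \<open>x\<close> to both neighbouring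
      partition points stay within one piece.\<close>
    define d' where "d' = min d (min (x - p i) (p (Suc i) - x))"
    have "0 < d'" using i \<open>0 < d\<close> by (auto simp: d'_def)
    then obtain s t where st: "s \<le> x" "x \<le> t" "s < t" "t - s < d'"
        "if f (p i) \<le> f (p (Suc i)) then f t - f s \<le> - r * (t - s) else f t - f s \<ge> r * (t - s)"
      using x by (cases "f (p i) \<le> f (p (Suc i))") auto
    have ps: "p i \<le> s" "t \<le> p (Suc i)" using st by (auto simp: d'_def)
    have "2 * r * (t - s) \<le> h i t - h i s"
      using inc[OF i(1), of s t] ps st(3,5) unfolding h_def sg_def
      by (cases "f (p i) \<le> f (p (Suc i))") auto
    then have "Q s t" using i ps by (auto simp: Q_def)
    then show "\<exists>s t. s \<le> x \<and> x \<le> t \<and> s < t \<and> t - s < d \<and> Q s t"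
      using st by (auto simp: d'_def)
  next
    fix C :: "(real \<times> real) set"
    assume C: "finite C" "\<And>s t. (s, t) \<in> C \<Longrightarrow> s < t \<and> Q s t"
      "pairwise (\<lambda>i j. disjnt {fst i..snd i} {fst j..snd j}) C"
    have "\<forall>c\<in>C. \<exists>i<n. p i \<le> fst c \<and> snd c \<le> p (Suc i) \<and> 2 * r * (snd c - fst c) \<le> h i (snd c) - h i (fst c)"
      using C(2) by (force simp: Q_def)
    then obtain g where g: "\<And>c. c \<in> C \<Longrightarrow> g c < n \<and> p (g c) \<le> fst c \<and> snd c \<le> p (Suc (g c)) \<and>
        2 * r * (snd c - fst c) \<le> h (g c) (snd c) - h (g c) (fst c)"
      by metis
    have "2 * r * (\<Sum>(s, t)\<in>C. t - s) = (\<Sum>c\<in>C. 2 * r * (snd c - fst c))"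
      by (simp add: sum_distrib_left split_def)
    also have "\<dots> = (\<Sum>i<n. \<Sum>c\<in>{c \<in> C. g c = i}. 2 * r * (snd c - fst c))"
      by (rule sum.group[symmetric]) (use C g in auto)
    also have "\<dots> \<le> (\<Sum>i<n. h i (p (Suc i)) - h i (p i))"
    proof (rule sum_mono)
      fix i assume "i \<in> {..<n}"
      then have i: "i < n" by simp
      have "(\<Sum>c\<in>{c \<in> C. g c = i}. 2 * r * (snd c - fst c)) \<le> (\<Sum>c\<in>{c \<in> C. g c = i}. h i (snd c) - h i (fst c))"
        by (rule sum_mono) (use g in auto)
      also have "\<dots> \<le> h i (p (Suc i)) - h i (p i)"
      proof (rule sum_disjoint_increments_le[OF hmono[OF i]])
        show "pairwise (\<lambda>i j. disjnt {fst i..snd i} {fst j..snd j}) {c \<in> C. g c = i}"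
          using C(3) by (rule pairwise_subset) auto
      qed (use C g interval_partition_Suc[OF p i] in force)+
      finally show "(\<Sum>c\<in>{c \<in> C. g c = i}. 2 * r * (snd c - fst c)) \<le> h i (p (Suc i)) - h i (p i)" .
    qed
    also have "\<dots> = (\<Sum>i<n. ?v (p (Suc i)) - ?v (p i)) - partition_sum f p n"
      unfolding partition_sum_def sum_subtractf[symmetric]
      by (intro sum.cong) (auto simp: h_def sg_def algebra_simps)
    also have "(\<Sum>i<n. ?v (p (Suc i)) - ?v (p i)) = ?v b - ?v a"
      using p by (simp add: sum_lessThan_telescope[of "\<lambda>i. ?v (p i)"] interval_partition_def)
    finally have "2 * r * (\<Sum>(s, t)\<in>C. t - s) \<le> 2 * r * e"
      using va pe by linarith
    then show "(\<Sum>(s, t)\<in>C. t - s) \<le> e" using \<open>0 < r\<close> by simp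
  qed
  then obtain T where T: "?E - p ` {..n} \<subseteq> T" "T \<in> lmeasurable" "measure lebesgue T \<le> e" by blast
  have fin: "negligible (p ` {..n})" by (simp add: negligible_finite)
  have "measure lebesgue (T \<union> p ` {..n}) \<le> e"
    using measure_Un_le[of T lebesgue "p ` {..n}"] T negligible_imp_measure0[OF fin] fin
    by (simp add: fmeasurableD negligible_imp_sets)
  moreover have "T \<union> p ` {..n} \<in> lmeasurable"
    using T fin by (auto intro: fmeasurable.Un negligible_imp_measurable)
  moreover have "?E \<subseteq> T \<union> p ` {..n}" using T(1) by auto
  ultimately show "\<exists>T. ?E \<subseteq> T \<and> T \<in> lmeasurable \<and> measure lebesgue T \<le> e" by blast
qed

text \<open>On an interval where the slope has modulus at least \<open>N\<close> the variation grows
  by at least \<open>N\<close> times the length, so disjoint intervals of this kind have total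
  length at most \<open>V / N\<close>.\<close>

lemma negligible_unbounded_slopes:
  assumes bv: "bounded_variation_on_Icc f a b" and "a < b"
  shows "negligible {x \<in> {a<..<b}. \<forall>N. \<forall>d>0.
    \<exists>s t. s \<le> x \<and> x \<le> t \<and> s < t \<and> t - s < d \<and> \<bar>f t - f s\<bar> \<ge> N * (t - s)}"
    (is "negligible ?E")
  unfolding negligible_outer_le
proof (intro allI impI)
  fix e :: real assume "0 < e"
  let ?v = "variation f a"
  define V where "V = ?v b - ?v a"
  have "0 \<le> V" using variation_increment[OF bv, of a b] \<open>a < b\<close> by (simp add: V_def)
  \<comment> \<open>The summand \<open>1\<close> keeps \<open>N\<close> positive when the variation
    vanishes.\<close>
  define N where "N = (V + 1) / e"
  have "0 < N" using \<open>0 \<le> V\<close> \<open>0 < e\<close> by (simp add: N_def)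
  have vmono: "mono_on {a..b} ?v"
    unfolding mono_on_def
  proof (intro allI impI)
    fix s t assume "s \<in> {a..b} \<and> t \<in> {a..b} \<and> s \<le> t"
    then show "?v s \<le> ?v t" using variation_increment[OF bv, of s t] by auto
  qed
  show "\<exists>T. ?E \<subseteq> T \<and> T \<in> lmeasurable \<and> measure lebesgue T \<le> e"
  proof (rule Vitali_cover_outer_measure_le[where Q = "\<lambda>s t. a \<le> s \<and> t \<le> b \<and> N * (t - s) \<le> ?v t - ?v s"])
    fix x d :: real assume x: "x \<in> ?E" and "0 < d"
    define d' where "d' = min d (min (x - a) (b - x))"
    have "0 < d'" using x \<open>0 < d\<close> by (auto simp: d'_def)
    then obtain s t where st: "s \<le> x" "x \<le> t" "s < t" "t - s < d'" "\<bar>f t - f s\<bar> \<ge> N * (t - s)"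
      using x by blast
    then have ab: "a \<le> s" "t \<le> b" "t - s < d" by (auto simp: d'_def)
    then have "N * (t - s) \<le> ?v t - ?v s"
      using st variation_increment[OF bv, of s t] by simp
    with st ab show "\<exists>s t. s \<le> x \<and> x \<le> t \<and> s < t \<and> t - s < d \<and> a \<le> s \<and> t \<le> b \<and> N * (t - s) \<le> ?v t - ?v s"
      by blast
  next
    fix C :: "(real \<times> real) set"
    assume C: "finite C" "\<And>s t. (s, t) \<in> C \<Longrightarrow> s < t \<and> a \<le> s \<and> t \<le> b \<and> N * (t - s) \<le> ?v t - ?v s"
      "pairwise (\<lambda>i j. disjnt {fst i..snd i} {fst j..snd j}) C"
    have "N * (\<Sum>(s, t)\<in>C. t - s) = (\<Sum>c\<in>C. N * (snd c - fst c))"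
      by (simp add: sum_distrib_left split_def)
    also have "\<dots> \<le> (\<Sum>c\<in>C. ?v (snd c) - ?v (fst c))"
      by (rule sum_mono) (use C(2) in force)
    also have "\<dots> \<le> V"
      unfolding V_def
      by (rule sum_disjoint_increments_le[OF vmono]) (use C \<open>a < b\<close> in force)+
    also have "\<dots> \<le> N * e" using \<open>0 < e\<close> by (simp add: N_def)
    finally show "(\<Sum>(s, t)\<in>C. t - s) \<le> e" using \<open>0 < N\<close> by simp
  qed
qed

text \<open>Subtracting \<open>m * x\<close> turns slopes on either side of \<open>m\<close> into
  slopes of opposite sign.\<close>

lemma bounded_variation_minus_linear:
  assumes "bounded_variation_on_Icc f a b"
  shows "bounded_variation_on_Icc (\<lambda>x. f x - m * x) a b"
proof -
  obtain B where B: "\<And>p n. interval_partition p n a b \<Longrightarrow> partition_sum f p n \<le> B"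
    using assms by (auto simp: bounded_variation_on_Icc_def)
  have "partition_sum (\<lambda>x. f x - m * x) p n \<le> B + \<bar>m\<bar> * (b - a)" if p: "interval_partition p n a b" for p n
  proof -
    have "partition_sum (\<lambda>x. f x - m * x) p n \<le> (\<Sum>i<n. \<bar>f (p (Suc i)) - f (p i)\<bar> + \<bar>m\<bar> * (p (Suc i) - p i))"
      unfolding partition_sum_def
    proof (rule sum_mono)
      fix i assume "i \<in> {..<n}"
      then have "\<bar>m * (p (Suc i) - p i)\<bar> = \<bar>m\<bar> * (p (Suc i) - p i)"
        using interval_partition_Suc[OF p] by (auto simp: abs_mult)
      then show "\<bar>f (p (Suc i)) - m * p (Suc i) - (f (p i) - m * p i)\<bar>
          \<le> \<bar>f (p (Suc i)) - f (p i)\<bar> + \<bar>m\<bar> * (p (Suc i) - p i)"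
        by (simp add: right_diff_distrib)
    qed
    also have "\<dots> = partition_sum f p n + \<bar>m\<bar> * (b - a)"
      using p by (simp add: sum.distrib partition_sum_def sum_distrib_left[symmetric]
          sum_lessThan_telescope interval_partition_def)
    finally show ?thesis using B[OF p] by simp
  qed
  then show ?thesis by (auto simp: bounded_variation_on_Icc_def)
qed

text \<open>Difference quotients are taken over short intervals that contain \<open>x\<close>,
  possibly as an end point, which covers both one-sided quotients at once. Off countably many null
  sets they stay bounded near \<open>x\<close>, and they cannot keep falling below one rational
  while exceeding a larger one; hence they converge.\<close>

theorem bounded_variation_differentiable_ae:
  fixes f :: "real \<Rightarrow> real"
  assumes bv: "bounded_variation_on_Icc f a b" and "a < b"
  obtains N where "negligible N"
    "\<And>x. x \<in> {a<..<b} - N \<Longrightarrow> \<exists>D. (f has_real_derivative D) (at x)"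
proof -
  define E where "E m r = {x \<in> {a<..<b}.
    (\<forall>d>0. \<exists>s t. s \<le> x \<and> x \<le> t \<and> s < t \<and> t - s < d \<and> f t - f s \<le> (m - r) * (t - s)) \<and>
    (\<forall>d>0. \<exists>s t. s \<le> x \<and> x \<le> t \<and> s < t \<and> t - s < d \<and> f t - f s \<ge> (m + r) * (t - s))}" for m r
  define E' where "E' = {x \<in> {a<..<b}. \<forall>N. \<forall>d>0.
    \<exists>s t. s \<le> x \<and> x \<le> t \<and> s < t \<and> t - s < d \<and> \<bar>f t - f s\<bar> \<ge> N * (t - s)}"
  have neg: "negligible (E m r)" if "0 < r" for m r
    using negligible_opposite_slopes[OF bounded_variation_minus_linear[OF bv] \<open>a < b\<close> that, of m]
    by (simp add: E_def algebra_simps)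
  define N where "N = E' \<union> (\<Union>(m, r)\<in>\<rat> \<times> (\<rat> \<inter> {0<..}). E m r)"
  have "countable (\<rat> \<times> (\<rat> \<inter> {0<..}) :: (real \<times> real) set)"
    by (intro countable_SIGMA countable_rat countable_Int1)
  then have "negligible N"
    unfolding N_def E'_def
    by (intro negligible_Un negligible_unbounded_slopes[OF assms] negligible_countable_Union)
       (auto intro: neg)
  moreover have "\<exists>D. (f has_real_derivative D) (at x)" if x: "x \<in> {a<..<b} - N" for x
  proof -
    define above where "above m \<longleftrightarrow> (\<exists>d>0. \<forall>s t. s \<le> x \<and> x \<le> t \<and> s < t \<and> t - s < d \<longrightarrow> f t - f s > m * (t - s))" for m
    define below where "below m \<longleftrightarrow> (\<exists>d>0. \<forall>s t. s \<le> x \<and> x \<le> t \<and> s < t \<and> t - s < d \<longrightarrow> f t - f s < m * (t - s))" for m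
    have ab: "above (m - r) \<or> below (m + r)" if "m \<in> \<rat>" "r \<in> \<rat>" "0 < r" for m r
    proof -
      have "x \<notin> E m r" using x that by (auto simp: N_def)
      moreover have "x \<in> E m r" if na: "\<not> above (m - r)" and nb: "\<not> below (m + r)"
      proof -
        have "\<forall>d>0. \<exists>s t. s \<le> x \<and> x \<le> t \<and> s < t \<and> t - s < d \<and> f t - f s \<le> (m - r) * (t - s)"
          using na unfolding above_def by (meson not_less)
        moreover have "\<forall>d>0. \<exists>s t. s \<le> x \<and> x \<le> t \<and> s < t \<and> t - s < d \<and> f t - f s \<ge> (m + r) * (t - s)"
          using nb unfolding below_def by (meson not_less)
        ultimately show ?thesis using x unfolding E_def by blast
      qed
      ultimately show ?thesis by blast
    qed
    obtain B d0 where B: "0 < d0" "\<And>s t. \<lbrakk>s \<le> x; x \<le> t; s < t; t - s < d0\<rbrakk> \<Longrightarrow> \<bar>f t - f s\<bar> < B * (t - s)"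
    proof -
      have "x \<notin> E'" "x \<in> {a<..<b}" using x by (auto simp: N_def)
      then obtain B d0 where "0 < d0"
        "\<not> (\<exists>s t. s \<le> x \<and> x \<le> t \<and> s < t \<and> t - s < d0 \<and> \<bar>f t - f s\<bar> \<ge> B * (t - s))"
        unfolding E'_def by blast
      then show thesis using that[of d0 B] not_le by blast
    qed
    have above_le: "m \<le> B" if m: "above m" for m
    proof -
      obtain d where d: "0 < d" "\<And>s t. \<lbrakk>s \<le> x; x \<le> t; s < t; t - s < d\<rbrakk> \<Longrightarrow> f t - f s > m * (t - s)"
        using m by (auto simp: above_def)
      define h where "h = min d d0 / 2"
      have h: "0 < h" "h < d" "h < d0" using d(1) B(1) by (auto simp: h_def)
      have "m * h < f (x + h) - f x" "\<bar>f (x + h) - f x\<bar> < B * h"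
        using d(2)[of x "x + h"] B(2)[of x "x + h"] h by simp_all
      then have "m * h < B * h" by linarith
      then show ?thesis using h by simp
    qed
    have aboveB: "above (- B)"
      unfolding above_def
    proof (intro exI[of _ d0] conjI allI impI)
      fix s t assume "s \<le> x \<and> x \<le> t \<and> s < t \<and> t - s < d0"
      then have "\<bar>f t - f s\<bar> < B * (t - s)" using B(2) by blast
      then show "- B * (t - s) < f t - f s" by simp
    qed (use B in auto)
    have above_anti: "above m'" if "above m" "m' \<le> m" for m m'
    proof -
      obtain d where d: "0 < d" "\<And>s t. \<lbrakk>s \<le> x; x \<le> t; s < t; t - s < d\<rbrakk> \<Longrightarrow> f t - f s > m * (t - s)"
        using \<open>above m\<close> by (auto simp: above_def)
      have "m' * (t - s) \<le> m * (t - s)" if "s < t" for s t :: real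
        using that \<open>m' \<le> m\<close> by (intro mult_right_mono) auto
      with d show ?thesis unfolding above_def by (meson le_less_trans)
    qed
    \<comment> \<open>The candidate derivative is the lower derivate; \<open>aboveB\<close> and
      \<open>above_le\<close> show that the set is nonempty and bounded above.\<close>
    define L where "L = Sup {m. above m}"
    have bdd: "bdd_above {m. above m}" using above_le by (auto simp: bdd_above_def)
    have aboveL: "above m" if mL: "m < L" for m
    proof -
      obtain m' where "above m'" "m < m'"
        using less_cSupE[OF mL[unfolded L_def]] aboveB by auto
      then show ?thesis using above_anti by simp
    qed
    have belowL: "below u" if Lu: "L < u" for u
    proof -
      obtain q1 where q1: "q1 \<in> \<rat>" "L < q1" "q1 < u" using Rats_dense_in_real[OF Lu] by blast
      obtain q2 where q2: "q2 \<in> \<rat>" "q1 < q2" "q2 < u" using Rats_dense_in_real[OF q1(3)] by blast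
      have "\<not> above q1" using q1(2) cSup_upper[OF _ bdd, of q1] by (auto simp: L_def)
      \<comment> \<open>The centre and the radius are chosen so that \<open>m - r = q1\<close> and
        \<open>m + r = q2\<close>.\<close>
      then have "below q2"
        using ab[of "(q1 + q2) / 2" "(q2 - q1) / 2"] q1 q2 by (simp add: field_simps)
      then obtain d where d: "0 < d" "\<And>s t. \<lbrakk>s \<le> x; x \<le> t; s < t; t - s < d\<rbrakk> \<Longrightarrow> f t - f s < q2 * (t - s)"
        by (auto simp: below_def)
      have "q2 * (t - s) \<le> u * (t - s)" if "s < t" for s t :: real
        using that q2 by (intro mult_right_mono) auto
      with d show ?thesis unfolding below_def by (meson less_le_trans)
    qed
    have "((\<lambda>y. (f y - f x) / (y - x)) \<longlongrightarrow> L) (at x)"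
    proof (rule order_tendstoI)
      fix m assume "m < L"
      then obtain d where d: "0 < d" "\<And>s t. \<lbrakk>s \<le> x; x \<le> t; s < t; t - s < d\<rbrakk> \<Longrightarrow> f t - f s > m * (t - s)"
        using aboveL[OF \<open>m < L\<close>] unfolding above_def by blast
      show "\<forall>\<^sub>F y in at x. m < (f y - f x) / (y - x)"
        unfolding eventually_at
      proof (intro exI[of _ d] conjI ballI impI)
        fix y assume y: "y \<noteq> x \<and> dist y x < d"
        show "m < (f y - f x) / (y - x)"
        proof (cases "x < y")
          case True
          then show ?thesis using d(2)[of x y] y by (simp add: dist_real_def pos_less_divide_eq)
        next
          case False
          then show ?thesis using d(2)[of y x] y by (simp add: dist_real_def neg_less_divide_eq algebra_simps)
        qed
      qed (rule d)
    next
      fix u assume "L < u"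
      then obtain d where d: "0 < d" "\<And>s t. \<lbrakk>s \<le> x; x \<le> t; s < t; t - s < d\<rbrakk> \<Longrightarrow> f t - f s < u * (t - s)"
        using belowL[OF \<open>L < u\<close>] unfolding below_def by blast
      show "\<forall>\<^sub>F y in at x. (f y - f x) / (y - x) < u"
        unfolding eventually_at
      proof (intro exI[of _ d] conjI ballI impI)
        fix y assume y: "y \<noteq> x \<and> dist y x < d"
        show "(f y - f x) / (y - x) < u"
        proof (cases "x < y")
          case True
          then show ?thesis using d(2)[of x y] y by (simp add: dist_real_def pos_divide_less_eq)
        next
          case False
          then show ?thesis using d(2)[of y x] y by (simp add: dist_real_def neg_divide_less_eq algebra_simps)
        qed
      qed (rule d)
    qed
    then show ?thesis by (auto simp: has_field_derivative_iff)
  qed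
  ultimately show thesis by (rule that)
qed

section \<open>The fundamental theorem of calculus for absolutely continuous functions\<close>

text \<open>At tags outside \<open>N\<close> the gauge comes from differentiability, and the error
  is proportional to the length. Pieces with tags in \<open>N\<close> are confined to an open
  \<open>U\<close> of small measure, so their total length is small and absolute continuity bounds
  the increments of \<open>f\<close>. Each kind of piece may use half of the error.\<close>

theorem absolutely_continuous_has_integral:
  fixes f :: "real \<Rightarrow> real"
  assumes ac: "absolutely_continuous_on_Icc f a b" and "a < b" and N: "negligible N"
    and der: "\<And>x. x \<in> {a..b} - N \<Longrightarrow> (f has_real_derivative g x) (at x within {a..b})"
  shows "((\<lambda>x. if x \<in> N then 0 else g x) has_integral f b - f a) {a..b}"
  unfolding has_integral_factor_content_real
proof (intro allI impI)
  let ?h = "\<lambda>x. if x \<in> N then 0 else g x"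
  fix e :: real assume "0 < e"
  define e' where "e' = e / 2"
  have "0 < e'" using \<open>0 < e\<close> by (simp add: e'_def)
  obtain d where "0 < d" and d: "\<And>(I::(real \<times> real set) set) l r. finite I \<and> (\<forall>i\<in>I. a \<le> l i \<and> l i \<le> r i \<and> r i \<le> b) \<and>
        disjoint_family_on (\<lambda>i. {l i<..<r i}) I \<and> (\<Sum>i\<in>I. r i - l i) < d
        \<Longrightarrow> (\<Sum>i\<in>I. dist (f (l i)) (f (r i))) < e' * (b - a)"
    using absolutely_continuous_on_IccD[OF ac, of "e' * (b - a)", where 'i = "real \<times> real set"]
      \<open>0 < e'\<close> \<open>a < b\<close> by (auto simp del: atLeastAtMost_iff)
  obtain U where U: "open U" "N \<subseteq> U" "U \<in> lmeasurable" "measure lebesgue U < d"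
  proof -
    obtain U where U: "open U" "N \<subseteq> U" "U - N \<in> lmeasurable" "emeasure lebesgue (U - N) < ennreal d"
      using sets_lebesgue_outer_open[OF negligible_imp_sets[OF N] \<open>0 < d\<close>] by blast
    have eq: "U = (U - N) \<union> N" using U by auto
    have "U \<in> lmeasurable"
      by (subst eq) (intro fmeasurable.Un U negligible_imp_measurable N)
    moreover have "measure lebesgue U \<le> measure lebesgue (U - N) + measure lebesgue N"
      by (subst eq) (intro measure_Un_le; use U N in \<open>auto simp: fmeasurableD negligible_imp_sets\<close>)
    moreover have "measure lebesgue (U - N) < d"
      using U(3,4) \<open>0 < d\<close> by (simp add: emeasure_eq_measure2 ennreal_less_iff)
    ultimately show thesis using that U negligible_imp_measure0[OF N] by simp
  qed
  have "\<forall>x. \<exists>d>0. x \<in> {a..b} - N \<longrightarrow>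
         (\<forall>y\<in>{a..b}. \<bar>y - x\<bar> < d \<longrightarrow> \<bar>f y - f x - g x * (y - x)\<bar> \<le> e' * \<bar>y - x\<bar>)"
  proof
    fix x
    show "\<exists>d>0. x \<in> {a..b} - N \<longrightarrow>
         (\<forall>y\<in>{a..b}. \<bar>y - x\<bar> < d \<longrightarrow> \<bar>f y - f x - g x * (y - x)\<bar> \<le> e' * \<bar>y - x\<bar>)"
    proof (cases "x \<in> {a..b} - N")
      case True
      then show ?thesis
        using der[OF True] \<open>0 < e'\<close>
        unfolding has_field_derivative_def has_derivative_within_alt by auto
    qed (auto intro: exI[of _ 1])
  qed
  then obtain \<delta> where \<delta>: "\<And>x. 0 < \<delta> x"
    "\<And>x y. \<lbrakk>x \<in> {a..b} - N; y \<in> {a..b}; \<bar>y - x\<bar> < \<delta> x\<rbrakk> \<Longrightarrow> \<bar>f y - f x - g x * (y - x)\<bar> \<le> e' * \<bar>y - x\<bar>"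
    by metis
  define \<gamma> where "\<gamma> x = (if x \<in> N then U else ball x (\<delta> x))" for x
  show "\<exists>d. gauge d \<and> (\<forall>p. p tagged_division_of {a..b} \<and> d fine p \<longrightarrow>
      norm ((\<Sum>(x, k)\<in>p. measure lborel k *\<^sub>R ?h x) - (f b - f a)) \<le> e * measure lborel {a..b})"
  proof (intro exI[of _ \<gamma>] conjI allI impI)
    show "gauge \<gamma>" using U \<delta>(1) by (auto simp: gauge_def \<gamma>_def)
    fix p assume "p tagged_division_of {a..b} \<and> \<gamma> fine p"
    then have ptag: "p tagged_division_of {a..b}" and fine: "\<gamma> fine p" by auto
    have finp: "finite p" using ptag by (simp add: tagged_division_of_finite)
    have k: "\<exists>u v. K = {u..v} \<and> u \<le> v \<and> u \<le> x \<and> x \<le> v \<and> a \<le> u \<and> v \<le> b" if xK: "(x, K) \<in> p" for x K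
    proof -
      have "x \<in> K" "K \<subseteq> {a..b}" using ptag xK by blast+
      moreover obtain u v where "K = {u..v}"
        using tagged_division_ofD(4)[OF ptag xK] by (auto simp: box_real)
      ultimately show ?thesis by force
    qed
    have fba: "f b - f a = (\<Sum>(x,K)\<in>p. f (Sup K) - f (Inf K))" "b - a = (\<Sum>(x,K)\<in>p. Sup K - Inf K)"
      using additive_tagged_division_1[OF less_imp_le[OF \<open>a < b\<close>] ptag, of f]
        additive_tagged_division_1[OF less_imp_le[OF \<open>a < b\<close>] ptag, of "\<lambda>x. x"] by simp_all
    define G where "G = {i \<in> p. fst i \<notin> N}"
    define I where "I = {i \<in> p. fst i \<in> N}"
    define F where "F = (\<lambda>(x, K). measure lborel K *\<^sub>R ?h x - (f (Sup K) - f (Inf K)))"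
    have pGI: "p = G \<union> I" "G \<inter> I = {}" "finite G" "finite I" using finp by (auto simp: G_def I_def)
    have "(\<Sum>(x, k)\<in>p. measure lborel k *\<^sub>R ?h x) - (f b - f a) = sum F p"
      unfolding fba F_def by (simp add: sum_subtractf split_def)
    also have "\<dots> = sum F G + sum F I"
      using pGI by (simp add: sum.union_disjoint)
    finally have eq: "(\<Sum>(x, k)\<in>p. measure lborel k *\<^sub>R ?h x) - (f b - f a) = sum F G + sum F I" .
    have "\<bar>sum F G\<bar> \<le> (\<Sum>(x, K)\<in>G. e' * (Sup K - Inf K))"
    proof (rule order_trans[OF sum_abs sum_mono])
      fix i assume i: "i \<in> G"
      obtain x K where xK: "i = (x, K)" by (cases i)
      have xp: "(x, K) \<in> p" "x \<notin> N" using i by (auto simp: G_def xK)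
      obtain u v where uv: "K = {u..v}" "u \<le> v" "u \<le> x" "x \<le> v" "a \<le> u" "v \<le> b"
        using k[OF xp(1)] by blast
      have "K \<subseteq> ball x (\<delta> x)" using fineD[OF fine xp(1)] xp(2) by (simp add: \<gamma>_def)
      moreover have "u \<in> K" "v \<in> K" using uv by auto
      ultimately have "u \<in> ball x (\<delta> x)" "v \<in> ball x (\<delta> x)" by blast+
      then have uvd: "\<bar>u - x\<bar> < \<delta> x" "\<bar>v - x\<bar> < \<delta> x" by (auto simp: dist_real_def abs_minus_commute)
      have "\<bar>f u - f x - g x * (u - x)\<bar> \<le> e' * (x - u)" "\<bar>f v - f x - g x * (v - x)\<bar> \<le> e' * (v - x)"
        using \<delta>(2)[of x u] \<delta>(2)[of x v] uv uvd xp(2) by auto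
      moreover have "(v - u) * g x - (f v - f u) = (f u - f x - g x * (u - x)) - (f v - f x - g x * (v - x))"
        by (simp add: algebra_simps)
      ultimately have "\<bar>(v - u) * g x - (f v - f u)\<bar> \<le> e' * (x - u) + e' * (v - x)" by linarith
      then show "\<bar>F i\<bar> \<le> (case i of (x, K) \<Rightarrow> e' * (Sup K - Inf K))"
        using uv xp by (simp add: F_def xK algebra_simps)
    qed
    also have "\<dots> \<le> (\<Sum>(x, K)\<in>p. e' * (Sup K - Inf K))"
    proof (rule sum_mono2)
      fix i assume "i \<in> p - G"
      then show "0 \<le> (case i of (x, K) \<Rightarrow> e' * (Sup K - Inf K))"
        using k[of "fst i" "snd i"] \<open>0 < e'\<close> by (auto simp: split_def)
    qed (use pGI finp in auto)
    also have "\<dots> = e' * (b - a)"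
      unfolding fba(2) by (simp add: sum_distrib_left split_def)
    finally have 1: "\<bar>sum F G\<bar> \<le> e' * (b - a)" .
    have disj: "disjoint_family_on (\<lambda>i. {Inf (snd i)<..<Sup (snd i)}) I"
      unfolding disjoint_family_on_def
    proof (intro ballI impI)
      fix i j assume ij: "i \<in> I" "j \<in> I" "i \<noteq> j"
      obtain x K y L where xy: "i = (x, K)" "j = (y, L)" by (cases i, cases j)
      have p: "(x, K) \<in> p" "(y, L) \<in> p" using ij by (auto simp: I_def xy)
      obtain u v where uv: "K = {u..v}" "u \<le> v" using k[OF p(1)] by blast
      obtain u' v' where uv': "L = {u'..v'}" "u' \<le> v'" using k[OF p(2)] by blast
      have "interior K \<inter> interior L = {}"
        using tagged_division_ofD(5)[OF ptag p] ij(3) xy by blast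
      then show "{Inf (snd i)<..<Sup (snd i)} \<inter> {Inf (snd j)<..<Sup (snd j)} = {}"
        using uv uv' by (simp add: xy interior_atLeastAtMost_real)
    qed
    \<comment> \<open>The open pieces are disjoint, so their total length is the measure of a subset
      of \<open>U\<close>.\<close>
    have "(\<Sum>i\<in>I. Sup (snd i) - Inf (snd i)) = (\<Sum>i\<in>I. measure lebesgue {Inf (snd i)<..<Sup (snd i)})"
    proof (rule sum.cong)
      fix i assume "i \<in> I"
      then obtain u v where "snd i = {u..v}" "u \<le> v" using k[of "fst i" "snd i"] by (auto simp: I_def)
      then show "Sup (snd i) - Inf (snd i) = measure lebesgue {Inf (snd i)<..<Sup (snd i)}" by simp
    qed simp
    also have "\<dots> = measure lebesgue (\<Union>i\<in>I. {Inf (snd i)<..<Sup (snd i)})"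
      by (rule measure_finite_Union[symmetric])
         (use pGI disj emeasure_lborel_box_finite[where 'a = real] in \<open>auto simp: box_real less_top[symmetric]\<close>)
    also have "\<dots> \<le> measure lebesgue U"
    proof (rule measure_mono_fmeasurable)
      show "(\<Union>i\<in>I. {Inf (snd i)<..<Sup (snd i)}) \<in> sets lebesgue"
        using pGI by (intro sets.finite_UN) auto
      show "(\<Union>i\<in>I. {Inf (snd i)<..<Sup (snd i)}) \<subseteq> U"
      proof
        fix z assume "z \<in> (\<Union>i\<in>I. {Inf (snd i)<..<Sup (snd i)})"
        then obtain i where i: "i \<in> I" "z \<in> {Inf (snd i)<..<Sup (snd i)}" by blast
        then have p: "(fst i, snd i) \<in> p" "fst i \<in> N" by (auto simp: I_def)
        obtain u v where "snd i = {u..v}" "u \<le> v" using k[OF p(1)] by blast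
        then have "z \<in> snd i" using i(2) by simp
        moreover have "snd i \<subseteq> U" using fineD[OF fine p(1)] p(2) by (simp add: \<gamma>_def)
        ultimately show "z \<in> U" by blast
      qed
    qed (use U in auto)
    finally have len: "(\<Sum>i\<in>I. Sup (snd i) - Inf (snd i)) < d" using U(4) by simp
    have "\<bar>sum F I\<bar> \<le> (\<Sum>i\<in>I. dist (f (Inf (snd i))) (f (Sup (snd i))))"
    proof (rule order_trans[OF sum_abs sum_mono])
      fix i assume "i \<in> I"
      then show "\<bar>F i\<bar> \<le> dist (f (Inf (snd i))) (f (Sup (snd i)))"
        by (simp add: F_def I_def split_def dist_real_def)
    qed
    also have "\<dots> < e' * (b - a)"
    proof (rule d, intro conjI ballI)
      fix i assume "i \<in> I"
      then obtain u v where "snd i = {u..v}" "u \<le> v" "a \<le> u" "v \<le> b" using k[of "fst i" "snd i"] by (auto simp: I_def)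
      then show "a \<le> Inf (snd i)" "Inf (snd i) \<le> Sup (snd i)" "Sup (snd i) \<le> b" by auto
    qed (use len disj pGI in auto)
    finally have 2: "\<bar>sum F I\<bar> < e' * (b - a)" .
    show "norm ((\<Sum>(x, k)\<in>p. measure lborel k *\<^sub>R ?h x) - (f b - f a)) \<le> e * measure lborel {a..b}"
      unfolding eq using 1 2 \<open>a < b\<close> by (simp add: e'_def)
  qed
qed

text \<open>\<open>G\<close> need not be measurable: almost everywhere the positive part of the
  derivative is a measurable minorant of it. For this nonnegative function the gauge integral and
  the Lebesgue integral agree, and it dominates the derivative, whose gauge integral is the
  increment.\<close>

theorem absolutely_continuous_increment_le_nn_integral:
  fixes f :: "real \<Rightarrow> real"
  assumes ac: "absolutely_continuous_on_Icc f a b" and "a \<le> b"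
    and le: "AE t in lebesgue. t \<in> {a<..<b} \<longrightarrow> (\<forall>D. (f has_real_derivative D) (at t) \<longrightarrow> ennreal D \<le> G t)"
  shows "ennreal (f b - f a) \<le> (\<integral>\<^sup>+t\<in>{a..b}. G t \<partial>lebesgue)"
proof (cases "a = b")
  case False
  then have "a < b" using assms by simp
  obtain N where N: "negligible N" "\<And>x. x \<in> {a<..<b} - N \<Longrightarrow> \<exists>D. (f has_real_derivative D) (at x)"
    using bounded_variation_differentiable_ae[OF absolutely_continuous_imp_bounded_variation[OF ac \<open>a \<le> b\<close>] \<open>a < b\<close>]
    by blast
  then obtain g where g: "\<And>x. x \<in> {a<..<b} - N \<Longrightarrow> (f has_real_derivative g x) (at x)"
    by metis
  define N' where "N' = N \<union> {a, b}"
  have N': "negligible N'" using N(1) by (simp add: N'_def)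
  define h where "h x = (if x \<in> N' then 0 else g x)" for x
  have hI: "(h has_integral f b - f a) {a..b}"
    unfolding h_def
  proof (rule absolutely_continuous_has_integral[OF ac \<open>a < b\<close> N'])
    fix x assume "x \<in> {a..b} - N'"
    then show "(f has_real_derivative g x) (at x within {a..b})"
      using g[of x] by (auto simp: N'_def intro: DERIV_subset)
  qed
  define k where "k x = max 0 (h x * indicator {a..b} x)" for x
  have km: "k \<in> lebesgue \<rightarrow>\<^sub>M borel"
    unfolding k_def using has_integral_implies_lebesgue_measurable_real[OF hI] by measurable
  have kG: "(\<integral>\<^sup>+t. ennreal (k t) \<partial>lebesgue) \<le> (\<integral>\<^sup>+t\<in>{a..b}. G t \<partial>lebesgue)"
  proof (rule nn_integral_mono_AE)
    have "AE t in lebesgue. t \<notin> N'"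
      using N' by (auto simp: negligible_iff_null_sets intro: AE_not_in)
    with le show "AE t in lebesgue. ennreal (k t) \<le> G t * indicator {a..b} t"
    proof eventually_elim
      case (elim t)
      show ?case
      proof (cases "t \<in> {a..b}")
        case True
        then have "t \<in> {a<..<b} - N" using elim(2) by (auto simp: N'_def)
        then have "ennreal (g t) \<le> G t" using elim(1) g by auto
        then show ?thesis using True by (auto simp: k_def h_def ennreal_max_0)
      qed (simp add: k_def)
    qed
  qed
  show ?thesis
  proof (cases "(\<integral>\<^sup>+t. ennreal (k t) \<partial>lebesgue) = \<infinity>")
    case True
    then show ?thesis using kG by (simp add: top_unique)
  next
    case False
    then obtain J where J: "(\<integral>\<^sup>+t. ennreal (k t) \<partial>lebesgue) = ennreal J" "0 \<le> J"
      by (cases "(\<integral>\<^sup>+t. ennreal (k t) \<partial>lebesgue)") auto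
    have "(k has_integral J) UNIV"
      by (subst has_integral_iff_nn_integral_lebesgue) (use J km in \<open>auto simp: k_def\<close>)
    moreover define h' where "h' x = (if x \<in> {a..b} then h x else 0)" for x
    have "(h' has_integral f b - f a) UNIV"
      using hI unfolding h'_def by (simp only: has_integral_restrict_UNIV)
    ultimately have "f b - f a \<le> J"
      by (intro has_integral_le[of h' "f b - f a" UNIV k J]) (auto simp: k_def h'_def)
    then show ?thesis using J kG by (metis ennreal_leI order_trans)
  qed
qed simp

section \<open>Path costs\<close>

text \<open>For a function that need not be measurable, \<open>\<integral>\<^sup>+\<close> is the lower integral. It is attained by a
  measurable minorant, which carries additivity over sets and translation invariance over.\<close>

lemma nn_integral_measurable_minorant:
  obtains g where "g \<in> borel_measurable M" "\<And>x. g x \<le> f x" "integral\<^sup>N M g = integral\<^sup>N M f"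
proof -
  let ?S = "{g. simple_function M g \<and> g \<le> f}"
  have "(\<lambda>_. 0) \<in> ?S" by (auto simp: le_fun_def)
  then have "?S \<noteq> {}" by blast
  then obtain F :: "nat \<Rightarrow> ennreal" where F: "range F \<subseteq> integral\<^sup>S M ` ?S" "Sup (integral\<^sup>S M ` ?S) = Sup (range F)"
    using ennreal_SUP_countable_SUP[of ?S "integral\<^sup>S M"] by blast
  then have "\<forall>n. \<exists>s. s \<in> ?S \<and> F n = integral\<^sup>S M s" by blast
  then obtain s where s: "\<And>n. s n \<in> ?S" "\<And>n. F n = integral\<^sup>S M (s n)" by metis
  define g where "g x = (SUP n. s n x)" for x
  have gm: "g \<in> borel_measurable M"
    unfolding g_def by (rule borel_measurable_SUP) (use s(1) borel_measurable_simple_function in auto)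
  have gf: "g x \<le> f x" for x
    unfolding g_def using s(1) by (auto intro!: SUP_least simp: le_fun_def)
  have "integral\<^sup>N M f = Sup (range F)"
    using F(2) by (simp add: nn_integral_def)
  also have "\<dots> \<le> integral\<^sup>N M g"
  proof (rule SUP_least)
    fix n
    have "F n = integral\<^sup>N M (s n)"
      using s by (simp add: nn_integral_eq_simple_integral)
    also have "\<dots> \<le> integral\<^sup>N M g"
      unfolding g_def by (intro nn_integral_mono SUP_upper) auto
    finally show "F n \<le> integral\<^sup>N M g" .
  qed
  finally have "integral\<^sup>N M f \<le> integral\<^sup>N M g" .
  moreover have "integral\<^sup>N M g \<le> integral\<^sup>N M f"
    by (intro nn_integral_mono gf)
  ultimately have "integral\<^sup>N M g = integral\<^sup>N M f" by simp
  with gm gf show thesis by (rule that)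
qed

lemma nn_set_integral_Un:
  assumes "A \<in> sets M" "B \<in> sets M" "A \<inter> B = {}"
  shows "(\<integral>\<^sup>+x\<in>A \<union> B. f x \<partial>M) = (\<integral>\<^sup>+x\<in>A. f x \<partial>M) + (\<integral>\<^sup>+x\<in>B. f x \<partial>M)"
proof (rule antisym)
  obtain g where g: "g \<in> borel_measurable M" "\<And>x. g x \<le> f x * indicator (A \<union> B) x"
    "integral\<^sup>N M g = (\<integral>\<^sup>+x\<in>A \<union> B. f x \<partial>M)"
    using nn_integral_measurable_minorant[of M "\<lambda>x. f x * indicator (A \<union> B) x"] by blast
  have "g x = g x * indicator A x + g x * indicator B x" for x
    using g(2)[of x] assms(3) by (auto split: split_indicator)
  then have "integral\<^sup>N M g = (\<integral>\<^sup>+x. g x * indicator A x + g x * indicator B x \<partial>M)" by simp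
  also have "\<dots> = (\<integral>\<^sup>+x\<in>A. g x \<partial>M) + (\<integral>\<^sup>+x\<in>B. g x \<partial>M)"
    using g(1) assms by (intro nn_integral_add) auto
  also have "\<dots> \<le> (\<integral>\<^sup>+x\<in>A. f x \<partial>M) + (\<integral>\<^sup>+x\<in>B. f x \<partial>M)"
  proof (intro add_mono nn_integral_mono)
    fix x
    show "g x * indicator A x \<le> f x * indicator A x" "g x * indicator B x \<le> f x * indicator B x"
      using g(2)[of x] by (auto split: split_indicator)
  qed
  finally show "(\<integral>\<^sup>+x\<in>A \<union> B. f x \<partial>M) \<le> (\<integral>\<^sup>+x\<in>A. f x \<partial>M) + (\<integral>\<^sup>+x\<in>B. f x \<partial>M)"
    using g(3) by simp
next
  obtain g where g: "g \<in> borel_measurable M" "\<And>x. g x \<le> f x * indicator A x"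
    "integral\<^sup>N M g = (\<integral>\<^sup>+x\<in>A. f x \<partial>M)"
    using nn_integral_measurable_minorant[of M "\<lambda>x. f x * indicator A x"] by blast
  obtain h where h: "h \<in> borel_measurable M" "\<And>x. h x \<le> f x * indicator B x"
    "integral\<^sup>N M h = (\<integral>\<^sup>+x\<in>B. f x \<partial>M)"
    using nn_integral_measurable_minorant[of M "\<lambda>x. f x * indicator B x"] by blast
  have "(\<integral>\<^sup>+x\<in>A. f x \<partial>M) + (\<integral>\<^sup>+x\<in>B. f x \<partial>M) = (\<integral>\<^sup>+x. g x + h x \<partial>M)"
    using g h by (simp add: nn_integral_add)
  also have "\<dots> \<le> (\<integral>\<^sup>+x\<in>A \<union> B. f x \<partial>M)"
  proof (intro nn_integral_mono)
    fix x show "g x + h x \<le> f x * indicator (A \<union> B) x"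
      using g(2)[of x] h(2)[of x] assms(3) by (auto split: split_indicator split_indicator_asm)
  qed
  finally show "(\<integral>\<^sup>+x\<in>A. f x \<partial>M) + (\<integral>\<^sup>+x\<in>B. f x \<partial>M) \<le> (\<integral>\<^sup>+x\<in>A \<union> B. f x \<partial>M)" .
qed

lemma nn_integral_lebesgue_shift:
  fixes f :: "real \<Rightarrow> ennreal"
  shows "(\<integral>\<^sup>+x. f (c + x) \<partial>lebesgue) = (\<integral>\<^sup>+x. f x \<partial>lebesgue)"
proof -
  have le: "(\<integral>\<^sup>+x. f x \<partial>lebesgue) \<le> (\<integral>\<^sup>+x. f (c + x) \<partial>lebesgue)" for f :: "real \<Rightarrow> ennreal" and c
  proof -
    obtain g where g: "g \<in> borel_measurable lebesgue" "\<And>x. g x \<le> f x"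
      "integral\<^sup>N lebesgue g = (\<integral>\<^sup>+x. f x \<partial>lebesgue)"
      using nn_integral_measurable_minorant by blast
    have "integral\<^sup>N lebesgue g = (\<integral>\<^sup>+x. g (c + x) \<partial>lebesgue)"
      using nn_integral_real_affine_lebesgue[OF g(1), of 1 c] by simp
    also have "\<dots> \<le> (\<integral>\<^sup>+x. f (c + x) \<partial>lebesgue)"
      using g(2) by (intro nn_integral_mono) auto
    finally show ?thesis using g(3) by simp
  qed
  have "(\<integral>\<^sup>+x. f (c + x) \<partial>lebesgue) \<le> (\<integral>\<^sup>+x. f (c + (- c + x)) \<partial>lebesgue)"
    by (rule le)
  then show ?thesis using le[of f c] by (intro antisym) auto
qed

lemma AE_lebesgue_neq: "AE t in lebesgue. t \<noteq> (a::real)"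
  by (rule AE_not_in[of "{a}", simplified]) (simp add: negligible_iff_null_sets[symmetric])

text \<open>The derivative is two-sided, whereas \<open>action\<close> uses the derivative within
  the half-line; for nonnegative times they can differ only at time \<open>0\<close>. The two-sided
  derivative depends only on the path near \<open>t\<close> and makes costs local.\<close>

definition path_cost :: "('v::real_normed_vector \<Rightarrow> 'v \<Rightarrow> ennreal) \<Rightarrow> (real \<Rightarrow> 'v) \<Rightarrow> real \<Rightarrow> real \<Rightarrow> ennreal" where
  "path_cost L q a b = (\<integral>\<^sup>+t\<in>{a..b}. L (q t) (vector_derivative q (at t)) \<partial>lebesgue)"

lemma path_cost_split:
  assumes "a \<le> b" "b \<le> c"
  shows "path_cost L q a c = path_cost L q a b + path_cost L q b c"
proof -
  have "{a..c} = {a..b} \<union> {b<..c}" using assms by auto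
  then have "path_cost L q a c = path_cost L q a b + (\<integral>\<^sup>+t\<in>{b<..c}. L (q t) (vector_derivative q (at t)) \<partial>lebesgue)"
    unfolding path_cost_def by (simp only:) (rule nn_set_integral_Un; auto)
  also have "(\<integral>\<^sup>+t\<in>{b<..c}. L (q t) (vector_derivative q (at t)) \<partial>lebesgue) = path_cost L q b c"
    unfolding path_cost_def
  proof (rule nn_integral_cong_AE)
    show "AE t in lebesgue. L (q t) (vector_derivative q (at t)) * indicator {b<..c} t =
        L (q t) (vector_derivative q (at t)) * indicator {b..c} t"
      using AE_lebesgue_neq[of b] by eventually_elim (auto split: split_indicator)
  qed
  finally show ?thesis .
qed

lemma vector_derivative_cong_open:
  assumes "open S" "t \<in> S" "\<And>s. s \<in> S \<Longrightarrow> q s = q' s"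
  shows "vector_derivative q (at t) = vector_derivative q' (at t)"
proof -
  have "\<forall>\<^sub>F s in nhds t. s \<in> UNIV \<longrightarrow> q s = q' s"
    unfolding eventually_nhds by (intro exI[of _ S]) (use assms in auto)
  then show ?thesis by (rule vector_derivative_cong_eq) (use assms in auto)
qed

lemma path_cost_cong:
  assumes "\<And>t. t \<in> {a<..<b} \<Longrightarrow> q t = q' t"
  shows "path_cost L q a b = path_cost L q' a b"
  unfolding path_cost_def
proof (rule nn_integral_cong_AE)
  show "AE t in lebesgue. L (q t) (vector_derivative q (at t)) * indicator {a..b} t =
        L (q' t) (vector_derivative q' (at t)) * indicator {a..b} t"
    using AE_lebesgue_neq[of a] AE_lebesgue_neq[of b]
  proof eventually_elim
    case (elim t)
    then show ?case
      using assms vector_derivative_cong_open[of "{a<..<b}" t q q'] by (auto split: split_indicator)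
  qed
qed

text \<open>Valid without differentiability: both sides choose from the same set of
  derivatives.\<close>

lemma vector_derivative_shift:
  "vector_derivative (\<lambda>s. q (s - c)) (at t) = vector_derivative q (at (t - c))"
proof -
  have *: "((\<lambda>s. q (s + c)) has_vector_derivative D) (at (t - c))"
    if "(q has_vector_derivative D) (at t)" for q :: "real \<Rightarrow> 'a" and D t c
  proof -
    have "((\<lambda>s. s + c) has_vector_derivative 1) (at (t - c))"
      by (auto intro!: derivative_eq_intros)
    from vector_diff_chain_at[OF this] that show ?thesis by (simp add: o_def)
  qed
  have "((\<lambda>s. q (s - c)) has_vector_derivative D) (at t) \<longleftrightarrow> (q has_vector_derivative D) (at (t - c))" for D
    using *[of "\<lambda>s. q (s - c)" D t c] *[of q D "t - c" "- c"] by auto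
  then show ?thesis by (simp add: vector_derivative_def)
qed

lemma path_cost_shift: "path_cost L (\<lambda>s. q (s - c)) (a + c) (b + c) = path_cost L q a b"
proof -
  have "path_cost L q a b = (\<integral>\<^sup>+t. L (q (- c + t)) (vector_derivative q (at (- c + t))) * indicator {a..b} (- c + t) \<partial>lebesgue)"
    unfolding path_cost_def by (rule nn_integral_lebesgue_shift[symmetric])
  also have "\<dots> = path_cost L (\<lambda>s. q (s - c)) (a + c) (b + c)"
    unfolding path_cost_def vector_derivative_shift
    by (intro nn_integral_cong) (auto split: split_indicator)
  finally show ?thesis by simp
qed

text \<open>The reparametrisations \<open>\<phi>\<close> and \<open>\<psi>\<close> map disjoint intervals to disjoint intervals that are no longer.\<close>

lemma absolutely_continuous_on_Icc_dominated:
  fixes f :: "real \<Rightarrow> 'f::metric_space" and g :: "real \<Rightarrow> 'g::metric_space" and h :: "real \<Rightarrow> 'h::metric_space"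
  assumes f: "absolutely_continuous_on_Icc f a b" and g: "absolutely_continuous_on_Icc g a' b'" and "0 < C"
    and \<phi>: "\<And>x. x \<in> {c..d} \<Longrightarrow> \<phi> x \<in> {a..b}" "\<And>x y. x \<le> y \<Longrightarrow> \<phi> x \<le> \<phi> y \<and> \<phi> y - \<phi> x \<le> y - x"
    and \<psi>: "\<And>x. x \<in> {c..d} \<Longrightarrow> \<psi> x \<in> {a'..b'}" "\<And>x y. x \<le> y \<Longrightarrow> \<psi> x \<le> \<psi> y \<and> \<psi> y - \<psi> x \<le> y - x"
    and h: "\<And>x y. \<lbrakk>c \<le> x; x \<le> y; y \<le> d\<rbrakk> \<Longrightarrow>
      dist (h x) (h y) \<le> C * (dist (f (\<phi> x)) (f (\<phi> y)) + dist (g (\<psi> x)) (g (\<psi> y)))"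
  shows "absolutely_continuous_on_Icc h c d"
  unfolding absolutely_continuous_on_Icc_def
proof (intro allI impI)
  let ?fam = "\<lambda>a b n l r d. (\<forall>i<n. a \<le> l i \<and> l i \<le> r i \<and> r i \<le> b) \<and>
        disjoint_family_on (\<lambda>i. {l i<..<r i}) {..<n::nat} \<and> (\<Sum>i<n. r i - l i) < (d::real)"
  have family: "?fam a b n (\<lambda>i. \<phi> (l i)) (\<lambda>i. \<phi> (r i)) \<delta>"
    if fam: "?fam c d n l r \<delta>" and \<phi>: "\<And>x. x \<in> {c..d} \<Longrightarrow> \<phi> x \<in> {a..b}"
      "\<And>x y. x \<le> y \<Longrightarrow> \<phi> x \<le> \<phi> y \<and> \<phi> y - \<phi> x \<le> y - x" for n l r \<delta> a b and \<phi> :: "real \<Rightarrow> real"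
  proof (intro conjI allI impI)
    fix i assume "i < n"
    then have i: "l i \<in> {c..d}" "r i \<in> {c..d}" "l i \<le> r i" using fam by force+
    show "a \<le> \<phi> (l i)" "\<phi> (l i) \<le> \<phi> (r i)" "\<phi> (r i) \<le> b"
      using \<phi>(1)[OF i(1)] \<phi>(1)[OF i(2)] \<phi>(2)[OF i(3)] by auto
  next
    have dis: "{\<phi> (l i)<..<\<phi> (r i)} \<inter> {\<phi> (l j)<..<\<phi> (r j)} = {}" if "i < n" "j < n" "i \<noteq> j" for i j
    proof (rule ccontr)
      assume "\<not> ?thesis"
      then obtain z where "z \<in> {\<phi> (l i)<..<\<phi> (r i)} \<inter> {\<phi> (l j)<..<\<phi> (r j)}" by blast
      then have z: "\<phi> (l i) < z" "z < \<phi> (r i)" "\<phi> (l j) < z" "z < \<phi> (r j)" by auto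
      then have "\<not> r i \<le> l j" "\<not> r j \<le> l i" using \<phi>(2) by force+
      moreover have "l i < r i" "l j < r j" using z fam that by (force simp: less_le)+
      ultimately have "max (l i) (l j) < min (r i) (r j)" by auto
      then obtain u where "max (l i) (l j) < u" "u < min (r i) (r j)" using dense by blast
      then have "u \<in> {l i<..<r i} \<inter> {l j<..<r j}" by auto
      moreover have "{l i<..<r i} \<inter> {l j<..<r j} = {}"
        using fam that by (auto simp: disjoint_family_on_def)
      ultimately show False by blast
    qed
    show "disjoint_family_on (\<lambda>i. {\<phi> (l i)<..<\<phi> (r i)}) {..<n}"
      unfolding disjoint_family_on_def using dis by blast
    have "(\<Sum>i<n. \<phi> (r i) - \<phi> (l i)) \<le> (\<Sum>i<n. r i - l i)" using fam \<phi>(2) by (intro sum_mono) auto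
    then show "(\<Sum>i<n. \<phi> (r i) - \<phi> (l i)) < \<delta>" using fam by linarith
  qed
  fix e :: real assume "0 < e"
  then have e: "0 < e / (2 * C)" using \<open>0 < C\<close> by simp
  obtain d1 where "0 < d1" and d1: "\<forall>n l r. ?fam a b n l r d1 \<longrightarrow> (\<Sum>i<n. dist (f (l i)) (f (r i))) < e / (2 * C)"
    using f e unfolding absolutely_continuous_on_Icc_def by meson
  obtain d2 where "0 < d2" and d2: "\<forall>n l r. ?fam a' b' n l r d2 \<longrightarrow> (\<Sum>i<n. dist (g (l i)) (g (r i))) < e / (2 * C)"
    using g e unfolding absolutely_continuous_on_Icc_def by meson
  show "\<exists>\<delta>>0. \<forall>n l r. ?fam c d n l r \<delta> \<longrightarrow> (\<Sum>i<n. dist (h (l i)) (h (r i))) < e"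
  proof (intro exI[of _ "min d1 d2"] conjI allI impI)
    fix n l r assume fam: "?fam c d n l r (min d1 d2)"
    have "(\<Sum>i<n. dist (h (l i)) (h (r i))) \<le> (\<Sum>i<n. C * (dist (f (\<phi> (l i))) (f (\<phi> (r i))) + dist (g (\<psi> (l i))) (g (\<psi> (r i)))))"
      using fam by (intro sum_mono h) auto
    also have "\<dots> = C * ((\<Sum>i<n. dist (f (\<phi> (l i))) (f (\<phi> (r i)))) + (\<Sum>i<n. dist (g (\<psi> (l i))) (g (\<psi> (r i)))))"
      by (simp only: sum_distrib_left[symmetric] sum.distrib)
    also have "\<dots> < C * (e / (2 * C) + e / (2 * C))"
      using family[OF fam \<phi>] family[OF fam \<psi>] \<open>0 < C\<close>
      by (intro mult_strict_left_mono add_strict_mono d1[rule_format] d2[rule_format]) auto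
    also have "\<dots> = e" using \<open>0 < C\<close> by simp
    finally show "(\<Sum>i<n. dist (h (l i)) (h (r i))) < e" .
  qed (use \<open>0 < d1\<close> \<open>0 < d2\<close> in simp)
qed

lemma absolutely_continuous_on_Icc_const: "absolutely_continuous_on_Icc (\<lambda>_. x) a b"
  unfolding absolutely_continuous_on_Icc_def by (auto intro!: exI[of _ 1])

lemma absolutely_continuous_on_Icc_subset:
  assumes "absolutely_continuous_on_Icc f a b" "a \<le> c" "d \<le> b"
  shows "absolutely_continuous_on_Icc f c d"
  by (rule absolutely_continuous_on_Icc_dominated[OF assms(1,1) zero_less_one, of _ _ "\<lambda>x. x" "\<lambda>x. x"]) (use assms in auto)

lemma absolutely_continuous_on_Icc_cong:
  assumes "absolutely_continuous_on_Icc f a b" "\<And>x. x \<in> {a..b} \<Longrightarrow> f x = g x"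
  shows "absolutely_continuous_on_Icc g a b"
  by (rule absolutely_continuous_on_Icc_dominated[OF assms(1,1) zero_less_one, of _ _ "\<lambda>x. x" "\<lambda>x. x"])
     (use assms(2)[symmetric] in auto)

lemma absolutely_continuous_on_Icc_shift:
  assumes "absolutely_continuous_on_Icc f a b"
  shows "absolutely_continuous_on_Icc (\<lambda>x. f (x - c)) (a + c) (b + c)"
  by (rule absolutely_continuous_on_Icc_dominated[OF assms assms zero_less_one, of _ _ "\<lambda>x. x - c" "\<lambda>x. x - c"]) auto

text \<open>Truncation by \<open>min\<close> and \<open>max\<close> at \<open>b\<close> splits an
  interval across the seam into its two parts.\<close>

lemma absolutely_continuous_on_Icc_join:
  assumes "absolutely_continuous_on_Icc f a b" "absolutely_continuous_on_Icc f b c" "a \<le> b" "b \<le> c"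
  shows "absolutely_continuous_on_Icc f a c"
proof (rule absolutely_continuous_on_Icc_dominated[OF assms(1,2) zero_less_one, of _ _ "\<lambda>x. min x b" "\<lambda>x. max x b"])
  fix x y :: real assume "x \<le> y"
  then show "dist (f x) (f y) \<le> 1 * (dist (f (min x b)) (f (min y b)) + dist (f (max x b)) (f (max y b)))"
    by (auto simp: min_def max_def dist_triangle)
qed (use assms in auto)

lemma absolutely_continuous_on_Icc_ident: "absolutely_continuous_on_Icc (\<lambda>x::real. x) a b"
  unfolding absolutely_continuous_on_Icc_def
proof (intro allI impI)
  fix e :: real assume "0 < e"
  have "(\<Sum>i<n. dist (l i) (r i)) = (\<Sum>i<n. r i - l i)" if "\<forall>i<n. l i \<le> r i" for n :: nat and l r :: "nat \<Rightarrow> real"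
    using that by (intro sum.cong) (auto simp: dist_real_def)
  with \<open>0 < e\<close> show "\<exists>d>0. \<forall>(n::nat) l r. (\<forall>i<n. a \<le> l i \<and> l i \<le> r i \<and> r i \<le> b) \<and>
      disjoint_family_on (\<lambda>i. {l i<..<r i}) {..<n} \<and> (\<Sum>i<n. r i - l i) < d \<longrightarrow> (\<Sum>i<n. dist (l i) (r i)) < e"
    by (intro exI[of _ e]) simp
qed

lemma absolutely_continuous_on_Icc_lipschitz:
  assumes "\<And>s t. \<lbrakk>s \<in> {a..b}; t \<in> {a..b}\<rbrakk> \<Longrightarrow> dist (f s) (f t) \<le> C * \<bar>s - t\<bar>" "0 \<le> C"
  shows "absolutely_continuous_on_Icc f a b"
proof (rule absolutely_continuous_on_Icc_dominated[OF absolutely_continuous_on_Icc_ident absolutely_continuous_on_Icc_ident,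
      of "C + 1" _ _ "\<lambda>x. x" a b "\<lambda>x. x" a b])
  fix x y assume xy: "a \<le> x" "x \<le> y" "y \<le> b"
  then have "dist (f x) (f y) \<le> C * \<bar>x - y\<bar>" by (intro assms) auto
  also have "\<dots> \<le> (C + 1) * (dist x y + dist x y)"
    using assms(2) by (intro mult_mono) (auto simp: dist_real_def)
  finally show "dist (f x) (f y) \<le> (C + 1) * (dist x y + dist x y)" .
qed (use assms in auto)

lemma absolutely_continuous_on_Icc_compose_lipschitz:
  assumes "absolutely_continuous_on_Icc f a b" "0 < C" "\<And>x y. dist (h x) (h y) \<le> C * dist x y"
  shows "absolutely_continuous_on_Icc (\<lambda>t. h (f t)) a b"
proof (rule absolutely_continuous_on_Icc_dominated[OF assms(1,1,2), of _ _ "\<lambda>x. x" "\<lambda>x. x"])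
  fix x y
  have "C * dist (f x) (f y) \<le> C * (dist (f x) (f y) + dist (f x) (f y))"
    using assms(2) by (intro mult_left_mono) auto
  with assms(3)[of "f x" "f y"] show "dist (h (f x)) (h (f y)) \<le> C * (dist (f x) (f y) + dist (f x) (f y))" by linarith
qed auto

lemma absolutely_continuous_on_Icc_add:
  fixes f g :: "real \<Rightarrow> 'v::real_normed_vector"
  assumes "absolutely_continuous_on_Icc f a b" "absolutely_continuous_on_Icc g a b"
  shows "absolutely_continuous_on_Icc (\<lambda>t. f t + g t) a b"
  by (rule absolutely_continuous_on_Icc_dominated[OF assms zero_less_one, of _ _ "\<lambda>x. x" "\<lambda>x. x"])
     (auto simp: dist_triangle_add)

lemma absolutely_continuous_on_Icc_imp_continuous_on:
  assumes "absolutely_continuous_on_Icc f a b"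
  shows "continuous_on {a..b} f"
  unfolding continuous_on_iff
proof (intro ballI allI impI)
  fix x and e :: real assume x: "x \<in> {a..b}" and "0 < e"
  then obtain d where "d > 0" and d: "\<forall>(n::nat) l r.
        (\<forall>i<n. a \<le> l i \<and> l i \<le> r i \<and> r i \<le> b) \<and>
        disjoint_family_on (\<lambda>i. {l i<..<r i}) {..<n} \<and> (\<Sum>i<n. r i - l i) < d
        \<longrightarrow> (\<Sum>i<n. dist (f (l i)) (f (r i))) < e"
    using assms(1) unfolding absolutely_continuous_on_Icc_def by meson
  have *: "dist (f u) (f v) < e" if "a \<le> u" "u \<le> v" "v \<le> b" "v - u < d" for u v
    using d[rule_format, of 1 "\<lambda>_. u" "\<lambda>_. v"] that by (auto simp: disjoint_family_on_def)
  show "\<exists>d>0. \<forall>x'\<in>{a..b}. dist x' x < d \<longrightarrow> dist (f x') (f x) < e"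
  proof (intro exI[of _ d] conjI ballI impI)
    fix y assume y: "y \<in> {a..b}" "dist y x < d"
    then show "dist (f y) (f x) < e"
      using *[of x y] *[of y x] x by (cases "x \<le> y") (auto simp: dist_commute dist_real_def)
  qed fact
qed

section \<open>Concatenation of paths and least transfer costs\<close>

definition join_paths :: "(real \<Rightarrow> 'v) \<Rightarrow> real \<Rightarrow> (real \<Rightarrow> 'v) \<Rightarrow> real \<Rightarrow> 'v" where
  "join_paths p s q r = (if r \<le> s then p r else q (r - s))"

lemma absolutely_continuous_join_paths:
  assumes "absolutely_continuous_on_Icc p 0 s" "absolutely_continuous_on_Icc q 0 t" "p s = q 0" "0 \<le> s" "0 \<le> t"
  shows "absolutely_continuous_on_Icc (join_paths p s q) 0 (s + t)"
proof (rule absolutely_continuous_on_Icc_join)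
  show "absolutely_continuous_on_Icc (join_paths p s q) 0 s"
    by (rule absolutely_continuous_on_Icc_cong[OF assms(1)]) (auto simp: join_paths_def)
  have "absolutely_continuous_on_Icc (\<lambda>r. q (r - s)) s (s + t)"
    using absolutely_continuous_on_Icc_shift[OF assms(2), of s] by (simp add: add.commute)
  then show "absolutely_continuous_on_Icc (join_paths p s q) s (s + t)"
    by (rule absolutely_continuous_on_Icc_cong) (use assms(3) in \<open>auto simp: join_paths_def\<close>)
qed (use assms in auto)

lemma path_cost_join_paths:
  assumes "0 \<le> s" "0 \<le> t"
  shows "path_cost L (join_paths p s q) 0 (s + t) = path_cost L p 0 s + path_cost L q 0 t"
proof -
  have "path_cost L (join_paths p s q) 0 s = path_cost L p 0 s"
    by (rule path_cost_cong) (auto simp: join_paths_def)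
  moreover have "path_cost L (join_paths p s q) s (s + t) = path_cost L (\<lambda>r. q (r - s)) s (s + t)"
    by (rule path_cost_cong) (auto simp: join_paths_def)
  moreover have "path_cost L (\<lambda>r. q (r - s)) s (s + t) = path_cost L q 0 t"
    using path_cost_shift[of L q s 0 t] by (simp add: add.commute)
  ultimately show ?thesis
    using path_cost_split[of 0 s "s + t" L "join_paths p s q"] assms by simp
qed

definition paths_between :: "'v::metric_space set \<Rightarrow> 'v \<Rightarrow> real \<Rightarrow> 'v \<Rightarrow> (real \<Rightarrow> 'v) set" where
  "paths_between S x t y = {q. absolutely_continuous_on_Icc q 0 t \<and> q ` {0..t} \<subseteq> S \<and> q 0 = x \<and> q t = y}"

definition transfer_cost :: "('v::real_normed_vector \<Rightarrow> 'v \<Rightarrow> ennreal) \<Rightarrow> 'v set \<Rightarrow> 'v \<Rightarrow> real \<Rightarrow> 'v \<Rightarrow> ennreal" where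
  "transfer_cost L S x t y = (INF q\<in>paths_between S x t y. path_cost L q 0 t)"

lemma transfer_cost_lessE:
  assumes "transfer_cost L S x t y < c"
  obtains q where "q \<in> paths_between S x t y" "path_cost L q 0 t < c"
  using assms by (auto simp: transfer_cost_def INF_less_iff)

lemma transfer_cost_le:
  "q \<in> paths_between S x t y \<Longrightarrow> transfer_cost L S x t y \<le> path_cost L q 0 t"
  by (auto simp: transfer_cost_def intro: INF_lower)

lemma join_paths_between:
  assumes "p \<in> paths_between S x s z" "q \<in> paths_between S z t y" "0 \<le> s" "0 \<le> t"
  shows "join_paths p s q \<in> paths_between S x (s + t) y"
proof -
  have "join_paths p s q ` {0..s + t} \<subseteq> S"
    using assms unfolding paths_between_def join_paths_def image_subset_iff by auto
  \<comment> \<open>For \<open>t = 0\<close> the value at the final time is taken from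
    \<open>p\<close>, hence the case distinction.\<close>
  moreover have "join_paths p s q (s + t) = y"
    using assms by (cases "t = 0") (auto simp: paths_between_def join_paths_def)
  ultimately show ?thesis
    using assms absolutely_continuous_join_paths[of p s q t]
    by (auto simp: paths_between_def join_paths_def)
qed

lemma transfer_cost_triangle:
  assumes "0 \<le> s" "0 \<le> t"
  shows "transfer_cost L S x (s + t) y \<le> transfer_cost L S x s z + transfer_cost L S z t y"
proof (rule ennreal_le_epsilon)
  fix e :: real
  assume fin: "transfer_cost L S x s z + transfer_cost L S z t y < top" and "0 < e"
  have e2: "0 < ennreal (e / 2)" using \<open>0 < e\<close> by simp
  have less: "c < c + ennreal (e / 2)" if "c < top" for c :: ennreal
    using ennreal_add_left_cancel_less[of c 0 "ennreal (e/2)"] that e2 by simp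
  have fin': "transfer_cost L S x s z < top" "transfer_cost L S z t y < top" using fin by auto
  have "transfer_cost L S x s z < transfer_cost L S x s z + ennreal (e / 2)"
    by (rule less[OF fin'(1)])
  then obtain p where p: "p \<in> paths_between S x s z" "path_cost L p 0 s < transfer_cost L S x s z + ennreal (e / 2)"
    by (rule transfer_cost_lessE)
  have "transfer_cost L S z t y < transfer_cost L S z t y + ennreal (e / 2)"
    by (rule less[OF fin'(2)])
  then obtain q where q: "q \<in> paths_between S z t y" "path_cost L q 0 t < transfer_cost L S z t y + ennreal (e / 2)"
    by (rule transfer_cost_lessE)
  have "transfer_cost L S x (s + t) y \<le> path_cost L p 0 s + path_cost L q 0 t"
    using transfer_cost_le[OF join_paths_between[OF p(1) q(1) assms], of L] path_cost_join_paths[OF assms] by metis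
  also have "\<dots> \<le> (transfer_cost L S x s z + ennreal (e / 2)) + (transfer_cost L S z t y + ennreal (e / 2))"
    using p(2) q(2) by (intro add_mono) auto
  also have "\<dots> = transfer_cost L S x s z + transfer_cost L S z t y + (ennreal (e / 2) + ennreal (e / 2))"
    by (simp add: ac_simps)
  also have "ennreal (e / 2) + ennreal (e / 2) = ennreal e"
    using \<open>0 < e\<close> by (simp flip: ennreal_plus)
  finally show "transfer_cost L S x (s + t) y \<le> transfer_cost L S x s z + transfer_cost L S z t y + ennreal e" .
qed

lemma paths_between_restrict:
  assumes "q \<in> paths_between S x (s + t) y" "0 \<le> s" "0 \<le> t"
  shows "q \<in> paths_between S x s (q s)" "(\<lambda>r. q (r + s)) \<in> paths_between S (q s) t y"
    "path_cost L q 0 (s + t) = path_cost L q 0 s + path_cost L (\<lambda>r. q (r + s)) 0 t"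
proof -
  have ac: "absolutely_continuous_on_Icc q 0 (s + t)" using assms by (simp add: paths_between_def)
  show "q \<in> paths_between S x s (q s)"
    using assms absolutely_continuous_on_Icc_subset[OF ac, of 0 s] by (auto simp: paths_between_def image_subset_iff)
  have "absolutely_continuous_on_Icc (\<lambda>r. q (r + s)) 0 t"
    using absolutely_continuous_on_Icc_shift[OF absolutely_continuous_on_Icc_subset[OF ac, of s "s + t"], of "- s"] assms
    by simp
  then show "(\<lambda>r. q (r + s)) \<in> paths_between S (q s) t y"
    using assms by (auto simp: paths_between_def image_subset_iff add.commute)
  show "path_cost L q 0 (s + t) = path_cost L q 0 s + path_cost L (\<lambda>r. q (r + s)) 0 t"
    using path_cost_split[of 0 s "s + t" L q] path_cost_shift[of L q "- s" s "s + t"] assms by simp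
qed

text \<open>Together with the triangle inequality this is the dynamic programming principle. The
  strict bound \<open>c\<close> replaces a minimiser, which need not exist: some path of cost below
  \<open>c\<close> is cut at time \<open>s\<close>.\<close>

lemma transfer_cost_intermediate:
  assumes "transfer_cost L S x (s + t) y < c" "0 \<le> s" "0 \<le> t"
  obtains z where "z \<in> S" "transfer_cost L S x s z + transfer_cost L S z t y < c"
proof -
  obtain q where q: "q \<in> paths_between S x (s + t) y" "path_cost L q 0 (s + t) < c"
    using assms(1) by (rule transfer_cost_lessE)
  note r = paths_between_restrict[OF q(1) assms(2,3)]
  have "transfer_cost L S x s (q s) + transfer_cost L S (q s) t y \<le> path_cost L q 0 (s + t)"
    unfolding r(3) by (intro add_mono transfer_cost_le r)
  moreover have "q s \<in> S" using r(1) assms by (auto simp: paths_between_def image_subset_iff)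
  ultimately show thesis using q(2) that le_less_trans by blast
qed

text \<open>The bound on \<open>L\<close> is asked for only strictly between the end times, since
  the end points may lie in smaller faces, where \<open>L\<close> takes other values.\<close>

lemma transfer_cost_line:
  assumes "convex S" "x \<in> S" "x + t *\<^sub>R d \<in> S" "0 \<le> t" and c: "0 \<le> c"
    and L: "\<And>s. 0 < s \<Longrightarrow> s < t \<Longrightarrow> L (x + s *\<^sub>R d) d \<le> ennreal c"
  shows "transfer_cost L S x t (x + t *\<^sub>R d) \<le> ennreal (c * t)"
proof -
  define q where "q s = x + s *\<^sub>R d" for s :: real
  have ac: "absolutely_continuous_on_Icc q 0 t"
  proof (rule absolutely_continuous_on_Icc_lipschitz[where C = "norm d"])
    fix u v :: real
    have "q u - q v = (u - v) *\<^sub>R d" by (simp add: q_def algebra_simps)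
    then show "dist (q u) (q v) \<le> norm d * \<bar>u - v\<bar>"
      by (simp add: dist_norm mult.commute)
  qed simp
  have qS: "q s \<in> S" if "s \<in> {0..t}" for s
  proof (cases "t = 0")
    case False
    have "q s = (1 - s / t) *\<^sub>R x + (s / t) *\<^sub>R (x + t *\<^sub>R d)"
      using False by (simp add: q_def algebra_simps)
    also have "\<dots> \<in> S"
      using that False assms by (intro convexD[OF assms(1)]) (auto simp: divide_simps)
    finally show ?thesis .
  qed (use that assms in \<open>auto simp: q_def\<close>)
  have der: "vector_derivative q (at s) = d" for s
    unfolding q_def by (intro vector_derivative_at) (auto intro!: derivative_eq_intros)
  have "q \<in> paths_between S x t (x + t *\<^sub>R d)"
    using ac qS by (auto simp: paths_between_def q_def)
  then have "transfer_cost L S x t (x + t *\<^sub>R d) \<le> path_cost L q 0 t"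
    by (rule transfer_cost_le)
  also have "\<dots> \<le> (\<integral>\<^sup>+s. ennreal c * indicator {0..t} s \<partial>lebesgue)"
    unfolding path_cost_def der
  proof (rule nn_integral_mono_AE)
    show "AE s in lebesgue. L (q s) d * indicator {0..t} s \<le> ennreal c * indicator {0..t} s"
      using AE_lebesgue_neq[of 0] AE_lebesgue_neq[of t]
      by eventually_elim (use L in \<open>auto split: split_indicator simp: q_def\<close>)
  qed
  also have "\<dots> = ennreal (c * t)"
    using \<open>0 \<le> t\<close> c by (simp add: nn_integral_cmult_indicator ennreal_mult)
  finally show ?thesis .
qed

section \<open>Substochastic matrices\<close>

declare transpose_matrix_vector [simp del]

lemma mult_vec_nth: "(A *v x) $ k = (\<Sum>l\<in>UNIV. A $ k $ l * x $ l)"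
  by (simp add: matrix_vector_mult_def)

lemma matrix_minus_vec: "((A - B) *v x) = A *v x - B *v (x :: 'a::comm_ring_1 ^ 'n)"
  by (simp add: vec_eq_iff mult_vec_nth left_diff_distrib sum_subtractf)

section \<open>Eigenvalues of substochastic matrices\<close>

text \<open>Finiteness gives meaning to the \<open>Max\<close> in \<open>spectral_radius\<close>.
  Eigenvalues are roots of the characteristic polynomial, which is nonzero because \<open>c0\<close>
  is not a root.\<close>

lemma finite_complex_eigenvalues:
  fixes A :: "complex ^ 'n ^ 'n"
  assumes "\<And>v. v \<noteq> 0 \<Longrightarrow> A *v v \<noteq> c0 *s v"
  shows "finite {c. \<exists>v. v \<noteq> 0 \<and> A *v v = c *s v}"
proof -
  \<comment> \<open>The determinant is formed over the ring of polynomials, with entries affine in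
    the eigenvalue; evaluation commutes with it.\<close>
  define p where "p = det (\<chi> i j. [:A $ i $ j, - (if i = j then 1 else 0):])"
  have poly_p: "poly p c = det (A - mat c)" for c
    unfolding p_def det_def poly_sum poly_mult poly_prod poly_of_int
    by (intro sum.cong refl arg_cong2[where f = "(*)"] prod.cong) (auto simp: mat_def)
  have ker: "(A - mat c) *v v = 0 \<longleftrightarrow> A *v v = c *s v" for c v
  proof -
    have "mat c *v v = c *s v"
      by (simp add: vec_eq_iff mult_vec_nth mat_def if_distrib[of "\<lambda>x. x * _"] cong: if_cong)
    then show ?thesis by (simp add: matrix_minus_vec)
  qed
  have det: "det (A - mat c) \<noteq> 0 \<longleftrightarrow> (\<forall>v. A *v v = c *s v \<longrightarrow> v = 0)" for c
    unfolding invertible_det_nz[symmetric] invertible_left_inverse matrix_left_invertible_ker ker ..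
  have "poly p c0 \<noteq> 0" unfolding poly_p det using assms by blast
  then have "finite {c. poly p c = 0}" by (intro poly_roots_finite) auto
  then show ?thesis
    by (rule rev_finite_subset) (use det poly_p in auto)
qed

text \<open>The eigenvalue equation is read in a coordinate where \<open>v\<close> has the largest
  modulus.\<close>

lemma row_substochastic_eigenvalue_le_1:
  fixes P :: "real ^ 'n ^ 'n"
  assumes "row_substochastic P" "v \<noteq> 0" "(\<chi> i j. complex_of_real (P $ i $ j)) *v v = c *s v"
  shows "cmod c \<le> 1"
proof -
  define m where "m = Max (range (\<lambda>k. cmod (v $ k)))"
  have le: "cmod (v $ k) \<le> m" for k unfolding m_def by (intro Max_ge) auto
  have "m \<in> range (\<lambda>k. cmod (v $ k))" unfolding m_def by (intro Max_in) auto
  then obtain k where k: "cmod (v $ k) = m" by auto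
  obtain j where "v $ j \<noteq> 0" using assms(2) by (auto simp: vec_eq_iff)
  then have "0 < m" using le[of j] by (meson less_le_trans zero_less_norm_iff)
  have "cmod c * m = cmod ((c *s v) $ k)" by (simp add: norm_mult k)
  also have "\<dots> = cmod (\<Sum>l\<in>UNIV. complex_of_real (P $ k $ l) * v $ l)"
    unfolding assms(3)[symmetric] by (simp add: mult_vec_nth)
  also have "\<dots> \<le> (\<Sum>l\<in>UNIV. P $ k $ l * m)"
  proof (rule order_trans[OF norm_sum sum_mono])
    fix l
    show "cmod (complex_of_real (P $ k $ l) * v $ l) \<le> P $ k $ l * m"
      using assms(1) le[of l] by (auto simp: norm_mult row_substochastic_def intro: mult_left_mono)
  qed
  also have "\<dots> = (\<Sum>l\<in>UNIV. P $ k $ l) * m" by (simp add: sum_distrib_right)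
  also have "\<dots> \<le> 1 * m"
    using assms(1) \<open>0 < m\<close> by (intro mult_right_mono) (auto simp: row_substochastic_def)
  finally show ?thesis using \<open>0 < m\<close> by simp
qed

lemma spectral_radius_less_1_imp_fixpoint_0:
  fixes P :: "real ^ 'n ^ 'n"
  assumes "row_substochastic P" "spectral_radius P < 1" "P *v u = u"
  shows "u = 0"
proof (rule ccontr)
  assume "u \<noteq> 0"
  let ?A = "\<chi> i j. complex_of_real (P $ i $ j)"
  let ?v = "\<chi> i. complex_of_real (u $ i)"
  have "?v \<noteq> 0" using \<open>u \<noteq> 0\<close> by (auto simp: vec_eq_iff)
  moreover have "?A *v ?v = 1 *s ?v"
  proof -
    have "(?A *v ?v) $ i = complex_of_real ((P *v u) $ i)" for i by (simp add: mult_vec_nth)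
    then show ?thesis using assms(3) by (simp add: vec_eq_iff)
  qed
  ultimately have "1 \<in> complex_spectrum P" unfolding complex_spectrum_def by blast
  \<comment> \<open>All eigenvalues have modulus at most \<open>1\<close>, so \<open>2\<close> is
    not one of them.\<close>
  moreover have "finite (complex_spectrum P)"
    unfolding complex_spectrum_def
    by (rule finite_complex_eigenvalues[where ?c0.0 = 2])
       (use row_substochastic_eigenvalue_le_1[OF assms(1)] in force)
  ultimately have "cmod 1 \<le> spectral_radius P"
    unfolding spectral_radius_def by (intro Max_ge imageI) auto
  then show False using assms(2) by simp
qed

text \<open>A positive strict supersolution \<open>w\<close> makes \<open>I - Q\<close> a nonsingular M-matrix.\<close>

definition strict_supersolution :: "real ^ 'n ^ 'n \<Rightarrow> real ^ 'n \<Rightarrow> bool" where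
  "strict_supersolution Q w \<longleftrightarrow>
     (\<forall>k l. 0 \<le> Q $ k $ l) \<and> (\<forall>k. 0 < w $ k) \<and> (\<forall>k. (Q *v w) $ k < w $ k)"

text \<open>Let \<open>m\<close> be the least ratio of \<open>u\<close> to \<open>w\<close>,
  attained at \<open>j\<close>. Nonnegativity of \<open>Q\<close> gives
  \<open>m * (Q *v w) $ j \<le> m * w $ j\<close>, and \<open>(Q *v w) $ j < w $ j\<close> then
  forces \<open>m \<ge> 0\<close>.\<close>

lemma strict_supersolution_minimum_principle:
  assumes "strict_supersolution Q w" "\<And>k. (Q *v u) $ k \<le> u $ k"
  shows "0 \<le> u $ k"
proof -
  define m where "m = Min (range (\<lambda>k. u $ k / w $ k))"
  have w: "0 < w $ k" for k using assms(1) by (simp add: strict_supersolution_def)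
  have "m \<le> u $ l / w $ l" for l unfolding m_def by (intro Min_le) auto
  then have le: "m * w $ l \<le> u $ l" for l using pos_le_divide_eq[OF w[of l]] by blast
  have "m \<in> range (\<lambda>k. u $ k / w $ k)" unfolding m_def by (intro Min_in) auto
  then obtain j where "m = u $ j / w $ j" by auto
  then have j: "u $ j = m * w $ j" using w[of j] by simp
  have "m * (Q *v w) $ j = (\<Sum>l\<in>UNIV. Q $ j $ l * (m * w $ l))"
    by (simp add: mult_vec_nth sum_distrib_left algebra_simps)
  also have "\<dots> \<le> (Q *v u) $ j"
    unfolding mult_vec_nth using assms(1) le by (intro sum_mono mult_left_mono) (auto simp: strict_supersolution_def)
  also have "\<dots> \<le> m * w $ j" using assms(2)[of j] j by simp
  finally have "m * (Q *v w) $ j \<le> m * w $ j" .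
  then have "0 \<le> m"
    using assms(1) by (auto simp: strict_supersolution_def mult_le_cancel_left not_less[symmetric])
  then have "0 \<le> m * w $ k" using w[of k] by simp
  with le[of k] show ?thesis by linarith
qed

lemma fixpoint_equation_solvable:
  fixes Q :: "real ^ 'n ^ 'n"
  assumes "\<And>u. Q *v u = u \<Longrightarrow> u = 0"
  obtains u where "u = Q *v u + b"
proof -
  let ?f = "\<lambda>u. u - Q *v u"
  have lin: "linear ?f"
    by (intro linear_compose_sub matrix_vector_mul_linear linear_ident)
  have "inj ?f"
    unfolding linear_injective_0[OF lin] using assms by auto
  with lin have "surj ?f" by (rule linear_inj_imp_surj)
  then obtain u where "b = ?f u" unfolding surj_def by blast
  then have "u = Q *v u + b" by simp
  then show thesis by (rule that)
qed

lemma strict_supersolution_fixpoint_0: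
  assumes "strict_supersolution Q w" "Q *v u = u"
  shows "u = 0"
proof -
  have "0 \<le> u $ k" for k
    by (rule strict_supersolution_minimum_principle[OF assms(1)]) (simp add: assms)
  moreover have "0 \<le> (- u) $ k" for k
  proof (rule strict_supersolution_minimum_principle[OF assms(1)])
    have "Q *v (- u) = - u" using assms(2) by (simp add: vec_eq_iff mult_vec_nth sum_negf)
    then show "(Q *v (- u)) $ k \<le> (- u) $ k" for k by simp
  qed
  ultimately show ?thesis by (simp add: vec_eq_iff order_antisym)
qed

lemma strict_supersolution_solvable:
  assumes "strict_supersolution Q w"
  obtains u where "u = Q *v u + b"
  using fixpoint_equation_solvable[of Q b] strict_supersolution_fixpoint_0[OF assms] by blast

text \<open>A negative minimum is impossible: row sums are at most \<open>1\<close>, so at a minimal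
  component \<open>P *v w\<close> would be at least that minimum, and the equation adds
  \<open>1\<close>.\<close>

lemma fixpoint_1_imp_strict_supersolution:
  assumes "row_substochastic P" "w = P *v w + 1"
  shows "strict_supersolution P w" "1 \<le> w $ k"
proof -
  define m where "m = Min (range (\<lambda>k. w $ k))"
  have le: "m \<le> w $ l" for l unfolding m_def by (intro Min_le) auto
  have "m \<in> range (\<lambda>k. w $ k)" unfolding m_def by (intro Min_in) auto
  then obtain j where j: "m = w $ j" by auto
  have eq: "w $ k = (P *v w) $ k + 1" for k using assms(2) by (metis one_index vector_add_component)
  have P0: "0 \<le> P $ k $ l" and P1: "(\<Sum>l\<in>UNIV. P $ k $ l) \<le> 1" for k l
    using assms(1) by (auto simp: row_substochastic_def)
  have ge: "(\<Sum>l\<in>UNIV. P $ k $ l) * m \<le> (P *v w) $ k" for k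
    unfolding mult_vec_nth sum_distrib_right by (intro sum_mono mult_left_mono P0 le)
  have "0 \<le> m"
  proof (rule ccontr)
    assume "\<not> 0 \<le> m"
    then have "1 * m \<le> (\<Sum>l\<in>UNIV. P $ j $ l) * m" using P1[of j] by (intro mult_right_mono_neg) auto
    then show False using ge[of j] eq[of j] j by simp
  qed
  then have Pw: "0 \<le> (P *v w) $ k" for k
    using ge[of k] P0 by (meson mult_nonneg_nonneg order_trans sum_nonneg)
  then show "1 \<le> w $ k" using eq[of k] by simp
  then show "strict_supersolution P w"
    unfolding strict_supersolution_def using P0 eq Pw
    by (metis add.commute less_add_one add_strict_increasing zero_less_one)
qed

lemma transpose_duality: "(\<Sum>k\<in>UNIV. u $ k * (transpose P *v x) $ k) = (\<Sum>k\<in>UNIV. (P *v u) $ k * (x :: real ^ 'n) $ k)"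
proof -
  have "(\<Sum>k\<in>UNIV. u $ k * (transpose P *v x) $ k) = (\<Sum>k\<in>UNIV. \<Sum>l\<in>UNIV. P $ l $ k * u $ k * x $ l)"
    by (simp add: mult_vec_nth transpose_def sum_distrib_left algebra_simps)
  also have "\<dots> = (\<Sum>l\<in>UNIV. \<Sum>k\<in>UNIV. P $ l $ k * u $ k * x $ l)" by (rule sum.swap)
  also have "\<dots> = (\<Sum>k\<in>UNIV. (P *v u) $ k * x $ k)"
    by (simp add: mult_vec_nth sum_distrib_right)
  finally show ?thesis .
qed

lemma transpose_fixpoint_duality:
  assumes "u = P *v u + b" "x = transpose P *v x + (c :: real ^ 'n)"
  shows "(\<Sum>k\<in>UNIV. u $ k * c $ k) = (\<Sum>k\<in>UNIV. b $ k * x $ k)"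
proof -
  have c: "c $ k = x $ k - (transpose P *v x) $ k" for k
    using assms(2) by (metis add_diff_cancel_left' vector_add_component)
  have b: "b $ k = u $ k - (P *v u) $ k" for k
    using assms(1) by (metis add_diff_cancel_left' vector_add_component)
  show ?thesis
    unfolding c b right_diff_distrib left_diff_distrib sum_subtractf transpose_duality ..
qed

locale stable_routing =
  fixes P :: "real ^ 'n ^ 'n"
  assumes sub: "row_substochastic P" and rad: "spectral_radius P < 1"
begin

lemma P_nonneg: "0 \<le> P $ k $ l" and P_row_le_1: "(\<Sum>l\<in>UNIV. P $ k $ l) \<le> 1"
  using sub by (auto simp: row_substochastic_def)

lemma fixpoint_0: "P *v u = u \<Longrightarrow> u = 0"
  by (rule spectral_radius_less_1_imp_fixpoint_0[OF sub rad])

text \<open>This is \<open>(I - P)^{-1} 1\<close>: the mean number of services that a job at a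
  station receives before it leaves the network.\<close>

definition work :: "real ^ 'n" where "work = (SOME w. w = P *v w + 1)"

lemma work_eq: "work = P *v work + 1"
proof -
  obtain w where "w = P *v w + 1" using fixpoint_equation_solvable[OF fixpoint_0] by blast
  then show ?thesis unfolding work_def by (rule someI)
qed

lemma work_eq_nth: "work $ k = (P *v work) $ k + 1"
  using work_eq by (metis one_index vector_add_component)

lemma work_supersolution: "strict_supersolution P work" and work_ge_1: "1 \<le> work $ k"
  using fixpoint_1_imp_strict_supersolution[OF sub work_eq] by blast+

lemma work_pos: "0 < work $ k"
  using work_ge_1[of k] by linarith

text \<open>By duality \<open>x $ k\<close> is the pairing of \<open>c\<close> with the solution of
  \<open>u = P *v u + axis k 1\<close>, which is nonnegative by the minimum principle.\<close>

lemma transpose_nonneg: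
  assumes "x = transpose P *v x + c" "\<And>k. 0 \<le> c $ k"
  shows "0 \<le> x $ k"
proof -
  obtain u where u: "u = P *v u + axis k 1"
    using strict_supersolution_solvable[OF work_supersolution] by blast
  have "0 \<le> u $ j" for j
  proof (rule strict_supersolution_minimum_principle[OF work_supersolution])
    fix j
    have "u $ j = (P *v u) $ j + axis k 1 $ j" using u by (metis vector_add_component)
    then show "(P *v u) $ j \<le> u $ j" by (simp add: axis_def split: if_splits)
  qed
  then have "0 \<le> (\<Sum>j\<in>UNIV. u $ j * c $ j)" using assms(2) by (intro sum_nonneg) auto
  also have "\<dots> = (\<Sum>j\<in>UNIV. axis k 1 $ j * x $ j)" by (rule transpose_fixpoint_duality[OF u assms(1)])
  also have "\<dots> = x $ k" by (simp add: axis_def if_distrib[of "\<lambda>x. x * _"] cong: if_cong)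
  finally show ?thesis .
qed

lemma transpose_fixpoint_0: "transpose P *v x = x \<Longrightarrow> x = 0"
proof -
  assume x: "transpose P *v x = x"
  have "0 \<le> x $ k" for k
    by (rule transpose_nonneg[of x 0]) (simp_all add: x)
  moreover have "0 \<le> (- x) $ k" for k
  proof (rule transpose_nonneg[of "- x" 0])
    have "transpose P *v (- x) = - x" using x by (simp add: vec_eq_iff mult_vec_nth sum_negf)
    then show "- x = transpose P *v (- x) + 0" by simp
  qed simp
  ultimately show ?thesis by (simp add: vec_eq_iff order_antisym)
qed

lemma transpose_solvable: obtains x where "x = transpose P *v x + c"
  using fixpoint_equation_solvable[OF transpose_fixpoint_0] by blast

lemma matrix_inv_transpose_fixpoint:
  "matrix_inv (mat 1 - transpose P) *v c = transpose P *v (matrix_inv (mat 1 - transpose P) *v c) + c"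
proof -
  let ?A = "mat 1 - transpose P"
  have "\<forall>x. ?A *v x = 0 \<longrightarrow> x = 0"
    using transpose_fixpoint_0 by (auto simp: matrix_minus_vec)
  then have "invertible ?A" by (simp add: invertible_left_inverse matrix_left_invertible_ker)
  then have "?A ** matrix_inv ?A = mat 1"
    unfolding invertible_def matrix_inv_def by (rule someI2_ex) simp
  then have "?A *v (matrix_inv ?A *v c) = c"
    by (simp add: matrix_vector_mul_assoc)
  then show ?thesis by (simp add: matrix_minus_vec algebra_simps)
qed

lemma transpose_supersolution:
  obtains w where "strict_supersolution (transpose P) w"
proof -
  obtain w where w: "w = transpose P *v w + 1" using transpose_solvable by blast
  have nth: "w $ k = (transpose P *v w) $ k + 1" for k
    using w by (metis one_index vector_add_component)
  have w0: "0 \<le> w $ k" for k by (rule transpose_nonneg[OF w]) simp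
  then have "0 \<le> (transpose P *v w) $ k" for k
    unfolding mult_vec_nth transpose_def by (intro sum_nonneg) (auto simp: P_nonneg)
  then have "0 < w $ k" "(transpose P *v w) $ k < w $ k" for k
    using nth[of k] by (metis add.commute add_strict_increasing zero_less_one, simp)
  then show thesis
    using that[of w] P_nonneg by (auto simp: strict_supersolution_def transpose_def)
qed

text \<open>Encodes a Dirichlet problem: \<open>u = rows_in J A *v u + b\<close> is the equation for
  \<open>A\<close> at the indices in \<open>J\<close>, while elsewhere the values of
  \<open>b\<close> are prescribed.\<close>

definition rows_in :: "'n set \<Rightarrow> real ^ 'n ^ 'n \<Rightarrow> real ^ 'n ^ 'n" where
  "rows_in J A = (\<chi> k l. if k \<in> J then A $ k $ l else 0)"

lemma rows_in_nth: "(rows_in J A *v x) $ k = (if k \<in> J then (A *v x) $ k else 0)"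
  by (simp add: rows_in_def mult_vec_nth)

lemma rows_in_supersolution:
  assumes "strict_supersolution A w"
  shows "strict_supersolution (rows_in J A) w"
  using assms unfolding strict_supersolution_def rows_in_nth by (auto simp: rows_in_def)

end

section \<open>Renewal rates\<close>

locale positive_variable = prob_space M for M :: "'a measure" +
  fixes X :: "'a \<Rightarrow> real"
  assumes rv: "random_variable borel X"
    and X_nonneg: "\<And>\<omega>. \<omega> \<in> space M \<Longrightarrow> 0 \<le> X \<omega>"
    and X_no_atom: "prob {\<omega> \<in> space M. X \<omega> = 0} = 0"
    and X_exp: "\<exists>\<theta>>0. integrable M (\<lambda>\<omega>. exp (\<theta> * X \<omega>))"
    and X_cdf: "\<exists>d>0. (cdf (distr M borel X) has_real_derivative d) (at 0 within {0..})"
begin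

abbreviation mgf :: "real \<Rightarrow> real" where
  "mgf \<theta> \<equiv> \<integral>\<omega>. exp (\<theta> * X \<omega>) \<partial>M"

lemma measurable_X [measurable]: "X \<in> borel_measurable M" using rv by simp

lemma integrable_exp_mono:
  assumes "integrable M (\<lambda>\<omega>. exp (\<theta>' * X \<omega>))" "\<theta> \<le> \<theta>'"
  shows "integrable M (\<lambda>\<omega>. exp (\<theta> * X \<omega>))"
proof (rule Bochner_Integration.integrable_bound[OF assms(1)])
  show "AE \<omega> in M. norm (exp (\<theta> * X \<omega>)) \<le> norm (exp (\<theta>' * X \<omega>))"
    using X_nonneg assms(2) by (intro AE_I2) (auto intro: mult_right_mono)
qed measurable

lemma integrable_exp_below_bound:
  assumes "ereal \<theta> < exp_moment_bound M X"
  shows "integrable M (\<lambda>\<omega>. exp (\<theta> * X \<omega>))"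
proof -
  obtain \<theta>' where "ereal \<theta> < ereal \<theta>'" "integrable M (\<lambda>\<omega>. exp (\<theta>' * X \<omega>))"
    using assms unfolding exp_moment_bound_def less_SUP_iff by auto
  then show ?thesis using integrable_exp_mono[of \<theta>' \<theta>] by simp
qed

lemma less_exp_moment_bound:
  assumes "integrable M (\<lambda>\<omega>. exp (\<theta>' * X \<omega>))" "0 \<le> \<theta>'" "\<theta> < \<theta>'"
  shows "ereal \<theta> < exp_moment_bound M X"
proof -
  have "ereal \<theta>' \<le> exp_moment_bound M X"
    unfolding exp_moment_bound_def using assms by (intro SUP_upper) auto
  then show ?thesis using assms(3) by (meson ereal_less_le less_ereal.simps(1) less_le_trans)
qed

lemma integrable_X: "integrable M X"
proof -
  obtain \<theta> where \<theta>: "0 < \<theta>" "integrable M (\<lambda>\<omega>. exp (\<theta> * X \<omega>))" using X_exp by blast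
  show ?thesis
  proof (rule Bochner_Integration.integrable_bound)
    show "integrable M (\<lambda>\<omega>. exp (\<theta> * X \<omega>) / \<theta>)" using \<theta>(2) by simp
    show "AE \<omega> in M. norm (X \<omega>) \<le> norm (exp (\<theta> * X \<omega>) / \<theta>)"
    proof (rule AE_I2)
      fix \<omega> assume "\<omega> \<in> space M"
      then have "0 \<le> X \<omega>" by (rule X_nonneg)
      moreover have "\<theta> * X \<omega> \<le> exp (\<theta> * X \<omega>)"
        using exp_ge_add_one_self[of "\<theta> * X \<omega>"] by linarith
      ultimately show "norm (X \<omega>) \<le> norm (exp (\<theta> * X \<omega>) / \<theta>)"
        using \<theta>(1) by (simp add: pos_le_divide_eq mult.commute)
    qed
  qed measurable
qed

lemma expectation_pos: "0 < expectation X"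
proof -
  have "0 \<le> expectation X" using X_nonneg by (intro integral_nonneg_AE AE_I2) auto
  moreover have "expectation X \<noteq> 0"
  proof
    assume "expectation X = 0"
    then have "AE \<omega> in M. X \<omega> = 0"
      using integral_nonneg_eq_0_iff_AE[OF integrable_X] X_nonneg by (auto intro: AE_I2)
    then have "prob {\<omega> \<in> space M. X \<omega> = 0} = 1"
      by (intro prob_Collect_eq_1[THEN iffD2]) auto
    then show False using X_no_atom by simp
  qed
  ultimately show ?thesis by simp
qed

text \<open>Jensen's inequality, by way of the tangent of \<open>exp\<close> at
  \<open>\<theta> * expectation X\<close>.\<close>

lemma mgf_ge:
  assumes "integrable M (\<lambda>\<omega>. exp (\<theta> * X \<omega>))"
  shows "exp (\<theta> * expectation X) \<le> mgf \<theta>"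
proof -
  let ?m = "expectation X"
  have "exp (\<theta> * ?m) = (\<integral>\<omega>. exp (\<theta> * ?m) * (1 + \<theta> * (X \<omega> - ?m)) \<partial>M)"
    using integrable_X by (simp add: prob_space)
  also have "\<dots> \<le> mgf \<theta>"
  proof (rule integral_mono)
    show "integrable M (\<lambda>\<omega>. exp (\<theta> * ?m) * (1 + \<theta> * (X \<omega> - ?m)))"
      using integrable_X by simp
    fix \<omega>
    have "exp (\<theta> * ?m) * (1 + \<theta> * (X \<omega> - ?m)) \<le> exp (\<theta> * ?m) * exp (\<theta> * (X \<omega> - ?m))"
      by (intro mult_left_mono exp_ge_add_one_self) auto
    also have "\<dots> = exp (\<theta> * X \<omega>)" by (simp add: exp_add[symmetric] algebra_simps)
    finally show "exp (\<theta> * ?m) * (1 + \<theta> * (X \<omega> - ?m)) \<le> exp (\<theta> * X \<omega>)" .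
  qed fact
  finally show ?thesis .
qed

lemma mgf_pos: "integrable M (\<lambda>\<omega>. exp (\<theta> * X \<omega>)) \<Longrightarrow> 0 < mgf \<theta>"
  using mgf_ge exp_gt_zero less_le_trans by blast

lemma ln_mgf_ge:
  "integrable M (\<lambda>\<omega>. exp (\<theta> * X \<omega>)) \<Longrightarrow> \<theta> * expectation X \<le> ln (mgf \<theta>)"
  using mgf_ge mgf_pos by (simp add: ln_ge_iff)

text \<open>In the second-order Taylor remainder one half of the exponent \<theta>0 dominates the
  exponential and the other half the square of \<open>X\<close>; this is the origin of the radius
  \<open>\<theta>0 / 2\<close> and of the constant \<open>c\<close>.\<close>

lemma ln_mgf_le_quadratic:
  obtains K r where "0 \<le> K" "0 < r"
    "\<And>\<theta>. \<bar>\<theta>\<bar> \<le> r \<Longrightarrow> ereal \<theta> < exp_moment_bound M X \<and> ln (mgf \<theta>) \<le> \<theta> * expectation X + K * \<theta>\<^sup>2"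
proof -
  obtain \<theta>0 where \<theta>0: "0 < \<theta>0" "integrable M (\<lambda>\<omega>. exp (\<theta>0 * X \<omega>))" using X_exp by blast
  define c where "c = 4 / \<theta>0\<^sup>2"
  define K where "K = c * mgf \<theta>0"
  have "0 < c" using \<theta>0 by (simp add: c_def)
  then have "0 \<le> K" using mgf_pos[OF \<theta>0(2)] by (simp add: K_def)
  moreover have "ereal \<theta> < exp_moment_bound M X \<and> ln (mgf \<theta>) \<le> \<theta> * expectation X + K * \<theta>\<^sup>2"
    if \<theta>: "\<bar>\<theta>\<bar> \<le> \<theta>0 / 2" for \<theta>
  proof
    have "\<theta> < \<theta>0" using \<theta> \<theta>0(1) by linarith
    then show "ereal \<theta> < exp_moment_bound M X"
      using \<theta>0 by (intro less_exp_moment_bound) auto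
    then have int: "integrable M (\<lambda>\<omega>. exp (\<theta> * X \<omega>))" by (rule integrable_exp_below_bound)
    have "mgf \<theta> \<le> (\<integral>\<omega>. 1 + \<theta> * X \<omega> + \<theta>\<^sup>2 * (c * exp (\<theta>0 * X \<omega>)) \<partial>M)"
    proof (rule integral_mono[OF int])
      show "integrable M (\<lambda>\<omega>. 1 + \<theta> * X \<omega> + \<theta>\<^sup>2 * (c * exp (\<theta>0 * X \<omega>)))"
        using integrable_X \<theta>0 by simp
      fix \<omega> assume "\<omega> \<in> space M"
      then have X: "0 \<le> X \<omega>" by (rule X_nonneg)
      obtain t where t: "\<bar>t\<bar> \<le> \<bar>\<theta> * X \<omega>\<bar>" "exp (\<theta> * X \<omega>) = 1 + \<theta> * X \<omega> + exp t / 2 * (\<theta> * X \<omega>)\<^sup>2"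
        using Maclaurin_exp_le[of "\<theta> * X \<omega>" 2] by (auto simp: numeral_2_eq_2)
      define z where "z = \<theta>0 * X \<omega> / 2"
      have "0 \<le> z" using X \<theta>0 by (simp add: z_def)
      have "\<bar>\<theta> * X \<omega>\<bar> \<le> z"
        using mult_right_mono[OF \<theta> X] X by (simp add: abs_mult z_def)
      then have "exp t \<le> exp z" using t(1) by simp
      moreover have "z\<^sup>2 / 2 \<le> exp z"
        using exp_lower_Taylor_quadratic[OF \<open>0 \<le> z\<close>] \<open>0 \<le> z\<close> by linarith
      ultimately have "exp t * (z\<^sup>2 / 2) \<le> exp z * exp z"
        by (intro mult_mono) auto
      also have "\<dots> = exp (\<theta>0 * X \<omega>)" by (simp add: z_def exp_add[symmetric])
      finally have *: "exp t * (z\<^sup>2 / 2) \<le> exp (\<theta>0 * X \<omega>)" .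
      have "exp t / 2 * (\<theta> * X \<omega>)\<^sup>2 = \<theta>\<^sup>2 * (c * (exp t * (z\<^sup>2 / 2)))"
        using \<theta>0 by (simp add: c_def z_def power2_eq_square field_simps)
      also have "\<dots> \<le> \<theta>\<^sup>2 * (c * exp (\<theta>0 * X \<omega>))"
        using * \<open>0 < c\<close> by (intro mult_left_mono) auto
      finally show "exp (\<theta> * X \<omega>) \<le> 1 + \<theta> * X \<omega> + \<theta>\<^sup>2 * (c * exp (\<theta>0 * X \<omega>))"
        unfolding t(2) by simp
    qed
    also have "\<dots> = 1 + \<theta> * expectation X + K * \<theta>\<^sup>2"
      using integrable_X \<theta>0 by (simp add: prob_space K_def)
    finally have "mgf \<theta> - 1 \<le> \<theta> * expectation X + K * \<theta>\<^sup>2" by simp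
    then show "ln (mgf \<theta>) \<le> \<theta> * expectation X + K * \<theta>\<^sup>2"
      using ln_le_minus_one[OF mgf_pos[OF int]] by linarith
  qed
  ultimately show thesis using that[of K "\<theta>0 / 2"] \<theta>0(1) by simp
qed

lemma renewal_rate_ge:
  assumes "ereal \<theta> < exp_moment_bound M X"
  shows "ereal (\<theta> - a * ln (mgf \<theta>)) \<le> renewal_rate M X a"
  unfolding renewal_rate_def using assms by (intro SUP_upper) auto

lemma renewal_rate_nonneg: "0 \<le> renewal_rate M X a"
proof -
  obtain \<theta>0 where "0 < \<theta>0" "integrable M (\<lambda>\<omega>. exp (\<theta>0 * X \<omega>))" using X_exp by blast
  then have "ereal 0 < exp_moment_bound M X" by (intro less_exp_moment_bound) auto
  from renewal_rate_ge[OF this, of a] show ?thesis by (simp add: prob_space zero_ereal_def)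
qed

section \<open>Affine minorants and upper bounds of renewal rates\<close>

text \<open>The affine functions \<open>h * (1 / expectation X - a)\<close> with tilts
  \<open>h\<close> of order \<open>e\<close> are minorants up to an error that is quadratic in
  \<open>e\<close> and uniform in the unbounded variable \<open>a\<close>.\<close>

definition linear_minorants :: "real \<Rightarrow> real \<Rightarrow> real \<Rightarrow> bool" where
  "linear_minorants A C r \<longleftrightarrow> 0 \<le> C \<and> 0 < r \<and>
     (\<forall>e h a. 0 \<le> e \<and> e \<le> r \<and> \<bar>h\<bar> \<le> A * e \<and> 0 \<le> a \<longrightarrow>
        ereal (h / expectation X - C * e\<^sup>2 - a * h) \<le> renewal_rate M X a)"

lemma linear_minorants_exist:
  assumes "0 \<le> A"
  shows "\<exists>C r. linear_minorants A C r"
proof -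
  obtain K r0 where K: "0 \<le> K" "0 < r0"
    "\<And>\<theta>. \<bar>\<theta>\<bar> \<le> r0 \<Longrightarrow> ereal \<theta> < exp_moment_bound M X \<and> ln (mgf \<theta>) \<le> \<theta> * expectation X + K * \<theta>\<^sup>2"
    using ln_mgf_le_quadratic by metis
  let ?m = "expectation X"
  have m: "0 < ?m" by (rule expectation_pos)
  define B where "B = (A + 1) / ?m"
  have "0 < B" using m assms by (simp add: B_def)
  define C where "C = K * B\<^sup>2"
  have "0 \<le> C" using K by (simp add: C_def)
  \<comment> \<open>The first bound gives \<open>C * e\<^sup>2 \<le> e\<close>; the second keeps
    \<theta> within the range of the quadratic bound.\<close>
  define r where "r = min (1 / (C + 1)) (r0 / B)"
  have "0 < r" using \<open>0 \<le> C\<close> \<open>0 < B\<close> K by (simp add: r_def)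
  have "ereal (h / ?m - C / ?m * e\<^sup>2 - a * h) \<le> renewal_rate M X a"
    if e: "0 \<le> e" "e \<le> r" and h: "\<bar>h\<bar> \<le> A * e" and a: "0 \<le> a" for e h a
  proof -
    \<comment> \<open>Lowering the tilt by \<open>C * e\<^sup>2\<close> absorbs the quadratic error,
      so that \<open>ln (mgf \<theta>) \<le> h\<close> without remainder. A remainder would be
      multiplied by \<open>a\<close>, which is unbounded.\<close>
    define \<theta> where "\<theta> = (h - C * e\<^sup>2) / ?m"
    have "(C + 1) * e \<le> 1"
      using e(2) \<open>0 \<le> C\<close> by (simp add: r_def pos_le_divide_eq mult.commute)
    then have "C * e \<le> 1" using e by (simp add: distrib_right)
    then have "C * e * e \<le> 1 * e" using e by (intro mult_right_mono) auto
    then have "C * e\<^sup>2 \<le> e" by (simp add: power2_eq_square mult.assoc)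
    moreover have "0 \<le> C * e\<^sup>2" using \<open>0 \<le> C\<close> by simp
    ultimately have "\<bar>h - C * e\<^sup>2\<bar> \<le> (A + 1) * e" using h by (simp add: distrib_right)
    then have \<theta>B: "\<bar>\<theta>\<bar> \<le> B * e"
      using m by (simp add: \<theta>_def B_def abs_divide divide_right_mono)
    also have "B * e \<le> r0"
      using e(2) \<open>0 < B\<close> by (simp add: r_def pos_le_divide_eq mult.commute)
    finally have \<theta>r: "\<bar>\<theta>\<bar> \<le> r0" .
    have "\<theta>\<^sup>2 \<le> (B * e)\<^sup>2" using \<theta>B by (metis abs_ge_zero power2_abs power_mono)
    then have "K * \<theta>\<^sup>2 \<le> K * (B * e)\<^sup>2" using K(1) by (intro mult_left_mono) auto
    also have "\<dots> = C * e\<^sup>2" by (simp add: C_def power_mult_distrib)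
    finally have "ln (mgf \<theta>) \<le> \<theta> * ?m + C * e\<^sup>2" using K(3)[OF \<theta>r] by linarith
    also have "\<theta> * ?m + C * e\<^sup>2 = h" using m by (simp add: \<theta>_def)
    finally have "a * ln (mgf \<theta>) \<le> a * h" using a by (intro mult_left_mono) auto
    then have "h / ?m - C / ?m * e\<^sup>2 - a * h \<le> \<theta> - a * ln (mgf \<theta>)"
      by (simp add: \<theta>_def diff_divide_distrib)
    also have "ereal (\<theta> - a * ln (mgf \<theta>)) \<le> renewal_rate M X a"
      using K(3)[OF \<theta>r] by (intro renewal_rate_ge) auto
    finally show ?thesis by simp
  qed
  then have "linear_minorants A (C / ?m) r"
    using \<open>0 \<le> C\<close> \<open>0 < r\<close> m by (simp add: linear_minorants_def)
  then show ?thesis by blast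
qed

lemma renewal_rate_at_mean: "renewal_rate M X (1 / expectation X) = 0"
proof (rule antisym)
  show "renewal_rate M X (1 / expectation X) \<le> 0"
    unfolding renewal_rate_def
  proof (rule SUP_least)
    fix \<theta> assume "\<theta> \<in> {\<theta>. ereal \<theta> < exp_moment_bound M X}"
    then have "\<theta> * expectation X \<le> ln (mgf \<theta>)"
      by (intro ln_mgf_ge integrable_exp_below_bound) auto
    then have "\<theta> - 1 / expectation X * ln (mgf \<theta>) \<le> 0"
      using expectation_pos by (simp add: field_simps)
    then show "ereal (\<theta> - 1 / expectation X * ln (mgf \<theta>)) \<le> 0"
      by (simp add: zero_ereal_def)
  qed
qed (rule renewal_rate_nonneg)

lemma prob_le_linear:
  obtains d r where "0 < d" "0 < r" "\<And>x. \<lbrakk>0 < x; x \<le> r\<rbrakk> \<Longrightarrow> d * x \<le> prob {\<omega> \<in> space M. X \<omega> \<le> x}"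
proof -
  let ?F = "cdf (distr M borel X)"
  have F: "?F x = prob {\<omega> \<in> space M. X \<omega> \<le> x}" for x
    unfolding cdf_def by (subst measure_distr) (auto simp: vimage_def Int_def conj_commute)
  have "{\<omega> \<in> space M. X \<omega> \<le> 0} = {\<omega> \<in> space M. X \<omega> = 0}" using X_nonneg by force
  then have F0: "?F 0 = 0" unfolding F using X_no_atom by simp
  obtain d where d: "0 < d" "(?F has_real_derivative d) (at 0 within {0..})" using X_cdf by blast
  have "((\<lambda>y. (?F y - ?F 0) / (y - 0)) \<longlongrightarrow> d) (at 0 within {0..})"
    using d(2) by (simp only: has_field_derivative_iff)
  then have "\<forall>\<^sub>F y in at 0 within {0..}. d / 2 < ?F y / y"
    using d(1) order_tendstoD(1)[of "\<lambda>y. ?F y / y" d _ "d / 2"] by (simp add: F0)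
  then obtain r where r: "0 < r" "\<And>y. \<lbrakk>y \<in> {0..}; y \<noteq> 0; dist y 0 < r\<rbrakk> \<Longrightarrow> d / 2 < ?F y / y"
    unfolding eventually_at by blast
  have "d / 2 * x \<le> prob {\<omega> \<in> space M. X \<omega> \<le> x}" if "0 < x" "x \<le> r / 2" for x
    using r(2)[of x] that r(1) by (simp add: F[symmetric] pos_less_divide_eq)
  then show thesis using that[of "d / 2" "r / 2"] d(1) r(1) by simp
qed

text \<open>The Laplace transform decays no faster than \<open>1 / s\<close>: the positive
  derivative of the distribution function at \<open>0\<close> gives \<open>X \<le> x\<close> a
  probability of order \<open>x\<close>, and for \<open>x\<close> of order \<open>1 / s\<close> the
  integrand is at least \<open>exp (- 1)\<close> on this event.\<close>

lemma mgf_negative_ge: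
  obtains c where "0 < c" "\<And>s. 0 \<le> s \<Longrightarrow> c / (1 + s) \<le> mgf (- s)"
proof -
  obtain d r where d: "0 < d" "0 < r" "\<And>x. \<lbrakk>0 < x; x \<le> r\<rbrakk> \<Longrightarrow> d * x \<le> prob {\<omega> \<in> space M. X \<omega> \<le> x}"
    using prob_le_linear by metis
  define b where "b = max 1 (1 / r)"
  have b: "1 \<le> b" "1 / b \<le> r" using d(2) by (auto simp: b_def field_simps max_def)
  have int: "integrable M (\<lambda>\<omega>. exp (- s * X \<omega>))" if "0 \<le> s" for s
    by (rule integrable_exp_mono[of 0]) (use that in auto)
  have "exp (- 1) * d / b / (1 + s) \<le> mgf (- s)" if s: "0 \<le> s" for s
  proof -
    \<comment> \<open>The factor \<open>b\<close> ensures \<open>x \<le> r\<close>, where the linear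
      lower bound on the probability is available.\<close>
    define x where "x = 1 / (b * (1 + s))"
    have x: "0 < x" "x \<le> r" "s * x \<le> 1"
    proof -
      show "0 < x" using b s by (simp add: x_def)
      have "1 / (b * (1 + s)) \<le> 1 / b" using b s by (intro divide_left_mono) auto
      then show "x \<le> r" using b by (simp add: x_def)
      have "s \<le> 1 * (1 + s)" using s by simp
      also have "\<dots> \<le> b * (1 + s)" using b s by (intro mult_right_mono) auto
      finally show "s * x \<le> 1" using b s by (simp add: x_def)
    qed
    have "exp (- 1) * (d * x) \<le> exp (- 1) * prob {\<omega> \<in> space M. X \<omega> \<le> x}"
      using d(3)[OF x(1,2)] by simp
    also have "\<dots> = (\<integral>\<omega>. exp (- 1) * indicator {\<omega> \<in> space M. X \<omega> \<le> x} \<omega> \<partial>M)" by simp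
    also have "\<dots> \<le> mgf (- s)"
    proof (rule integral_mono[OF _ int[OF s]])
      fix \<omega> assume "\<omega> \<in> space M"
      have "s * X \<omega> \<le> 1" if "X \<omega> \<le> x"
        using mult_left_mono[OF that s] x(3) by linarith
      then show "exp (- 1) * indicator {\<omega> \<in> space M. X \<omega> \<le> x} \<omega> \<le> exp (- s * X \<omega>)"
        by (auto split: split_indicator)
    next
      show "integrable M (\<lambda>\<omega>. exp (- 1) * indicator {\<omega> \<in> space M. X \<omega> \<le> x} \<omega> :: real)"
        by (intro integrable_mult_right integrable_real_indicator) (auto simp: emeasure_eq_measure)
    qed
    finally show ?thesis by (simp add: x_def divide_simps mult_ac)
  qed
  then show thesis using that[of "exp (- 1) * d / b"] d(1) b by simp
qed

text \<open>At rates not below the mean rate, Jensen's inequality disposes of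
  \<open>\<theta> \<ge> 0\<close>. For \<open>\<theta> = - s\<close> the bound on the Laplace
  transform leaves a gain of \<open>a * ln (1 + s)\<close> up to a constant, against the loss
  \<open>s\<close>.\<close>

lemma renewal_rate_bounded:
  obtains B where "\<And>a. \<lbrakk>1 / expectation X \<le> a; a \<le> A\<rbrakk> \<Longrightarrow> renewal_rate M X a \<le> ereal B"
proof -
  obtain c where c: "0 < c" "\<And>s. 0 \<le> s \<Longrightarrow> c / (1 + s) \<le> mgf (- s)"
    using mgf_negative_ge by metis
  define B where "B = \<bar>A\<bar> * (\<bar>ln c\<bar> + ln (\<bar>A\<bar> + 1)) + 1"
  have "renewal_rate M X a \<le> ereal B" if a: "1 / expectation X \<le> a" "a \<le> A" for a
    unfolding renewal_rate_def
  proof (rule SUP_least)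
    fix \<theta> assume "\<theta> \<in> {\<theta>. ereal \<theta> < exp_moment_bound M X}"
    then have int: "integrable M (\<lambda>\<omega>. exp (\<theta> * X \<omega>))" by (intro integrable_exp_below_bound) auto
    have "0 < 1 / expectation X" using expectation_pos by simp
    then have a0: "0 < a" "0 < A" using a by linarith+
    have "0 \<le> ln (\<bar>A\<bar> + 1)" by simp
    then have B1: "1 \<le> B" by (simp add: B_def)
    have "\<theta> - a * ln (mgf \<theta>) \<le> B"
    proof (cases "0 \<le> \<theta>")
      case True
      have "1 \<le> a * expectation X"
        using a(1) expectation_pos by (simp add: pos_divide_le_eq)
      then have "1 * \<theta> \<le> (a * expectation X) * \<theta>"
        using True by (rule mult_right_mono)
      then have "\<theta> \<le> (a * expectation X) * \<theta>" by simp
      also have "\<dots> = a * (\<theta> * expectation X)" by simp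
      also have "\<dots> \<le> a * ln (mgf \<theta>)" using ln_mgf_ge[OF int] a0 by (intro mult_left_mono) auto
      finally show ?thesis using B1 by linarith
    next
      case False
      define s where "s = - \<theta>"
      have s: "0 \<le> s" "\<theta> = - s" using False by (auto simp: s_def)
      have "ln (c / (1 + s)) \<le> ln (mgf \<theta>)"
        using c s by (intro ln_mono) auto
      then have "ln c - ln (1 + s) \<le> ln (mgf \<theta>)" using c(1) s by (simp add: ln_div)
      then have "a * (ln c - ln (1 + s)) \<le> a * ln (mgf \<theta>)" using a0 by (intro mult_left_mono) auto
      moreover have "a * (ln (1 + s) - ln c) \<le> A * (\<bar>ln c\<bar> + ln (A + 1)) + 1 + s"
      proof -
        \<comment> \<open>The tangent of \<open>ln\<close> is taken where its slope is
          \<open>1 / (A + 1)\<close>, so that \<open>a\<close> times the linear term is at most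
          \<open>1 + s\<close>.\<close>
        have "ln ((1 + s) / (A + 1)) \<le> (1 + s) / (A + 1) - 1"
          using s a0 by (intro ln_le_minus_one) auto
        then have "ln (1 + s) \<le> ln (A + 1) + (1 + s) / (A + 1)" using s a0 by (simp add: ln_div)
        moreover have "0 \<le> ln (A + 1)" using a0 by simp
        ultimately have "ln (1 + s) - ln c \<le> \<bar>ln c\<bar> + ln (A + 1) + (1 + s) / (A + 1)" by linarith
        then have "a * (ln (1 + s) - ln c) \<le> a * (\<bar>ln c\<bar> + ln (A + 1) + (1 + s) / (A + 1))"
          using a0 by (intro mult_left_mono) auto
        also have "\<dots> \<le> A * (\<bar>ln c\<bar> + ln (A + 1) + (1 + s) / (A + 1))"
          using a a0 s \<open>0 \<le> ln (A + 1)\<close> by (intro mult_right_mono) auto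
        also have "\<dots> = A * (\<bar>ln c\<bar> + ln (A + 1)) + A * ((1 + s) / (A + 1))" by (simp add: distrib_left)
        also have "A * ((1 + s) / (A + 1)) \<le> 1 + s"
          using a0 s by (simp add: pos_divide_le_eq mult.commute distrib_left)
        finally show ?thesis by simp
      qed
      ultimately show ?thesis using a0 s by (simp add: B_def algebra_simps)
    qed
    then show "ereal (\<theta> - a * ln (mgf \<theta>)) \<le> ereal B" by simp
  qed
  then show thesis by (rule that)
qed

end

section \<open>Bounds on the Lagrangian\<close>

text \<open>Fenchel's inequality: the convex conjugate of \<pi> is \<open>exp s - 1\<close>.\<close>

lemma entropy_fun_ge: "0 \<le> u \<Longrightarrow> u * s - exp s + 1 \<le> entropy_fun u"
proof (cases "u = 0")
  case False
  assume "0 \<le> u"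
  with False have "0 < u" by simp
  have "u * (1 + (s - ln u)) \<le> u * exp (s - ln u)"
    using \<open>0 < u\<close> by (intro mult_left_mono exp_ge_add_one_self) auto
  also have "\<dots> = exp s" using \<open>0 < u\<close> by (simp add: exp_diff)
  finally show ?thesis using False by (simp add: entropy_fun_def algebra_simps)
qed (simp add: entropy_fun_def)

lemma entropy_term_ge:
  assumes "0 \<le> a" "0 \<le> b"
  shows "ereal (a * s - b * (exp s - 1)) \<le> entropy_term a b"
proof (cases "b = 0")
  case False
  then have b: "0 < b" using assms by simp
  have "(a / b * s - exp s + 1) * b \<le> entropy_fun (a / b) * b"
    using assms b by (intro mult_right_mono entropy_fun_ge) auto
  moreover have "(a / b * s - exp s + 1) * b = a * s - b * (exp s - 1)"
    using b by (simp add: field_simps)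
  ultimately show ?thesis using False by (simp add: entropy_term_def)
qed (use assms in \<open>auto simp: entropy_term_def\<close>)

lemma entropy_term_nonneg: "0 \<le> a \<Longrightarrow> 0 \<le> b \<Longrightarrow> 0 \<le> entropy_term a b"
  using entropy_term_ge[of a b 0] by (simp add: zero_ereal_def)

lemma entropy_term_self: "entropy_term a a = 0"
  by (simp add: entropy_term_def entropy_fun_def zero_ereal_def)

lemma routing_rate_self: "routing_rate p p = 0"
  by (simp add: routing_rate_def entropy_term_self)

lemma routing_rate_nonneg:
  assumes "\<And>l. 0 \<le> p $ l" "(\<Sum>l\<in>UNIV. p $ l) \<le> 1" "\<And>l. 0 \<le> r $ l" "(\<Sum>l\<in>UNIV. r $ l) \<le> 1"
  shows "0 \<le> routing_rate p r"
  unfolding routing_rate_def using assms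
  by (intro add_nonneg_nonneg sum_nonneg entropy_term_nonneg) auto

text \<open>Gibbs' variational inequality with exponents \<open>ln (1 + v)\<close>.\<close>

lemma routing_rate_ge:
  assumes p: "\<And>l. 0 \<le> p $ l" "(\<Sum>l\<in>UNIV. p $ l) \<le> 1" and r: "\<And>l. 0 \<le> r $ l" "(\<Sum>l\<in>UNIV. r $ l) \<le> 1"
    and v: "\<And>l. 0 \<le> v l"
  shows "ereal ((\<Sum>l\<in>UNIV. r $ l * ln (1 + v l)) - ln (1 + (\<Sum>l\<in>UNIV. p $ l * v l))) \<le> routing_rate p r"
proof -
  define m where "m = 1 + (\<Sum>l\<in>UNIV. p $ l * v l)"
  have "0 \<le> (\<Sum>l\<in>UNIV. p $ l * v l)" using p v by (intro sum_nonneg) auto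
  then have m: "0 < m" by (simp add: m_def)
  define s where "s l = ln (1 + v l) - ln m" for l
  have es: "exp (s l) = (1 + v l) / m" for l
  proof -
    have "0 < 1 + v l" using v[of l] by simp
    then show ?thesis using m by (simp add: s_def exp_diff)
  qed
  have e0: "exp (- ln m) = 1 / m" using m by (simp add: exp_minus inverse_eq_divide)
  let ?R = "\<Sum>l\<in>UNIV. r $ l" and ?P = "\<Sum>l\<in>UNIV. p $ l"
  have "(\<Sum>l\<in>UNIV. r $ l * s l - p $ l * (exp (s l) - 1)) + ((1 - ?R) * (- ln m) - (1 - ?P) * (exp (- ln m) - 1))
      = (\<Sum>l\<in>UNIV. r $ l * ln (1 + v l)) - ln m"
  proof -
    have "(\<Sum>l\<in>UNIV. r $ l * s l) = (\<Sum>l\<in>UNIV. r $ l * ln (1 + v l)) - ?R * ln m"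
      by (simp add: s_def right_diff_distrib sum_subtractf sum_distrib_right)
    moreover have "(\<Sum>l\<in>UNIV. p $ l * (exp (s l) - 1)) = (?P + (m - 1)) / m - ?P"
      unfolding es m_def
      by (simp add: right_diff_distrib sum_subtractf distrib_left add_divide_distrib sum.distrib sum_divide_distrib)
    moreover have "(?P + (m - 1)) / m - ?P + (1 - ?P) * (1 / m - 1) = 0"
      using m by (simp add: field_simps)
    ultimately show ?thesis
      unfolding sum_subtractf e0 by (simp add: algebra_simps)
  qed
  then have "ereal ((\<Sum>l\<in>UNIV. r $ l * ln (1 + v l)) - ln m)
      = (\<Sum>l\<in>UNIV. ereal (r $ l * s l - p $ l * (exp (s l) - 1))) + ereal ((1 - ?R) * (- ln m) - (1 - ?P) * (exp (- ln m) - 1))"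
    by (simp add: sum_ereal)
  also have "\<dots> \<le> routing_rate p r"
    unfolding routing_rate_def using p r by (intro add_mono sum_mono entropy_term_ge) auto
  finally show ?thesis by (simp add: m_def)
qed

section \<open>Free velocities and velocities of bounded cost\<close>

context jackson_network
begin

sublocale arrival: positive_variable M "\<xi> k" for k
  by unfold_locales (use random_variables nonnegative no_atom_at_0 exponential_moments cdf_derivatives in auto)

sublocale service: positive_variable M "\<eta> k" for k
  by unfold_locales (use random_variables nonnegative no_atom_at_0 exponential_moments cdf_derivatives in auto)

sublocale stable_routing P
  by unfold_locales (use routing in auto)

definition arrival_rate :: "real ^ 'n" where "arrival_rate = (\<chi> k. 1 / expectation (\<xi> k))"

definition service_rate :: "real ^ 'n" where "service_rate = (\<chi> k. 1 / expectation (\<eta> k))"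

text \<open>The equilibrium flow rates through the stations, that is, the solution of the traffic
  equations.\<close>

definition throughput :: "real ^ 'n" where
  "throughput = matrix_inv (mat 1 - transpose P) *v arrival_rate"

lemma arrival_rate_pos: "0 < arrival_rate $ k" and service_rate_pos: "0 < service_rate $ k"
  using arrival.expectation_pos service.expectation_pos by (simp_all add: arrival_rate_def service_rate_def)

lemma throughput_eq: "throughput = transpose P *v throughput + arrival_rate"
  unfolding throughput_def by (rule matrix_inv_transpose_fixpoint)

lemma throughput_less: "throughput $ k < service_rate $ k"
  using stability[of k] by (simp add: throughput_def service_rate_def arrival_rate_def)

lemma flow_nth:
  "(\<alpha> + (transpose \<rho> - mat 1) *v \<delta>) $ k = \<alpha> $ k + (\<Sum>l\<in>UNIV. \<rho> $ l $ k * \<delta> $ l) - (\<delta> :: real ^ 'n) $ k"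
  by (simp add: matrix_minus_vec mult_vec_nth transpose_def)

lemma rate_nonneg:
  assumes "\<alpha> \<in> orthant" "\<delta> \<in> orthant" "row_substochastic \<rho>"
  shows "0 \<le> rate J \<alpha> \<delta> \<rho>"
  unfolding rate_def
proof (intro add_nonneg_nonneg sum_nonneg)
  fix k
  have "0 \<le> routing_rate (P $ k) (\<rho> $ k)"
    using assms(3) P_nonneg P_row_le_1 by (intro routing_rate_nonneg) (auto simp: row_substochastic_def)
  moreover have "0 \<le> \<delta> $ k" using assms(2) by (simp add: orthant_def)
  ultimately show "0 \<le> ereal (\<delta> $ k) * routing_rate (P $ k) (\<rho> $ k)" by simp
qed (auto intro: arrival.renewal_rate_nonneg service.renewal_rate_nonneg)

lemma min_rate_nonneg: "0 \<le> min_rate J y"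
  unfolding min_rate_def by (intro Inf_greatest) (auto intro: rate_nonneg)

lemma min_rate_le:
  assumes "\<alpha> \<in> orthant" "\<delta> \<in> orthant" "row_substochastic \<rho>" "y = \<alpha> + (transpose \<rho> - mat 1) *v \<delta>"
  shows "min_rate J y \<le> rate J \<alpha> \<delta> \<rho>"
  unfolding min_rate_def using assms by (intro Inf_lower) blast

text \<open>The faces partition the orthant and \<open>0 * \<infinity> = 0\<close>, so a single
  summand remains.\<close>

lemma lagrangian_eq:
  assumes "x \<in> orthant"
  shows "lagrangian x y = min_rate {k. x $ k = 0} y"
proof -
  have "face J = {x \<in> orthant. {k. x $ k = 0} = J}" for J
    by (auto simp: face_def orthant_def less_le)
  then have "indicator (face J) x * min_rate J y = (if J = {k. x $ k = 0} then min_rate J y else 0)" for J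
    using assms by (auto simp: indicator_def)
  then show ?thesis by (simp add: lagrangian_def)
qed

text \<open>With mean arrivals, unperturbed routing, full service at nonempty stations and at most
  full service at empty ones, every summand of \<open>rate\<close> vanishes.\<close>

lemma min_rate_fluid:
  assumes "\<And>k. 0 \<le> \<delta> $ k" "\<And>k. k \<notin> J \<Longrightarrow> \<delta> $ k = service_rate $ k"
    "\<And>k. k \<in> J \<Longrightarrow> \<delta> $ k \<le> service_rate $ k"
    and y: "y = arrival_rate + (transpose P - mat 1) *v \<delta>"
  shows "min_rate J y = 0"
proof -
  have "rate J arrival_rate \<delta> P = 0"
  proof -
    have "renewal_rate M (\<xi> k) (arrival_rate $ k) = 0" for k
      using arrival.renewal_rate_at_mean[of k] by (simp add: arrival_rate_def)
    moreover have "renewal_rate M (\<eta> k) (\<delta> $ k) = 0" if "k \<in> - J" for k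
      using service.renewal_rate_at_mean[of k] assms(2)[of k] that by (simp add: service_rate_def)
    moreover have "\<not> \<delta> $ k > 1 / expectation (\<eta> k)" if "k \<in> J" for k
      using assms(3)[OF that] by (simp add: service_rate_def)
    ultimately show ?thesis by (simp add: rate_def routing_rate_self)
  qed
  moreover have "min_rate J y \<le> rate J arrival_rate \<delta> P"
    using assms(1) arrival_rate_pos routing(1) y
    by (intro min_rate_le) (auto simp: orthant_def intro: less_imp_le)
  ultimately show ?thesis using min_rate_nonneg[of J y] by simp
qed

text \<open>Routing stays at \<open>P\<close>, which is free, and all arrivals and services are sped
  up, where renewal rates are bounded. Departures \<delta> balance arrivals at rate
  \<open>c\<close>, so arrivals at rate \<open>y + c\<close> produce the velocity \<open>y\<close>;
  \<open>c\<close> is so large that these rates are not below the mean rates.\<close>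

lemma min_rate_bounded:
  obtains B where "0 \<le> B" "\<And>J y. (\<And>k. \<bar>y $ k\<bar> \<le> 1) \<Longrightarrow> min_rate J y \<le> ereal B"
proof -
  define c :: "real ^ 'n" where "c = (\<chi> k. 1 + arrival_rate $ k + service_rate $ k)"
  have c_pos: "0 \<le> c $ k" for k
    using arrival_rate_pos[of k] service_rate_pos[of k] by (simp add: c_def)
  obtain \<delta> where \<delta>: "\<delta> = transpose P *v \<delta> + c" using transpose_solvable by blast
  have \<delta>0: "0 \<le> \<delta> $ k" for k by (rule transpose_nonneg[OF \<delta> c_pos])
  have \<delta>c: "service_rate $ k \<le> \<delta> $ k" for k
  proof -
    have "0 \<le> (transpose P *v \<delta>) $ k"
      unfolding mult_vec_nth transpose_def using \<delta>0 P_nonneg by (intro sum_nonneg) auto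
    moreover have "\<delta> $ k = (transpose P *v \<delta>) $ k + c $ k" using \<delta> by (metis vector_add_component)
    ultimately show ?thesis using arrival_rate_pos[of k] by (simp add: c_def)
  qed
  have "\<forall>k. \<exists>B. \<forall>a. 1 / expectation (\<xi> k) \<le> a \<and> a \<le> 1 + c $ k \<longrightarrow> renewal_rate M (\<xi> k) a \<le> ereal B"
    using arrival.renewal_rate_bounded by (metis (no_types))
  then obtain B1 where B1: "\<And>k a. \<lbrakk>1 / expectation (\<xi> k) \<le> a; a \<le> 1 + c $ k\<rbrakk> \<Longrightarrow> renewal_rate M (\<xi> k) a \<le> ereal (B1 k)"
    by metis
  have "\<forall>k. \<exists>B. \<forall>a. 1 / expectation (\<eta> k) \<le> a \<and> a \<le> \<delta> $ k \<longrightarrow> renewal_rate M (\<eta> k) a \<le> ereal B"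
    using service.renewal_rate_bounded by (metis (no_types))
  then obtain B2 where B2: "\<And>k a. \<lbrakk>1 / expectation (\<eta> k) \<le> a; a \<le> \<delta> $ k\<rbrakk> \<Longrightarrow> renewal_rate M (\<eta> k) a \<le> ereal (B2 k)"
    by metis
  \<comment> \<open>The service bounds enter twice, once for each of the sums over
    \<open>- J\<close> and \<open>J\<close>, so that \<open>B\<close> does not depend on
    \<open>J\<close>.\<close>
  define B where "B = (\<Sum>k\<in>UNIV. \<bar>B1 k\<bar>) + (\<Sum>k\<in>UNIV. \<bar>B2 k\<bar>) + (\<Sum>k\<in>UNIV. \<bar>B2 k\<bar>)"
  have "min_rate J y \<le> ereal B" if y: "\<And>k. \<bar>y $ k\<bar> \<le> 1" for J y
  proof -
    define \<alpha> where "\<alpha> = y + c"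
    have \<alpha>: "arrival_rate $ k \<le> \<alpha> $ k" "\<alpha> $ k \<le> 1 + c $ k" for k
      using y[of k] service_rate_pos[of k] by (auto simp: \<alpha>_def c_def)
    have "\<alpha> + (transpose P - mat 1) *v \<delta> = y + (c + transpose P *v \<delta> - \<delta>)"
      by (simp add: \<alpha>_def matrix_minus_vec)
    also have "c + transpose P *v \<delta> - \<delta> = 0" using \<delta> by (metis add.commute diff_self)
    finally have yeq: "y = \<alpha> + (transpose P - mat 1) *v \<delta>" by simp
    have "\<alpha> \<in> orthant" by (auto simp: orthant_def intro: order_trans[OF less_imp_le[OF arrival_rate_pos] \<alpha>(1)])
    then have "min_rate J y \<le> rate J \<alpha> \<delta> P"
      using yeq \<delta>0 routing(1) by (intro min_rate_le) (auto simp: orthant_def)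
    also have "\<dots> \<le> ereal B"
    proof -
      have 1: "renewal_rate M (\<xi> k) (\<alpha> $ k) \<le> ereal \<bar>B1 k\<bar>" for k
      proof -
        have "renewal_rate M (\<xi> k) (\<alpha> $ k) \<le> ereal (B1 k)"
          using \<alpha>[of k] by (intro B1) (auto simp: arrival_rate_def)
        also have "\<dots> \<le> ereal \<bar>B1 k\<bar>" by simp
        finally show ?thesis .
      qed
      have 2: "renewal_rate M (\<eta> k) (\<delta> $ k) \<le> ereal \<bar>B2 k\<bar>" for k
      proof -
        have "renewal_rate M (\<eta> k) (\<delta> $ k) \<le> ereal (B2 k)"
          using \<delta>c[of k] by (intro B2) (auto simp: service_rate_def)
        also have "\<dots> \<le> ereal \<bar>B2 k\<bar>" by simp
        finally show ?thesis .
      qed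
      have "rate J \<alpha> \<delta> P \<le> (\<Sum>k\<in>UNIV. ereal \<bar>B1 k\<bar>) + (\<Sum>k\<in>- J. ereal \<bar>B2 k\<bar>) + (\<Sum>k\<in>J. ereal \<bar>B2 k\<bar>) + 0"
        unfolding rate_def
        by (intro add_mono sum_mono 1 2) (auto simp: routing_rate_self 2)
      also have "\<dots> \<le> (\<Sum>k\<in>UNIV. ereal \<bar>B1 k\<bar>) + (\<Sum>k\<in>UNIV. ereal \<bar>B2 k\<bar>) + (\<Sum>k\<in>UNIV. ereal \<bar>B2 k\<bar>) + 0"
        by (intro add_mono sum_mono2 order_refl) auto
      also have "\<dots> = ereal B" by (simp add: B_def)
      finally show ?thesis .
    qed
    finally show ?thesis .
  qed
  moreover have "0 \<le> B" unfolding B_def by (intro add_nonneg_nonneg sum_nonneg) auto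
  ultimately show thesis using that by blast
qed

text \<open>The exponential tilting behind the Lyapunov bound: the weights off \<open>J\<close> do not depend on \<open>J\<close>,
  while on \<open>J\<close>, where the velocity vanishes, \<open>v\<close> is \<open>P\<close>-harmonic, so that the free services at
  empty stations neither gain nor lose.\<close>

lemma tilting_weights:
  assumes "0 \<le> e"
  obtains v :: "real ^ 'n" where
    "\<And>k. 0 \<le> v $ k" "\<And>k. v $ k \<le> e * work $ k" "\<And>k. k \<notin> J \<Longrightarrow> v $ k = e * work $ k"
    "\<And>k. k \<in> J \<Longrightarrow> (P *v v) $ k = v $ k" "\<And>k. k \<notin> J \<Longrightarrow> (P *v v) $ k \<le> v $ k - e"
proof -
  obtain v where v: "v = rows_in J P *v v + (\<chi> k. if k \<in> J then 0 else e * work $ k)"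
    using strict_supersolution_solvable[OF rows_in_supersolution[OF work_supersolution]] by blast
  have vk: "v $ k = (if k \<in> J then (P *v v) $ k else e * work $ k)" for k
    using arg_cong[OF v, of "\<lambda>x. x $ k"] by (simp add: rows_in_nth)
  note mp = strict_supersolution_minimum_principle[OF rows_in_supersolution[OF work_supersolution, of J]]
  have v0: "0 \<le> v $ k" for k
  proof (rule mp)
    fix k show "(rows_in J P *v v) $ k \<le> v $ k"
      using vk[of k] work_pos[of k] assms by (auto simp: rows_in_nth)
  qed
  \<comment> \<open>Comparison with \<open>e *\<^sub>R work\<close>, which exceeds its image under
    \<open>P\<close> by \<open>e\<close> in every coordinate. The resulting upper bound on
    \<open>v\<close> then also gives the drop by \<open>e\<close> off \<open>J\<close>.\<close>
  have "0 \<le> (e *\<^sub>R work - v) $ k" for k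
  proof (rule mp)
    fix k
    have "(P *v (e *\<^sub>R work - v)) $ k = e * (P *v work) $ k - (P *v v) $ k"
      by (simp add: mult_vec_nth right_diff_distrib sum_subtractf sum_distrib_left algebra_simps)
    then show "(rows_in J P *v (e *\<^sub>R work - v)) $ k \<le> (e *\<^sub>R work - v) $ k"
      using vk[of k] work_eq_nth[of k] assms by (auto simp: rows_in_nth algebra_simps)
  qed
  then have ve: "v $ k \<le> e * work $ k" for k by simp
  have "(P *v v) $ k \<le> e * (P *v work) $ k" for k
    unfolding mult_vec_nth sum_distrib_left
  proof (rule sum_mono)
    fix l
    have "P $ k $ l * v $ l \<le> P $ k $ l * (e * work $ l)"
      by (intro mult_left_mono ve P_nonneg)
    then show "P $ k $ l * v $ l \<le> e * (P $ k $ l * work $ l)" by (simp add: mult.left_commute)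
  qed
  then have "(P *v v) $ k \<le> v $ k - e" if "k \<notin> J" for k
    using that vk[of k] work_eq_nth[of k] by (simp add: algebra_simps)
  moreover have "(P *v v) $ k = v $ k" if "k \<in> J" for k using that by (subst vk[of k]) simp
  moreover have "v $ k = e * work $ k" if "k \<notin> J" for k using that by (subst vk[of k]) simp
  ultimately show thesis using v0 ve by (intro that) auto
qed

section \<open>The Lyapunov function\<close>

definition capacity_gap :: real where
  "capacity_gap = Min (range (\<lambda>k. service_rate $ k - throughput $ k))"

lemma capacity_gap_pos: "0 < capacity_gap"
  unfolding capacity_gap_def using throughput_less by (subst Min_gr_iff) auto

lemma capacity_gap_le: "capacity_gap \<le> service_rate $ k - throughput $ k"
  unfolding capacity_gap_def by (intro Min_le) auto

definition height :: "real ^ 'n \<Rightarrow> real ^ 'n \<Rightarrow> real" where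
  "height g x = (\<Sum>k\<in>UNIV. g $ k * x $ k)"

text \<open>One gradient \<open>g\<close> serves every face except the origin. Only velocities
  tangent to the face are considered, since at an interior time a path can have no other
  derivative.\<close>

definition lyapunov :: "real ^ 'n \<Rightarrow> real \<Rightarrow> bool" where
  "lyapunov g c \<longleftrightarrow> (\<forall>k. 0 < g $ k) \<and> 0 < c \<and>
     (\<forall>J y. J \<noteq> UNIV \<and> (\<forall>k\<in>J. y $ k = 0) \<longrightarrow> ereal (height g y + c) \<le> min_rate J y)"

text \<open>Each summand of \<open>rate\<close> has an affine minorant: tilts \<open>- v\<close> for
  arrivals, \<open>h\<close> for services off \<open>J\<close>, and Gibbs' inequality with
  \<open>v\<close> for routing. The terms in \<alpha>, \<delta> and \<rho> together dominate
  \<open>height g y\<close>. The constant terms leave the sum of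
  \<open>(service_rate $ k - throughput $ k) * b $ k\<close> off \<open>J\<close>, at least
  \<open>capacity_gap * e\<close>, against errors of size \<open>C * e\<^sup>2\<close>.\<close>

lemma lyapunov_exists: "\<exists>g c. lyapunov g c"
proof -
  let ?w = "\<lambda>k. work $ k"
  have "\<forall>k. \<exists>C r. arrival.linear_minorants k (?w k) C r"
    using arrival.linear_minorants_exist less_imp_le[OF work_pos] by blast
  then obtain C1 r1 where min1: "\<And>k. arrival.linear_minorants k (?w k) (C1 k) (r1 k)" by metis
  have "0 \<le> ?w k + (?w k)\<^sup>2" for k using work_pos[of k] by simp
  then have "\<forall>k. \<exists>C r. service.linear_minorants k (?w k + (?w k)\<^sup>2) C r"
    using service.linear_minorants_exist by blast
  then obtain C2 r2 where min2: "\<And>k. service.linear_minorants k (?w k + (?w k)\<^sup>2) (C2 k) (r2 k)" by metis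
  note C1 = min1[unfolded arrival.linear_minorants_def, THEN conjunct1]
    min1[unfolded arrival.linear_minorants_def, THEN conjunct2, THEN conjunct1]
    min1[unfolded arrival.linear_minorants_def, THEN conjunct2, THEN conjunct2, rule_format]
  note C2 = min2[unfolded service.linear_minorants_def, THEN conjunct1]
    min2[unfolded service.linear_minorants_def, THEN conjunct2, THEN conjunct1]
    min2[unfolded service.linear_minorants_def, THEN conjunct2, THEN conjunct2, rule_format]
  define C where "C = (\<Sum>k\<in>UNIV. C1 k) + (\<Sum>k\<in>UNIV. C2 k + service_rate $ k * (?w k)\<^sup>2)"
  have C0: "0 \<le> C"
    unfolding C_def using C1(1) C2(1) service_rate_pos
    by (intro add_nonneg_nonneg sum_nonneg mult_nonneg_nonneg) (auto intro: less_imp_le)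
  define r where "r = min (Min (range r1)) (Min (range r2))"
  have r: "r \<le> r1 k" "r \<le> r2 k" for k
    unfolding r_def by (auto intro: min.coboundedI1 min.coboundedI2 Min_le)
  have r0: "0 < r" unfolding r_def using C1(2) C2(2) by (auto simp: Min_gr_iff)
  \<comment> \<open>\<open>e \<le> 1\<close> gives \<open>e\<^sup>2 \<le> e\<close> in the bound on
    \<open>h\<close>, \<open>e \<le> r\<close> admits the affine minorants, and the last bound makes
    \<open>C * e\<^sup>2\<close> at most half of the gain \<open>capacity_gap * e\<close>.\<close>
  define e where "e = min (min 1 r) (capacity_gap / (2 * (C + 1)))"
  have e: "0 < e" "e \<le> 1" "e \<le> r" using r0 capacity_gap_pos C0 by (auto simp: e_def)
  have "e * (2 * (C + 1)) \<le> capacity_gap"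
  proof -
    have "e \<le> capacity_gap / (2 * (C + 1))" by (simp add: e_def)
    then show ?thesis using C0 by (subst (asm) pos_le_divide_eq) auto
  qed
  then have "C * e \<le> capacity_gap / 2" using e(1) by (simp add: algebra_simps)
  then have Ce: "C * e\<^sup>2 \<le> capacity_gap / 2 * e"
    using e(1) mult_right_mono[of "C * e" "capacity_gap / 2" e] by (simp add: power2_eq_square mult.assoc)
  define g :: "real ^ 'n" where "g = (\<chi> k. ln (1 + e * ?w k))"
  have "ereal ((\<Sum>k\<in>UNIV. g $ k * y $ k) + capacity_gap / 2 * e) \<le> min_rate J y"
    if J: "J \<noteq> UNIV" and yJ: "\<And>k. k \<in> J \<Longrightarrow> y $ k = 0" for J y
  proof -
    obtain v where v: "\<And>k. 0 \<le> v $ k" "\<And>k. v $ k \<le> e * ?w k" "\<And>k. k \<notin> J \<Longrightarrow> v $ k = e * ?w k"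
      "\<And>k. k \<in> J \<Longrightarrow> (P *v v) $ k = v $ k" "\<And>k. k \<notin> J \<Longrightarrow> (P *v v) $ k \<le> v $ k - e"
      using tilting_weights[of e J] e(1) by (metis less_imp_le)
    define b :: "real ^ 'n" where "b = v - P *v v"
    have bJ: "b $ k = 0" if "k \<in> J" for k using v(4)[OF that] by (simp add: b_def)
    have bnJ: "e \<le> b $ k" if "k \<notin> J" for k using v(5)[OF that] by (simp add: b_def)
    have Pv0: "0 \<le> (P *v v) $ k" for k unfolding mult_vec_nth using v(1) P_nonneg by (intro sum_nonneg) auto
    have bv: "b $ k \<le> v $ k" for k using Pv0[of k] by (simp add: b_def)
    have b0: "0 \<le> b $ k" for k using bJ[of k] bnJ[of k] e(1) by (cases "k \<in> J") auto
    define G where "G k = ln (1 + v $ k)" for k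
    \<comment> \<open>To first order \<open>G k - ln (1 + (P *v v) $ k)\<close> equals
      \<open>b $ k\<close>; taking off a quadratic term makes \<open>h\<close> a lower bound for
      it.\<close>
    define h where "h k = b $ k - (?w k)\<^sup>2 * e\<^sup>2" for k
    have Gv: "G k \<le> v $ k" for k unfolding G_def using v(1)[of k] by (intro ln_add_one_self_le_self) auto
    have hb: "\<bar>h k\<bar> \<le> (?w k + (?w k)\<^sup>2) * e" for k
    proof -
      have "b $ k \<le> ?w k * e" using bv[of k] v(2)[of k] by (simp add: mult.commute)
      moreover have "(?w k)\<^sup>2 * e\<^sup>2 \<le> (?w k)\<^sup>2 * e"
        using e by (intro mult_left_mono) (auto simp: power2_eq_square mult_left_le)
      moreover have "0 \<le> (?w k)\<^sup>2 * e\<^sup>2" "0 \<le> (?w k)\<^sup>2 * e" using e(1) by simp_all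
      moreover have "0 \<le> ?w k * e" using e(1) work_pos[of k] by simp
      ultimately show ?thesis using b0[of k] unfolding h_def distrib_right abs_le_iff by linarith
    qed
    have hG: "h k \<le> G k - ln (1 + (P *v v) $ k)" for k
    proof -
      have pos: "0 < 1 + v $ k" "0 < 1 + (P *v v) $ k" using v(1)[of k] Pv0[of k] by linarith+
      have "ln ((1 + (P *v v) $ k) / (1 + v $ k)) \<le> (1 + (P *v v) $ k) / (1 + v $ k) - 1"
        using pos by (intro ln_le_minus_one) simp
      also have "\<dots> = - (b $ k / (1 + v $ k))"
        using pos by (simp add: b_def field_simps)
      finally have "b $ k / (1 + v $ k) \<le> G k - ln (1 + (P *v v) $ k)"
        using pos by (simp add: G_def ln_div)
      moreover have "b $ k - b $ k * v $ k \<le> b $ k / (1 + v $ k)"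
      proof -
        have "0 \<le> b $ k * (v $ k)\<^sup>2" using b0[of k] by simp
        then have "(b $ k - b $ k * v $ k) * (1 + v $ k) \<le> b $ k"
          by (simp add: algebra_simps power2_eq_square)
        then show ?thesis using pos_le_divide_eq[OF pos(1)] by blast
      qed
      moreover have "b $ k * v $ k \<le> (e * ?w k) * (e * ?w k)"
        using bv[of k] v(1,2)[of k] b0[of k] by (intro mult_mono) auto
      ultimately show ?thesis by (simp add: h_def power2_eq_square algebra_simps)
    qed
    show ?thesis
      unfolding min_rate_def
    proof (rule Inf_greatest)
      fix z
      assume "z \<in> {rate J \<alpha> \<delta> \<rho> | \<alpha> \<delta> \<rho>. \<alpha> \<in> orthant \<and> \<delta> \<in> orthant \<and> row_substochastic \<rho> \<and>
            y = \<alpha> + (transpose \<rho> - mat 1) *v \<delta>}"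
      then obtain \<alpha> \<delta> \<rho> where z: "z = rate J \<alpha> \<delta> \<rho>"
        and adm: "\<alpha> \<in> orthant" "\<delta> \<in> orthant" "row_substochastic \<rho>"
        and y: "y = \<alpha> + (transpose \<rho> - mat 1) *v \<delta>"
        by blast
      have \<alpha>0: "0 \<le> \<alpha> $ k" and \<delta>0: "0 \<le> \<delta> $ k" for k using adm by (auto simp: orthant_def)
      have \<rho>0: "0 \<le> \<rho> $ k $ l" "(\<Sum>l\<in>UNIV. \<rho> $ k $ l) \<le> 1" for k l
        using adm(3) by (auto simp: row_substochastic_def)
      define RA where "RA k = - (arrival_rate $ k * v $ k) - C1 k * e\<^sup>2 + \<alpha> $ k * v $ k" for k
      define RS where "RS k = service_rate $ k * h k - C2 k * e\<^sup>2 - \<delta> $ k * h k" for k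
      define RR where "RR k = \<delta> $ k * ((\<Sum>l\<in>UNIV. \<rho> $ k $ l * G l) - ln (1 + (P *v v) $ k))" for k
      have "ereal (RA k) \<le> renewal_rate M (\<xi> k) (\<alpha> $ k)" for k
        using C1(3)[of e k "- v $ k" "\<alpha> $ k"] e r(1)[of k] v(1,2)[of k] \<alpha>0[of k]
        by (simp add: RA_def arrival_rate_def mult.commute)
      moreover have "ereal (RS k) \<le> renewal_rate M (\<eta> k) (\<delta> $ k)" for k
        using C2(3)[of e k "h k" "\<delta> $ k"] e r(2)[of k] hb[of k] \<delta>0[of k]
        by (simp add: RS_def service_rate_def)
      moreover have "ereal (RR k) \<le> ereal (\<delta> $ k) * routing_rate (P $ k) (\<rho> $ k)" for k
      proof -
        have "ereal ((\<Sum>l\<in>UNIV. \<rho> $ k $ l * G l) - ln (1 + (P *v v) $ k)) \<le> routing_rate (P $ k) (\<rho> $ k)"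
          unfolding G_def mult_vec_nth
          by (rule routing_rate_ge) (use P_nonneg P_row_le_1 \<rho>0 v(1) in auto)
        then have "ereal (\<delta> $ k) * ereal ((\<Sum>l\<in>UNIV. \<rho> $ k $ l * G l) - ln (1 + (P *v v) $ k))
            \<le> ereal (\<delta> $ k) * routing_rate (P $ k) (\<rho> $ k)"
          using \<delta>0 by (intro ereal_mult_left_mono) auto
        then show ?thesis by (simp add: RR_def)
      qed
      moreover have "0 \<le> (\<Sum>k\<in>J. if \<delta> $ k > 1 / expectation (\<eta> k) then renewal_rate M (\<eta> k) (\<delta> $ k) else 0)"
        by (intro sum_nonneg) (auto intro: service.renewal_rate_nonneg)
      ultimately have "(\<Sum>k\<in>UNIV. ereal (RA k)) + (\<Sum>k\<in>- J. ereal (RS k)) + 0 + (\<Sum>k\<in>UNIV. ereal (RR k)) \<le> rate J \<alpha> \<delta> \<rho>"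
        unfolding rate_def by (intro add_mono sum_mono) auto
      moreover have "(\<Sum>k\<in>UNIV. g $ k * y $ k) + capacity_gap / 2 * e
          \<le> (\<Sum>k\<in>UNIV. RA k) + (\<Sum>k\<in>- J. RS k) + (\<Sum>k\<in>UNIV. RR k)"
      proof -
        have "(\<Sum>k\<in>UNIV. g $ k * y $ k) = (\<Sum>k\<in>UNIV. G k * y $ k)"
        proof (rule sum.cong)
          fix k show "g $ k * y $ k = G k * y $ k"
            using yJ[of k] v(3)[of k] by (cases "k \<in> J") (auto simp: g_def G_def)
        qed simp
        also have "\<dots> = (\<Sum>k\<in>UNIV. G k * \<alpha> $ k) + (\<Sum>k\<in>UNIV. G k * (\<Sum>l\<in>UNIV. \<rho> $ l $ k * \<delta> $ l)) - (\<Sum>k\<in>UNIV. G k * \<delta> $ k)"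
          unfolding y flow_nth by (simp add: algebra_simps sum.distrib sum_subtractf)
        also have "(\<Sum>k\<in>UNIV. G k * (\<Sum>l\<in>UNIV. \<rho> $ l $ k * \<delta> $ l)) = (\<Sum>k\<in>UNIV. \<Sum>l\<in>UNIV. \<delta> $ l * (\<rho> $ l $ k * G k))"
          by (simp add: sum_distrib_left algebra_simps)
        also have "\<dots> = (\<Sum>l\<in>UNIV. \<Sum>k\<in>UNIV. \<delta> $ l * (\<rho> $ l $ k * G k))" by (rule sum.swap)
        also have "\<dots> = (\<Sum>k\<in>UNIV. RR k) + (\<Sum>k\<in>UNIV. \<delta> $ k * ln (1 + (P *v v) $ k))"
          by (simp add: RR_def sum_distrib_left right_diff_distrib sum_subtractf)
        finally have gy: "(\<Sum>k\<in>UNIV. g $ k * y $ k) = (\<Sum>k\<in>UNIV. G k * \<alpha> $ k) + (\<Sum>k\<in>UNIV. RR k)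
            - (\<Sum>k\<in>UNIV. \<delta> $ k * (G k - ln (1 + (P *v v) $ k)))"
          by (simp add: right_diff_distrib sum_subtractf mult.commute)
        have "(\<Sum>k\<in>UNIV. G k * \<alpha> $ k) \<le> (\<Sum>k\<in>UNIV. \<alpha> $ k * v $ k)"
          unfolding mult.commute[of "G _"] by (intro sum_mono mult_left_mono Gv \<alpha>0)
        moreover have "(\<Sum>k\<in>- J. \<delta> $ k * h k) \<le> (\<Sum>k\<in>UNIV. \<delta> $ k * (G k - ln (1 + (P *v v) $ k)))"
        proof -
          have "(\<Sum>k\<in>- J. \<delta> $ k * h k) \<le> (\<Sum>k\<in>- J. \<delta> $ k * (G k - ln (1 + (P *v v) $ k)))"
            by (intro sum_mono mult_left_mono hG \<delta>0)
          \<comment> \<open>On \<open>J\<close> the factor vanishes exactly, because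
            \<open>v\<close> is harmonic there. It has to: services in \<open>J\<close> up to the
            mean rate are free, so no minorant is available to compensate it.\<close>
          also have "\<dots> = (\<Sum>k\<in>UNIV. \<delta> $ k * (G k - ln (1 + (P *v v) $ k)))"
            by (rule sum.mono_neutral_left) (use v(4) in \<open>auto simp: G_def\<close>)
          finally show ?thesis .
        qed
        moreover have "(\<Sum>k\<in>UNIV. RA k) = (\<Sum>k\<in>UNIV. \<alpha> $ k * v $ k) - (\<Sum>k\<in>UNIV. arrival_rate $ k * v $ k) - (\<Sum>k\<in>UNIV. C1 k) * e\<^sup>2"
          by (simp add: RA_def sum.distrib sum_subtractf sum_negf sum_distrib_right)
        moreover have "(\<Sum>k\<in>- J. RS k) = (\<Sum>k\<in>- J. service_rate $ k * h k - C2 k * e\<^sup>2) - (\<Sum>k\<in>- J. \<delta> $ k * h k)"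
          by (simp add: RS_def sum_subtractf)
        moreover have "(\<Sum>k\<in>- J. service_rate $ k * b $ k) - (\<Sum>k\<in>UNIV. C2 k + service_rate $ k * (?w k)\<^sup>2) * e\<^sup>2
            \<le> (\<Sum>k\<in>- J. service_rate $ k * h k - C2 k * e\<^sup>2)"
        proof -
          have "(\<Sum>k\<in>- J. service_rate $ k * h k - C2 k * e\<^sup>2)
              = (\<Sum>k\<in>- J. service_rate $ k * b $ k) - (\<Sum>k\<in>- J. (C2 k + service_rate $ k * (?w k)\<^sup>2) * e\<^sup>2)"
            by (simp add: h_def sum_subtractf[symmetric] algebra_simps)
          moreover have "(\<Sum>k\<in>- J. (C2 k + service_rate $ k * (?w k)\<^sup>2) * e\<^sup>2) \<le> (\<Sum>k\<in>UNIV. (C2 k + service_rate $ k * (?w k)\<^sup>2) * e\<^sup>2)"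
            using C2(1) less_imp_le[OF service_rate_pos]
            by (intro sum_mono2 mult_nonneg_nonneg add_nonneg_nonneg) auto
          ultimately show ?thesis by (simp add: sum_distrib_right)
        qed
        \<comment> \<open>Pairing \<open>v = P *v v + b\<close> with the traffic equations turns the
          price of tilting the arrivals into throughputs, which stability places below the service
          rates.\<close>
        moreover have "(\<Sum>k\<in>UNIV. arrival_rate $ k * v $ k) = (\<Sum>k\<in>- J. throughput $ k * b $ k)"
        proof -
          have "v = P *v v + b" by (simp add: b_def)
          from transpose_fixpoint_duality[OF this throughput_eq]
          have "(\<Sum>k\<in>UNIV. arrival_rate $ k * v $ k) = (\<Sum>k\<in>UNIV. throughput $ k * b $ k)"
            by (simp add: mult.commute)
          also have "\<dots> = (\<Sum>k\<in>- J. throughput $ k * b $ k)"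
            by (rule sum.mono_neutral_right) (use bJ in auto)
          finally show ?thesis .
        qed
        moreover have "capacity_gap * e \<le> (\<Sum>k\<in>- J. service_rate $ k * b $ k) - (\<Sum>k\<in>- J. throughput $ k * b $ k)"
        proof -
          obtain j where j: "j \<in> - J" using J by blast
          have "capacity_gap * e \<le> (service_rate $ j - throughput $ j) * b $ j"
            using capacity_gap_le[of j] bnJ[of j] j capacity_gap_pos e(1) by (intro mult_mono) auto
          also have "\<dots> \<le> (\<Sum>k\<in>- J. (service_rate $ k - throughput $ k) * b $ k)"
          proof (rule member_le_sum[OF j])
            fix k show "0 \<le> (service_rate $ k - throughput $ k) * b $ k"
              using throughput_less[of k] b0[of k] by simp
          qed simp
          finally show ?thesis by (simp add: left_diff_distrib sum_subtractf)
        qed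
        ultimately show ?thesis
          using gy Ce by (simp add: C_def distrib_right)
      qed
      ultimately show "ereal ((\<Sum>k\<in>UNIV. g $ k * y $ k) + capacity_gap / 2 * e) \<le> z"
        unfolding z
        using order_trans[of "ereal ((\<Sum>k\<in>UNIV. g $ k * y $ k) + capacity_gap / 2 * e)"
            "ereal ((\<Sum>k\<in>UNIV. RA k) + (\<Sum>k\<in>- J. RS k) + (\<Sum>k\<in>UNIV. RR k))" "rate J \<alpha> \<delta> \<rho>"]
        by simp
    qed
  qed
  moreover have "0 < g $ k" for k
    unfolding g_def using e(1) work_pos[of k] by (auto intro!: ln_gt_zero)
  moreover have "0 < capacity_gap / 2 * e" using capacity_gap_pos e(1) by simp
  ultimately have "lyapunov g (capacity_gap / 2 * e)" by (simp add: lyapunov_def height_def)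
  then show ?thesis by blast
qed

end

section \<open>Fluid paths\<close>

lemma convex_orthant: "convex orthant"
  unfolding convex_def orthant_def by auto

lemma has_vector_derivative_cart:
  fixes q :: "real \<Rightarrow> real ^ 'n"
  assumes "\<And>k. ((\<lambda>t. q t $ k) has_real_derivative v $ k) (at t)"
  shows "(q has_vector_derivative v) (at t)"
  unfolding has_vector_derivative_def has_derivative_componentwise_within[of q]
proof
  fix i :: "real ^ 'n" assume "i \<in> Basis"
  then obtain k where i: "i = axis k 1" by (auto simp: Basis_vec_def)
  have "((\<lambda>t. q t $ k) has_derivative (\<lambda>x. x * v $ k)) (at t)"
    using assms[of k] by (simp add: has_field_derivative_def mult_commute_abs)
  then show "((\<lambda>x. q x \<bullet> i) has_derivative (\<lambda>x. (x *\<^sub>R v) \<bullet> i)) (at t)"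
    by (simp add: i inner_axis)
qed

lemma has_real_derivative_nth:
  fixes q :: "real \<Rightarrow> real ^ 'n"
  assumes "(q has_vector_derivative v) (at t)"
  shows "((\<lambda>t. q t $ k) has_real_derivative v $ k) (at t)"
  using bounded_linear.has_vector_derivative[OF bounded_linear_vec_nth assms, of k]
  by (simp add: has_real_derivative_iff_has_vector_derivative)

lemma absolutely_continuous_differentiable_ae:
  fixes q :: "real \<Rightarrow> real ^ 'n"
  assumes "absolutely_continuous_on_Icc q a b" "a \<le> b"
  shows "AE t in lebesgue. t \<in> {a<..<b} \<longrightarrow> (\<exists>v. (q has_vector_derivative v) (at t))"
proof (cases "a = b")
  case False
  then have "a < b" using assms by simp
  have "AE t in lebesgue. t \<in> {a<..<b} \<longrightarrow> (\<exists>D. ((\<lambda>t. q t $ k) has_real_derivative D) (at t))" for k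
  proof -
    have "absolutely_continuous_on_Icc (\<lambda>t. q t $ k) a b"
      by (rule absolutely_continuous_on_Icc_compose_lipschitz[OF assms(1), of 1]) (auto simp: dist_vec_nth_le)
    then obtain N where N: "negligible N" "\<And>x. x \<in> {a<..<b} - N \<Longrightarrow> \<exists>D. ((\<lambda>t. q t $ k) has_real_derivative D) (at x)"
      using bounded_variation_differentiable_ae[OF absolutely_continuous_imp_bounded_variation \<open>a < b\<close>] \<open>a < b\<close>
      by (metis less_imp_le)
    have "AE t in lebesgue. t \<notin> N"
      using N(1) by (auto simp: negligible_iff_null_sets intro: AE_not_in)
    then show ?thesis by eventually_elim (use N(2) in auto)
  qed
  note component = this
  have "AE t in lebesgue. \<forall>k\<in>UNIV. t \<in> {a<..<b} \<longrightarrow> (\<exists>D. ((\<lambda>t. q t $ k) has_real_derivative D) (at t))"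
    by (rule AE_finite_allI[OF finite component])
  then show ?thesis
  proof eventually_elim
    case (elim t)
    show ?case
    proof
      assume "t \<in> {a<..<b}"
      then have "\<forall>k. \<exists>D. ((\<lambda>t. q t $ k) has_real_derivative D) (at t)" using elim by blast
      from choice[OF this] obtain D where "\<forall>k. ((\<lambda>t. q t $ k) has_real_derivative D k) (at t)" ..
      then have "(q has_vector_derivative (\<chi> k. D k)) (at t)" by (intro has_vector_derivative_cart) simp
      then show "\<exists>v. (q has_vector_derivative v) (at t)" by blast
    qed
  qed
qed simp

context jackson_network
begin

definition running_cost :: "real ^ 'n \<Rightarrow> real ^ 'n \<Rightarrow> ennreal" where
  "running_cost x y = e2ennreal (lagrangian x y)"

abbreviation move_cost :: "real ^ 'n \<Rightarrow> real \<Rightarrow> real ^ 'n \<Rightarrow> ennreal" where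
  "move_cost \<equiv> transfer_cost running_cost orthant"

text \<open>A coordinate that is positive at one end of a segment in the orthant, or moves at all,
  is positive strictly between the ends. Hence the open segment lies in a single face and one value
  of \<open>min_rate\<close> bounds its cost rate.\<close>

lemma move_cost_line:
  assumes "x \<in> orthant" "x + t *\<^sub>R d \<in> orthant" "0 \<le> t" "0 \<le> c"
    and c: "min_rate {k. x $ k = 0 \<and> d $ k = 0} d \<le> ereal c"
  shows "move_cost x t (x + t *\<^sub>R d) \<le> ennreal (c * t)"
proof (rule transfer_cost_line[OF convex_orthant assms(1-4)])
  fix s :: real assume s: "0 < s" "s < t"
  have pos: "0 < x $ k + s * d $ k" if "\<not> (x $ k = 0 \<and> d $ k = 0)" for k
  proof -
    have xt: "0 \<le> x $ k" "0 \<le> x $ k + t * d $ k"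
      using assms(1,2) by (auto simp: orthant_def)
    show ?thesis
    proof (cases "0 \<le> d $ k")
      case True
      then have "0 \<le> s * d $ k" using s by simp
      moreover have "0 < x $ k \<or> 0 < s * d $ k" using that xt True s by auto
      ultimately show ?thesis using xt by linarith
    next
      case False
      then have "t * d $ k < s * d $ k" using s by simp
      then show ?thesis using xt by linarith
    qed
  qed
  have zero: "x $ k + s * d $ k = 0" if "x $ k = 0 \<and> d $ k = 0" for k using that by simp
  have "0 \<le> x $ k + s * d $ k" for k using pos[of k] zero[of k] by force
  then have "x + s *\<^sub>R d \<in> orthant" by (simp add: orthant_def)
  moreover have "{k. (x + s *\<^sub>R d) $ k = 0} = {k. x $ k = 0 \<and> d $ k = 0}"
    using pos zero by (auto simp: less_le)
  ultimately have "lagrangian (x + s *\<^sub>R d) d \<le> ereal c" using c by (simp add: lagrangian_eq)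
  then have "running_cost (x + s *\<^sub>R d) d \<le> e2ennreal (ereal c)"
    unfolding running_cost_def by (rule e2ennreal_mono)
  then show "running_cost (x + s *\<^sub>R d) d \<le> ennreal c" by (simp add: ennreal.rep_eq e2ennreal_ereal)
qed

lemma move_cost_lipschitz:
  obtains B where "0 \<le> B"
    "\<And>x y. \<lbrakk>x \<in> orthant; y \<in> orthant\<rbrakk> \<Longrightarrow> move_cost x (norm (y - x)) y \<le> ennreal (B * norm (y - x))"
proof -
  obtain B where B: "0 \<le> B" "\<And>J y. (\<And>k. \<bar>y $ k\<bar> \<le> 1) \<Longrightarrow> min_rate J y \<le> ereal B"
    using min_rate_bounded by metis
  have "move_cost x (norm (y - x)) y \<le> ennreal (B * norm (y - x))" if xy: "x \<in> orthant" "y \<in> orthant" for x y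
  proof -
    \<comment> \<open>For \<open>y = x\<close> the vector \<open>d\<close> is \<open>0\<close>,
      which still has norm at most \<open>1\<close>.\<close>
    define d where "d = (1 / norm (y - x)) *\<^sub>R (y - x)"
    have y: "x + norm (y - x) *\<^sub>R d = y" by (simp add: d_def)
    have "\<bar>d $ k\<bar> \<le> 1" for k
    proof -
      have "\<bar>d $ k\<bar> \<le> norm d" by (rule component_le_norm_cart)
      also have "\<dots> \<le> 1" by (simp add: d_def)
      finally show ?thesis .
    qed
    then show ?thesis
      using move_cost_line[OF xy(1), of "norm (y - x)" d B] xy(2) B unfolding y by simp
  qed
  with B(1) show thesis by (rule that)
qed

section \<open>The fluid model and its draining time\<close>

text \<open>Stations off \<open>J\<close> serve at full rate, while those in \<open>J\<close>
  release exactly what they receive and so stay empty.\<close>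

definition fluid_departures :: "'n set \<Rightarrow> real ^ 'n" where
  "fluid_departures J = (SOME \<delta>. \<delta> = rows_in J (transpose P) *v \<delta> +
     (\<chi> k. if k \<in> J then arrival_rate $ k else service_rate $ k))"

definition fluid_velocity :: "'n set \<Rightarrow> real ^ 'n" where
  "fluid_velocity J = arrival_rate + (transpose P - mat 1) *v fluid_departures J"

lemma fluid_departures_nth:
  "fluid_departures J $ k =
     (if k \<in> J then (transpose P *v fluid_departures J) $ k + arrival_rate $ k else service_rate $ k)"
proof -
  obtain w where "strict_supersolution (transpose P) w" by (rule transpose_supersolution)
  then obtain \<delta> where "\<delta> = rows_in J (transpose P) *v \<delta> +
     (\<chi> k. if k \<in> J then arrival_rate $ k else service_rate $ k)"
    using strict_supersolution_solvable[OF rows_in_supersolution] by blast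
  then have "fluid_departures J = rows_in J (transpose P) *v fluid_departures J +
     (\<chi> k. if k \<in> J then arrival_rate $ k else service_rate $ k)"
    unfolding fluid_departures_def by (rule someI)
  from arg_cong[OF this, of "\<lambda>x. x $ k"] show ?thesis by (simp add: rows_in_nth split: if_splits)
qed

text \<open>The minimum principle for the Dirichlet problem on \<open>J\<close>. It compares
  departure rates for different sets of empty stations, and with the throughput.\<close>

lemma fluid_minimum_principle:
  assumes "\<And>k. k \<in> J \<Longrightarrow> (transpose P *v u) $ k \<le> u $ k" "\<And>k. k \<notin> J \<Longrightarrow> 0 \<le> u $ k"
  shows "0 \<le> u $ k"
proof -
  obtain w where "strict_supersolution (transpose P) w" by (rule transpose_supersolution)
  then have "strict_supersolution (rows_in J (transpose P)) w" by (rule rows_in_supersolution)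
  then show ?thesis
    by (rule strict_supersolution_minimum_principle) (use assms in \<open>auto simp: rows_in_nth\<close>)
qed

lemma transpose_diff_nth: "(transpose P *v (u - v)) $ k = (transpose P *v u) $ k - (transpose P *v v) $ k"
  by (simp add: mult_vec_nth right_diff_distrib sum_subtractf)

lemma throughput_nth: "throughput $ k = (transpose P *v throughput) $ k + arrival_rate $ k"
  using throughput_eq by (metis vector_add_component)

lemma throughput_nonneg: "0 \<le> throughput $ k"
  by (rule transpose_nonneg[OF throughput_eq]) (simp add: arrival_rate_pos less_imp_le)

text \<open>The throughput solves the same equations on \<open>J\<close> with smaller values off
  \<open>J\<close>.\<close>

lemma fluid_departures_ge: "throughput $ k \<le> fluid_departures J $ k"
proof -
  have "0 \<le> (fluid_departures J - throughput) $ k"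
  proof (rule fluid_minimum_principle[of J])
    fix k assume "k \<in> J"
    then show "(transpose P *v (fluid_departures J - throughput)) $ k \<le> (fluid_departures J - throughput) $ k"
      using fluid_departures_nth[of J k] throughput_nth[of k] by (simp add: transpose_diff_nth)
  next
    fix k assume "k \<notin> J"
    then show "0 \<le> (fluid_departures J - throughput) $ k"
      using fluid_departures_nth[of J k] throughput_less[of k] by simp
  qed
  then show ?thesis by simp
qed

lemma fluid_velocity_nth:
  "fluid_velocity J $ k = arrival_rate $ k + (transpose P *v fluid_departures J) $ k - fluid_departures J $ k"
  by (simp add: fluid_velocity_def matrix_minus_vec)

lemma fluid_velocity_0: "k \<in> J \<Longrightarrow> fluid_velocity J $ k = 0"
  using fluid_departures_nth[of J k] by (simp add: fluid_velocity_nth)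

text \<open>The mean number of services still owed to the jobs present.\<close>

definition workload :: "real ^ 'n \<Rightarrow> real" where
  "workload x = (\<Sum>k\<in>UNIV. work $ k * x $ k)"

lemma workload_add_scale: "workload (x + t *\<^sub>R d) = workload x + t * workload d"
  by (simp add: workload_def distrib_left sum.distrib sum_distrib_left mult_ac)

lemma workload_nonneg: "x \<in> orthant \<Longrightarrow> 0 \<le> workload x"
  unfolding workload_def using work_pos by (intro sum_nonneg mult_nonneg_nonneg) (auto simp: orthant_def intro: less_imp_le)

text \<open>By duality with \<open>work\<close> the drift is minus the total excess of departures
  over throughput. No excess is negative, and any station off \<open>J\<close> contributes at least
  the gap.\<close>

lemma workload_velocity:
  assumes "J \<noteq> UNIV"
  shows "workload (fluid_velocity J) \<le> - capacity_gap"
proof -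
  let ?d = "fluid_departures J"
  have "(\<Sum>k\<in>UNIV. work $ k * arrival_rate $ k) = (\<Sum>k\<in>UNIV. throughput $ k)"
    using transpose_fixpoint_duality[OF work_eq throughput_eq] by simp
  moreover have "(\<Sum>k\<in>UNIV. work $ k * (transpose P *v ?d) $ k) = (\<Sum>k\<in>UNIV. work $ k * ?d $ k) - (\<Sum>k\<in>UNIV. ?d $ k)"
  proof -
    have "(P *v work) $ k * ?d $ k = work $ k * ?d $ k - ?d $ k" for k
      using work_eq_nth[of k] by (simp add: algebra_simps)
    then show ?thesis unfolding transpose_duality by (simp add: sum_subtractf)
  qed
  ultimately have w: "workload (fluid_velocity J) = - (\<Sum>k\<in>UNIV. ?d $ k - throughput $ k)"
    by (simp add: workload_def fluid_velocity_nth distrib_left right_diff_distrib sum.distrib sum_subtractf)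
  obtain j where "j \<notin> J" using assms by blast
  then have "capacity_gap \<le> ?d $ j - throughput $ j"
    using capacity_gap_le[of j] fluid_departures_nth[of J j] by simp
  also have "\<dots> \<le> (\<Sum>k\<in>UNIV. ?d $ k - throughput $ k)"
    using fluid_departures_ge by (intro member_le_sum) auto
  finally show ?thesis using w by simp
qed

text \<open>Keeping the stations in \<open>J\<close> empty is free only if their inflow is within
  their capacity; off \<open>J\<close> the inequality is an equality.\<close>

definition sustainable :: "'n set \<Rightarrow> bool" where
  "sustainable J \<longleftrightarrow> (\<forall>k. fluid_departures J $ k \<le> service_rate $ k)"

lemma sustainable_empty: "sustainable {}"
  by (simp add: sustainable_def fluid_departures_nth)

lemma min_rate_fluid_velocity: "sustainable J \<Longrightarrow> min_rate J (fluid_velocity J) = 0"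
proof (rule min_rate_fluid[OF _ _ _ fluid_velocity_def])
  fix k show "0 \<le> fluid_departures J $ k"
    using throughput_nonneg fluid_departures_ge order_trans by blast
next
  fix k assume "sustainable J" "k \<in> J"
  then show "fluid_departures J $ k \<le> service_rate $ k" by (simp add: sustainable_def)
qed (simp add: fluid_departures_nth)

text \<open>When further stations run empty, the departure rates can only decrease; hence stations that
  are empty stay empty, and the fluid path has at most one linear piece per station.\<close>

lemma sustainable_step:
  assumes "sustainable J" "J \<subseteq> J'" "\<And>k. k \<in> J' - J \<Longrightarrow> fluid_velocity J $ k \<le> 0"
  shows "sustainable J'"
proof -
  have "0 \<le> (fluid_departures J - fluid_departures J') $ k" for k
  proof (rule fluid_minimum_principle[of J'])
    fix k assume "k \<in> J'"
    then show "(transpose P *v (fluid_departures J - fluid_departures J')) $ k \<le> (fluid_departures J - fluid_departures J') $ k"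
      using fluid_departures_nth[of J' k] fluid_velocity_nth[of J k] fluid_velocity_0[of k J] assms(3)[of k]
      by (cases "k \<in> J") (simp_all add: transpose_diff_nth)
  next
    fix k assume "k \<notin> J'"
    then show "0 \<le> (fluid_departures J - fluid_departures J') $ k"
      using assms(2) fluid_departures_nth[of J k] fluid_departures_nth[of J' k] by auto
  qed
  then show ?thesis using assms(1) unfolding sustainable_def by (auto intro: order_trans)
qed

lemma move_cost_refl: "x \<in> orthant \<Longrightarrow> move_cost x 0 x = 0"
proof -
  assume x: "x \<in> orthant"
  obtain B where "0 \<le> B" "\<And>J y. (\<And>k. \<bar>y $ k\<bar> \<le> 1) \<Longrightarrow> min_rate J y \<le> ereal B"
    using min_rate_bounded by blast
  then show ?thesis using move_cost_line[of x 0 0 B] x by simp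
qed

text \<open>The fluid velocity is followed until a further station runs empty. Such a time exists
  because the workload strictly decreases, so that some coordinate of the velocity is
  negative.\<close>

lemma fluid_stage:
  assumes x: "x \<in> orthant" and J: "J = {k. x $ k = 0}" "sustainable J" "J \<noteq> UNIV"
  obtains t where "0 \<le> t" "x + t *\<^sub>R fluid_velocity J \<in> orthant"
    "J \<subset> {k. (x + t *\<^sub>R fluid_velocity J) $ k = 0}"
    "sustainable {k. (x + t *\<^sub>R fluid_velocity J) $ k = 0}"
    "move_cost x t (x + t *\<^sub>R fluid_velocity J) = 0"
proof -
  define d where "d = fluid_velocity J"
  define K where "K = {k. d $ k < 0}"
  have x0: "0 \<le> x $ k" for k using x by (simp add: orthant_def)
  have "K \<noteq> {}"
  proof
    assume "K = {}"
    then have "0 \<le> d $ k" for k by (auto simp: K_def not_less)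
    then have "0 \<le> workload d" by (intro workload_nonneg) (simp add: orthant_def)
    then show False using workload_velocity[OF J(3)] capacity_gap_pos by (simp add: d_def)
  qed
  \<comment> \<open>The first time at which a decreasing coordinate reaches
    \<open>0\<close>.\<close>
  define t where "t = Min ((\<lambda>k. x $ k / - d $ k) ` K)"
  have t_le: "t \<le> x $ k / - d $ k" if "k \<in> K" for k unfolding t_def using that by (intro Min_le) auto
  have "t \<in> (\<lambda>k. x $ k / - d $ k) ` K" unfolding t_def using \<open>K \<noteq> {}\<close> by (intro Min_in) auto
  then obtain j where j: "j \<in> K" "t = x $ j / - d $ j" by auto
  have t0: "0 \<le> t" using j x0[of j] by (auto simp: K_def divide_nonneg_pos divide_nonneg_neg)
  let ?x' = "x + t *\<^sub>R d"
  have x': "0 \<le> ?x' $ k" for k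
  proof (cases "k \<in> K")
    case True
    then have "0 < - d $ k" by (simp add: K_def)
    then have "t * - d $ k \<le> x $ k" using t_le[OF True] pos_le_divide_eq by blast
    then show ?thesis by simp
  next
    case False
    then have "0 \<le> t * d $ k" using t0 by (simp add: K_def)
    then show ?thesis using x0[of k] by simp
  qed
  then have x'o: "?x' \<in> orthant" by (simp add: orthant_def)
  have dJ: "d $ k = 0" if "k \<in> J" for k using that fluid_velocity_0 by (simp add: d_def)
  have sub: "J \<subseteq> {k. ?x' $ k = 0}" using dJ J(1) by auto
  have "?x' $ j = 0" using j by (simp add: K_def)
  moreover have "j \<notin> J" using dJ j(1) by (auto simp: K_def)
  ultimately have psub: "J \<subset> {k. ?x' $ k = 0}" using sub by auto
  have "sustainable {k. ?x' $ k = 0}"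
  proof (rule sustainable_step[OF J(2) sub])
    fix k assume k: "k \<in> {k. ?x' $ k = 0} - J"
    then have "0 < x $ k" using x0[of k] J(1) by (auto simp: less_le)
    then have "t * d $ k < 0" using k by simp
    then show "fluid_velocity J $ k \<le> 0" using t0 by (auto simp: d_def mult_less_0_iff)
  qed
  moreover have "move_cost x t ?x' = 0"
  proof -
    have "{k. x $ k = 0 \<and> d $ k = 0} = J" using dJ J(1) by auto
    then have "min_rate {k. x $ k = 0 \<and> d $ k = 0} d \<le> ereal 0"
      using min_rate_fluid_velocity[OF J(2)] by (simp add: d_def)
    from move_cost_line[OF x x'o t0 order_refl this] show ?thesis by simp
  qed
  ultimately show thesis using that[of t] t0 x'o psub by (simp add: d_def)
qed

text \<open>Induction on the number of nonempty stations; elapsed time is charged to the workload,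
  which falls at least at rate \<open>capacity_gap\<close>.\<close>

lemma fluid_drain:
  assumes "x \<in> orthant" "sustainable {k. x $ k = 0}"
  shows "\<exists>t\<ge>0. capacity_gap * t \<le> workload x \<and> move_cost x t 0 = 0"
  using assms
proof (induction "card (- {k. x $ k = 0})" arbitrary: x rule: less_induct)
  case less
  define J where "J = {k. x $ k = 0}"
  show ?case
  proof (cases "J = UNIV")
    case True
    then have "x = 0" by (auto simp: J_def vec_eq_iff)
    then show ?thesis using less.prems move_cost_refl[of 0] by (auto simp: workload_def intro!: exI[of _ 0])
  next
    case False
    then obtain t where t: "0 \<le> t" "x + t *\<^sub>R fluid_velocity J \<in> orthant"
      "J \<subset> {k. (x + t *\<^sub>R fluid_velocity J) $ k = 0}"
      "sustainable {k. (x + t *\<^sub>R fluid_velocity J) $ k = 0}"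
      "move_cost x t (x + t *\<^sub>R fluid_velocity J) = 0"
      using fluid_stage[OF less.prems(1) J_def] less.prems(2) by (metis J_def)
    let ?x' = "x + t *\<^sub>R fluid_velocity J"
    have "card (- {k. ?x' $ k = 0}) < card (- {k. x $ k = 0})"
      using t(3) by (intro psubset_card_mono) (auto simp: J_def)
    from less.hyps[OF this t(2,4)] obtain s where s: "0 \<le> s" "capacity_gap * s \<le> workload ?x'" "move_cost ?x' s 0 = 0"
      by blast
    have "t * workload (fluid_velocity J) \<le> t * - capacity_gap"
      using workload_velocity[OF False] t(1) by (intro mult_left_mono) auto
    then have "capacity_gap * (t + s) \<le> workload x"
      using s(2) by (simp add: workload_add_scale algebra_simps)
    moreover have "move_cost x (t + s) 0 = 0"
      using transfer_cost_triangle[OF t(1) s(1), of running_cost orthant x 0 ?x'] t(5) s(3) by simp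
    ultimately show ?thesis using t(1) s(1) by (intro exI[of _ "t + s"]) auto
  qed
qed

text \<open>At the origin, departures at the throughput rates balance the flow within capacity, so
  the velocity \<open>0\<close> is free.\<close>

lemma move_cost_stay: "0 \<le> t \<Longrightarrow> move_cost 0 t 0 = 0"
proof -
  assume "0 \<le> t"
  have "0 = arrival_rate + (transpose P - mat 1) *v throughput"
    using throughput_nth by (simp add: vec_eq_iff matrix_minus_vec)
  then have "min_rate UNIV 0 = 0"
    using throughput_nonneg throughput_less by (intro min_rate_fluid[of throughput]) (auto intro: less_imp_le)
  then show ?thesis
    using move_cost_line[of 0 t 0 0] \<open>0 \<le> t\<close> by (simp add: orthant_def)
qed

text \<open>The empty stations of \<open>x\<close> need not be sustainable. A push of size
  \<open>h\<close> into the interior, where no station is empty, costs at most a multiple of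
  \<open>h\<close>, and the fluid path from there drains for free. Letting \<open>h\<close> tend to
  \<open>0\<close> shows that the infimum is \<open>0\<close>.\<close>

lemma move_cost_drain:
  obtains T where "0 \<le> T" "\<And>x t. \<lbrakk>x \<in> orthant; norm x \<le> R; T \<le> t\<rbrakk> \<Longrightarrow> move_cost x t 0 = 0"
proof -
  obtain B where B: "0 \<le> B"
    "\<And>x y. \<lbrakk>x \<in> orthant; y \<in> orthant\<rbrakk> \<Longrightarrow> move_cost x (norm (y - x)) y \<le> ennreal (B * norm (y - x))"
    using move_cost_lipschitz by metis
  define N where "N = norm (1 :: real ^ 'n)"
  \<comment> \<open>The push takes time at most \<open>N\<close>, and draining takes at most the
    workload after the push divided by its least rate of decrease; any time left is spent at
    \<open>0\<close>.\<close>
  define T where "T = N + ((\<Sum>k\<in>UNIV. work $ k * \<bar>R\<bar>) + workload 1) / capacity_gap"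
  have w1: "0 \<le> workload 1" by (rule workload_nonneg) (simp add: orthant_def)
  have T0: "0 \<le> T"
    unfolding T_def N_def using w1 capacity_gap_pos less_imp_le[OF work_pos]
    by (intro add_nonneg_nonneg divide_nonneg_pos sum_nonneg mult_nonneg_nonneg) auto
  have "move_cost x t 0 = 0" if x: "x \<in> orthant" "norm x \<le> R" and t: "T \<le> t" for x t
  proof -
    have le: "move_cost x t 0 \<le> ennreal (B * (h * N))" if h: "0 < h" "h \<le> 1" for h
    proof -
      define x' where "x' = x + h *\<^sub>R 1"
      have pos: "0 < x' $ k" for k using x(1) h by (simp add: x'_def orthant_def add_nonneg_pos)
      then have x'o: "x' \<in> orthant" by (simp add: orthant_def less_imp_le)
      have "{k. x' $ k = 0} = {}" using pos by (auto simp: less_le)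
      then obtain s where s: "0 \<le> s" "capacity_gap * s \<le> workload x'" "move_cost x' s 0 = 0"
        using fluid_drain[OF x'o] sustainable_empty by auto
      have nrm: "norm (x' - x) = h * N" using h by (simp add: x'_def N_def)
      have "workload x \<le> (\<Sum>k\<in>UNIV. work $ k * \<bar>R\<bar>)"
        unfolding workload_def
      proof (intro sum_mono mult_left_mono less_imp_le[OF work_pos])
        fix k show "x $ k \<le> \<bar>R\<bar>" using component_le_norm_cart[of x k] x(2) by simp
      qed
      moreover have "h * workload 1 \<le> workload 1" using h w1 by (simp add: mult_left_le_one_le)
      ultimately have "capacity_gap * s \<le> (\<Sum>k\<in>UNIV. work $ k * \<bar>R\<bar>) + workload 1"
        using s(2) unfolding x'_def workload_add_scale by linarith
      then have "s \<le> ((\<Sum>k\<in>UNIV. work $ k * \<bar>R\<bar>) + workload 1) / capacity_gap"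
        using capacity_gap_pos by (simp add: pos_le_divide_eq mult.commute)
      moreover have "h * N \<le> N" using h by (simp add: N_def mult_left_le_one_le)
      ultimately have st: "h * N + s \<le> t" using t by (simp add: T_def)
      have hN: "0 \<le> h * N" using h by (simp add: N_def)
      have "move_cost x (h * N + (s + (t - h * N - s))) 0 \<le> move_cost x (h * N) x' + move_cost x' (s + (t - h * N - s)) 0"
        using hN s(1) st by (intro transfer_cost_triangle) auto
      also have "\<dots> \<le> move_cost x (h * N) x' + (move_cost x' s 0 + move_cost 0 (t - h * N - s) 0)"
        using s(1) st by (intro add_left_mono transfer_cost_triangle) auto
      also have "\<dots> = move_cost x (h * N) x'" using s(3) move_cost_stay[of "t - h * N - s"] st by simp
      also have "\<dots> \<le> ennreal (B * (h * N))" using B(2)[OF x(1) x'o] by (simp add: nrm)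
      finally show ?thesis by simp
    qed
    have "move_cost x t 0 \<le> ennreal e" if "0 < e" for e
    proof -
      define h where "h = min 1 (e / (B * N + 1))"
      have BN: "0 \<le> B * N" using B(1) by (simp add: N_def)
      have h: "0 < h" "h \<le> 1" using \<open>0 < e\<close> BN by (auto simp: h_def add_nonneg_pos)
      have "h \<le> e / (B * N + 1)" by (simp add: h_def)
      then have "h * (B * N + 1) \<le> e" using BN by (subst (asm) pos_le_divide_eq) auto
      then have "B * (h * N) \<le> e" using h(1) by (simp add: algebra_simps)
      then show ?thesis using le[OF h] by (meson ennreal_leI order_trans)
    qed
    note small = this
    have "move_cost x t 0 \<le> 0"
    proof (rule ennreal_le_epsilon)
      fix e :: real assume "0 < e"
      then show "move_cost x t 0 \<le> 0 + ennreal e" using small by simp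
    qed
    then show ?thesis by simp
  qed
  with T0 show thesis by (rule that)
qed

end

section \<open>The potential\<close>

lemma exp_minus_ennreal: "0 \<le> r \<Longrightarrow> exp_minus (ennreal r) = exp (- r)"
  by (simp add: exp_minus_def)

lemma exp_minus_bounds: "0 \<le> exp_minus a" "exp_minus a \<le> 1"
  by (auto simp: exp_minus_def)

lemma exp_minus_top: "exp_minus top = 0"
  by (simp add: exp_minus_def)

lemma exp_minus_antimono: "a \<le> b \<Longrightarrow> exp_minus b \<le> exp_minus a"
  by (cases a; cases b) (auto simp: exp_minus_def top_unique ennreal_le_iff)

lemma exp_minus_add: "exp_minus (a + b) = exp_minus a * exp_minus b"
  by (cases a; cases b) (auto simp: exp_minus_def exp_add exp_diff exp_minus inverse_eq_divide simp flip: ennreal_plus)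

text \<open>Additive errors in the cost become additive errors of at most the same size in the
  density, so near-optimal paths suffice.\<close>

lemma exp_minus_add_ge:
  assumes "0 \<le> e"
  shows "exp_minus a - e \<le> exp_minus (a + ennreal e)"
proof -
  have "1 - e \<le> exp (- e)" using exp_ge_add_one_self[of "- e"] by simp
  then have "exp_minus a * (1 - e) \<le> exp_minus a * exp (- e)"
    using exp_minus_bounds by (intro mult_left_mono) auto
  moreover have "exp_minus a * e \<le> 1 * e" using assms exp_minus_bounds by (intro mult_right_mono) auto
  ultimately show ?thesis using assms by (simp add: exp_minus_add exp_minus_ennreal algebra_simps)
qed

lemma less_add_ennreal: "a < \<infinity> \<Longrightarrow> 0 < e \<Longrightarrow> a < a + ennreal e"
  by (cases a) (auto simp: ennreal_lessI simp flip: ennreal_plus)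

context jackson_network
begin

lemma height_0: "height g 0 = 0"
  by (simp add: height_def)

text \<open>The Lyapunov inequality is integrated along \<open>q\<close>: it bounds the derivative
  of \<open>height g (q t) + c * t\<close> by the running cost at almost every time.\<close>

lemma path_cost_ge_height:
  assumes g: "lyapunov g c"
    and q: "absolutely_continuous_on_Icc q a b" "a \<le> b" "\<And>t. t \<in> {a..b} \<Longrightarrow> q t \<in> orthant"
    and nz: "\<And>t. t \<in> {a<..<b} \<Longrightarrow> q t \<noteq> 0"
  shows "ennreal (height g (q b) - height g (q a) + c * (b - a)) \<le> path_cost running_cost q a b"
proof -
  define f where "f t = height g (q t) + c * t" for t
  have lip: "dist (height g x) (height g y) \<le> ((\<Sum>k\<in>UNIV. \<bar>g $ k\<bar>) + 1) * dist x y" for x y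
  proof -
    have "height g x - height g y = (\<Sum>k\<in>UNIV. g $ k * (x - y) $ k)"
      by (simp add: height_def sum_subtractf right_diff_distrib)
    then have "dist (height g x) (height g y) = \<bar>\<Sum>k\<in>UNIV. g $ k * (x - y) $ k\<bar>"
      by (simp add: dist_real_def)
    also have "\<dots> \<le> (\<Sum>k\<in>UNIV. \<bar>g $ k\<bar> * norm (x - y))"
    proof (rule order_trans[OF sum_abs sum_mono])
      fix k show "\<bar>g $ k * (x - y) $ k\<bar> \<le> \<bar>g $ k\<bar> * norm (x - y)"
        unfolding abs_mult by (intro mult_left_mono component_le_norm_cart) auto
    qed
    also have "\<dots> \<le> ((\<Sum>k\<in>UNIV. \<bar>g $ k\<bar>) + 1) * dist x y"
      by (simp add: sum_distrib_right[symmetric] dist_norm distrib_right)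
    finally show ?thesis .
  qed
  have "0 < (\<Sum>k\<in>UNIV. \<bar>g $ k\<bar>) + 1" by (intro add_nonneg_pos sum_nonneg) auto
  then have "absolutely_continuous_on_Icc (\<lambda>t. height g (q t)) a b"
    by (rule absolutely_continuous_on_Icc_compose_lipschitz[OF q(1)]) (rule lip)
  moreover have "absolutely_continuous_on_Icc (\<lambda>t. c * t) a b"
    by (rule absolutely_continuous_on_Icc_lipschitz[where C = c])
       (use g in \<open>auto simp: lyapunov_def dist_real_def abs_mult simp flip: right_diff_distrib\<close>)
  ultimately have "absolutely_continuous_on_Icc f a b"
    unfolding f_def by (rule absolutely_continuous_on_Icc_add)
  then have "ennreal (f b - f a) \<le> (\<integral>\<^sup>+t\<in>{a..b}. running_cost (q t) (vector_derivative q (at t)) \<partial>lebesgue)"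
  proof (rule absolutely_continuous_increment_le_nn_integral[OF _ q(2)])
    show "AE t in lebesgue. t \<in> {a<..<b} \<longrightarrow> (\<forall>D. (f has_real_derivative D) (at t) \<longrightarrow>
        ennreal D \<le> running_cost (q t) (vector_derivative q (at t)))"
      using absolutely_continuous_differentiable_ae[OF q(1,2)]
    proof (eventually_elim, intro impI allI)
      fix t D
      assume ex: "t \<in> {a<..<b} \<longrightarrow> (\<exists>v. (q has_vector_derivative v) (at t))"
        and t: "t \<in> {a<..<b}" and fD: "(f has_real_derivative D) (at t)"
      then obtain v where v: "(q has_vector_derivative v) (at t)" by blast
      have qo: "q s \<in> orthant" if "s \<in> {a<..<b}" for s using q(3) that by simp
      \<comment> \<open>A coordinate of a path in the orthant that vanishes at an interior time has
        a local minimum there, so the velocity is tangent to the face.\<close>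
      have v0: "v $ k = 0" if "q t $ k = 0" for k
      proof (rule DERIV_local_min[OF has_real_derivative_nth[OF v, of k]])
        show "0 < min (t - a) (b - t)" using t by simp
        show "\<forall>s. \<bar>t - s\<bar> < min (t - a) (b - t) \<longrightarrow> q t $ k \<le> q s $ k"
        proof (intro allI impI)
          fix s assume "\<bar>t - s\<bar> < min (t - a) (b - t)"
          then have "s \<in> {a<..<b}" by auto
          then show "q t $ k \<le> q s $ k" using qo[of s] that by (simp add: orthant_def)
        qed
      qed
      have "(f has_real_derivative (height g v + c)) (at t)"
        unfolding f_def height_def
        by (auto intro!: derivative_eq_intros has_real_derivative_nth[OF v] simp: mult.commute)
      then have "D = height g v + c" using fD DERIV_unique by blast
      moreover have "{k. q t $ k = 0} \<noteq> UNIV" using nz[OF t] by (auto simp: vec_eq_iff)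
      then have "ereal (height g v + c) \<le> lagrangian (q t) v"
        unfolding lagrangian_eq[OF qo[OF t]] using g v0 by (simp add: lyapunov_def)
      ultimately have "e2ennreal (ereal D) \<le> running_cost (q t) v"
        unfolding running_cost_def by (intro e2ennreal_mono) simp
      then show "ennreal D \<le> running_cost (q t) (vector_derivative q (at t))"
        using vector_derivative_at[OF v] by (simp add: e2ennreal_ereal)
    qed
  qed
  then show ?thesis by (simp add: path_cost_def f_def algebra_simps)
qed

text \<open>Here \<open>s\<close> is the duration of the last excursion from \<open>0\<close>.\<close>

lemma move_cost_last_excursion:
  assumes g: "lyapunov g c" and xy: "x \<in> orthant" "y \<in> orthant" and t: "0 \<le> t"
    and C: "move_cost x t y < ennreal C" and alt: "x = 0 \<or> C + height g x < c * t"
  shows "\<exists>s\<ge>0. s \<le> t \<and> move_cost 0 s y < ennreal C \<and> c * s + height g y \<le> C"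
proof -
  have "0 < ennreal C" by (rule le_less_trans[OF zero_le C])
  then have C0: "0 < C" by simp
  obtain q where q: "q \<in> paths_between orthant x t y" and qC: "path_cost running_cost q 0 t < ennreal C"
    using C by (rule transfer_cost_lessE)
  have ac: "absolutely_continuous_on_Icc q 0 t" and qo: "\<And>s. s \<in> {0..t} \<Longrightarrow> q s \<in> orthant"
    and q0: "q 0 = x" and qt: "q t = y"
    using q by (auto simp: paths_between_def image_subset_iff)
  define Z where "Z = {s \<in> {0..t}. q s = 0}"
  have ge: "height g y - height g (q s) + c * (t - s) < C"
    if s: "0 \<le> s" "s \<le> t" "\<And>r. s < r \<Longrightarrow> r < t \<Longrightarrow> q r \<noteq> 0" for s
  proof -
    have "ennreal (height g (q t) - height g (q s) + c * (t - s)) \<le> path_cost running_cost q s t"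
      by (rule path_cost_ge_height[OF g absolutely_continuous_on_Icc_subset[OF ac]])
         (use s qo in auto)
    also have "\<dots> \<le> path_cost running_cost q 0 t"
      using path_cost_split[of 0 s t running_cost q] s by simp
    finally have "ennreal (height g (q t) - height g (q s) + c * (t - s)) < ennreal C"
      using qC by (rule le_less_trans)
    then have "height g (q t) - height g (q s) + c * (t - s) < C"
      by (meson ennreal_leI not_le)
    then show ?thesis by (simp add: qt)
  qed
  have hy: "0 \<le> height g y"
    unfolding height_def using xy(2) g by (intro sum_nonneg mult_nonneg_nonneg) (auto simp: lyapunov_def orthant_def less_imp_le)
  \<comment> \<open>A path that avoids \<open>0\<close> would pay at least
    \<open>c * t - height g x\<close>, which \<open>alt\<close> makes larger than \<open>C\<close>;
    and if \<open>x = 0\<close>, time \<open>0\<close> is a visit.\<close>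
  have "Z \<noteq> {}"
  proof
    assume Z: "Z = {}"
    then have "x \<noteq> 0" using t q0 by (auto simp: Z_def)
    then have "C + height g x < c * t" using alt by simp
    moreover have "height g y - height g (q 0) + c * (t - 0) < C"
      by (rule ge) (use Z t in \<open>auto simp: Z_def\<close>)
    ultimately show False using q0 hy by simp
  qed
  moreover have "compact Z"
  proof -
    have "Z = {0..t} \<inter> q -` {0}" by (auto simp: Z_def)
    moreover have "closed ({0..t} \<inter> q -` {0})"
      using absolutely_continuous_on_Icc_imp_continuous_on[OF ac] by (intro continuous_closed_preimage) auto
    moreover have "bounded Z" by (rule bounded_subset[of "{0..t}"]) (auto simp: Z_def)
    ultimately show ?thesis by (simp add: compact_eq_bounded_closed)
  qed
  ultimately obtain s where s: "s \<in> Z" "\<And>r. r \<in> Z \<Longrightarrow> r \<le> s"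
    using compact_attains_sup[of Z] by blast
  then have s': "0 \<le> s" "s \<le> t" "q s = 0" by (auto simp: Z_def)
  have "height g y - height g (q s) + c * (t - s) < C"
  proof (rule ge[OF s'(1,2)])
    fix r assume "s < r" "r < t"
    then show "q r \<noteq> 0" using s(2)[of r] s'(1) by (auto simp: Z_def)
  qed
  then have "c * (t - s) + height g y \<le> C" by (simp add: s'(3) height_0)
  moreover have "move_cost 0 (t - s) y < ennreal C"
  proof -
    have q': "q \<in> paths_between orthant x (s + (t - s)) y" using q by simp
    have ts: "0 \<le> t - s" using s' by simp
    note r = paths_between_restrict[OF q' s'(1) ts]
    have "move_cost 0 (t - s) y \<le> path_cost running_cost (\<lambda>r. q (r + s)) 0 (t - s)"
      using transfer_cost_le[OF r(2)] s'(3) by simp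
    also have "\<dots> \<le> path_cost running_cost q 0 t" using r(3)[of running_cost] by simp
    finally show ?thesis using qC by simp
  qed
  ultimately show ?thesis using s' by (intro exI[of _ "t - s"]) auto
qed

section \<open>The quasipotential\<close>

text \<open>Freidlin and Wentzell's quasipotential relative to the equilibrium
  \<open>0\<close>.\<close>

definition potential :: "real ^ 'n \<Rightarrow> ennreal" where
  "potential y = (INF t\<in>{0..}. move_cost 0 t y)"

lemma zero_in_orthant: "0 \<in> orthant"
  by (simp add: orthant_def)

lemma potential_le: "0 \<le> t \<Longrightarrow> potential y \<le> move_cost 0 t y"
  unfolding potential_def by (rule INF_lower) simp

lemma potential_lessE:
  assumes "potential y < c"
  obtains t where "0 \<le> t" "move_cost 0 t y < c"
  using assms by (auto simp: potential_def INF_less_iff)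

text \<open>The additional time is spent waiting at \<open>0\<close> before departure.\<close>

lemma move_cost_0_antimono: "0 \<le> s \<Longrightarrow> s \<le> t \<Longrightarrow> move_cost 0 t y \<le> move_cost 0 s y"
  using transfer_cost_triangle[of "t - s" s running_cost orthant 0 y 0] move_cost_stay[of "t - s"] by simp

lemma potential_triangle: "0 \<le> t \<Longrightarrow> potential y \<le> potential x + move_cost x t y"
proof (cases "potential x")
  case (real p)
  assume t: "0 \<le> t"
  show ?thesis
  proof (rule ennreal_le_epsilon)
    fix e :: real assume "0 < e"
    then have "potential x < potential x + ennreal e" using real by (intro less_add_ennreal) auto
    then obtain s where s: "0 \<le> s" "move_cost 0 s x < potential x + ennreal e" by (rule potential_lessE)
    have "potential y \<le> move_cost 0 (s + t) y" using s t by (intro potential_le) auto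
    also have "\<dots> \<le> move_cost 0 s x + move_cost x t y" using s t by (intro transfer_cost_triangle) auto
    also have "\<dots> \<le> (potential x + ennreal e) + move_cost x t y" using s by (intro add_mono) auto
    finally show "potential y \<le> potential x + move_cost x t y + ennreal e" by (simp add: ac_simps)
  qed
qed simp

lemma potential_0: "potential 0 = 0"
  using potential_le[of 0 0] move_cost_stay[of 0] by simp

lemma potential_finite: "y \<in> orthant \<Longrightarrow> potential y < \<infinity>"
proof -
  assume y: "y \<in> orthant"
  obtain B where "move_cost 0 (norm (y - 0)) y \<le> ennreal (B * norm (y - 0))"
    using move_cost_lipschitz zero_in_orthant y by metis
  then show ?thesis using potential_le[of "norm y" y]
    by (simp add: le_less_trans[OF order_trans])
qed

lemma potential_lipschitz:
  obtains B where "0 \<le> B" "\<And>x y. \<lbrakk>x \<in> orthant; y \<in> orthant\<rbrakk> \<Longrightarrow> potential y \<le> potential x + ennreal (B * norm (y - x))"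
proof -
  obtain B where B: "0 \<le> B"
    "\<And>x y. \<lbrakk>x \<in> orthant; y \<in> orthant\<rbrakk> \<Longrightarrow> move_cost x (norm (y - x)) y \<le> ennreal (B * norm (y - x))"
    using move_cost_lipschitz by blast
  have "potential y \<le> potential x + ennreal (B * norm (y - x))" if "x \<in> orthant" "y \<in> orthant" for x y
    using potential_triangle[of "norm (y - x)" y x] B(2)[OF that] by (meson add_left_mono norm_ge_zero order_trans)
  with B(1) show thesis by (rule that)
qed

text \<open>The potential dominates the Lyapunov height, by the bound on the last excursion, and the
  height grows linearly on the orthant. This bounds the level sets of the limit.\<close>

lemma potential_coercive:
  obtains c where "0 < c" "\<And>y C. \<lbrakk>y \<in> orthant; potential y < ennreal C\<rbrakk> \<Longrightarrow> norm y \<le> C / c"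
proof -
  obtain g c where lyap: "lyapunov g c" using lyapunov_exists by blast
  then have g: "\<And>k. 0 < g $ k" "0 < c" by (auto simp: lyapunov_def)
  define m where "m = Min (range (\<lambda>k. g $ k))"
  have m: "m \<le> g $ k" for k unfolding m_def by (intro Min_le) auto
  have m0: "0 < m" unfolding m_def using g(1) by (subst Min_gr_iff) auto
  have "norm y \<le> C / m" if y: "y \<in> orthant" and C: "potential y < ennreal C" for y C
  proof -
    obtain t where t: "0 \<le> t" "move_cost 0 t y < ennreal C" using C by (rule potential_lessE)
    then obtain s where s: "0 \<le> s" "c * s + height g y \<le> C" using move_cost_last_excursion[OF lyap, of 0 y t C] zero_in_orthant y by auto
    have y0: "0 \<le> y $ k" for k using y by (simp add: orthant_def)
    have "m * norm y \<le> m * (\<Sum>k\<in>UNIV. \<bar>y $ k\<bar>)" using m0 norm_le_l1_cart[of y] by (intro mult_left_mono) auto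
    also have "\<dots> \<le> height g y"
      unfolding height_def sum_distrib_left using m y0 by (intro sum_mono) (simp add: mult_right_mono)
    also have "\<dots> \<le> C" using s g(2) by (smt (verit) mult_nonneg_nonneg)
    finally show ?thesis using m0 by (simp add: pos_le_divide_eq mult.commute)
  qed
  with m0 show thesis by (rule that)
qed

text \<open>\<open>T\<close> does not depend on \<open>y\<close>, because \<open>C\<close> acts as a
  threshold. Below it the two costs agree, since cheap paths pass through \<open>0\<close> and have
  short last excursions; above it both are at least \<open>C\<close>, which is all that uniform
  convergence needs.\<close>

lemma move_cost_eventually_potential:
  obtains T where "\<And>t x y. \<lbrakk>T \<le> t; x \<in> orthant; norm x \<le> R; y \<in> orthant\<rbrakk> \<Longrightarrow>
     0 \<le> t \<and> (potential y < ennreal C \<longrightarrow> move_cost x t y = potential y) \<and>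
     (ennreal C \<le> potential y \<longrightarrow> ennreal C \<le> move_cost x t y)"
proof -
  obtain g c where lyap: "lyapunov g c" using lyapunov_exists by blast
  then have g: "\<And>k. 0 < g $ k" "0 < c" by (auto simp: lyapunov_def)
  obtain T0 where T0: "0 \<le> T0" "\<And>x t. \<lbrakk>x \<in> orthant; norm x \<le> R; T0 \<le> t\<rbrakk> \<Longrightarrow> move_cost x t 0 = 0"
    using move_cost_drain[of R] by blast
  \<comment> \<open>Bounds the duration of a last excursion. The modulus covers negative
    \<open>C\<close>, for which \<open>ennreal C\<close> is \<open>0\<close>.\<close>
  define T1 where "T1 = \<bar>C\<bar> / c"
  define UR where "UR = (\<Sum>k\<in>UNIV. g $ k * \<bar>R\<bar>)"
  \<comment> \<open>Time to drain \<open>x\<close>, time for the excursion to \<open>y\<close>, and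
    enough in addition to force a visit to \<open>0\<close> on every path of cost below
    \<open>C\<close>.\<close>
  define T where "T = T0 + T1 + (\<bar>C\<bar> + \<bar>UR\<bar> + 1) / c"
  have T1: "0 \<le> T1" "\<And>s. c * s \<le> \<bar>C\<bar> \<Longrightarrow> s \<le> T1"
    using g(2) by (auto simp: T1_def pos_le_divide_eq mult.commute)
  have T: "0 \<le> T" "T0 + T1 \<le> T" "\<bar>C\<bar> + UR < c * T"
  proof -
    have "0 \<le> (\<bar>C\<bar> + \<bar>UR\<bar> + 1) / c" using g(2) by (intro divide_nonneg_pos) auto
    then show "0 \<le> T" "T0 + T1 \<le> T" using T0 T1(1) by (auto simp: T_def)
    have "\<bar>C\<bar> + UR < c * ((\<bar>C\<bar> + \<bar>UR\<bar> + 1) / c)" using g(2) by simp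
    also have "\<dots> \<le> c * T" using g(2) T0 T1(1) by (intro mult_left_mono) (auto simp: T_def)
    finally show "\<bar>C\<bar> + UR < c * T" .
  qed
  have hg: "height g y \<ge> 0" if "y \<in> orthant" for y
    unfolding height_def using that g(1) by (intro sum_nonneg mult_nonneg_nonneg) (auto simp: orthant_def less_imp_le)
  have from_0: "move_cost 0 t y = potential y" if y: "y \<in> orthant" and p: "potential y < ennreal C" and t: "T1 \<le> t" for y t
  proof (rule antisym)
    show "potential y \<le> move_cost 0 t y" using t T1(1) by (intro potential_le) linarith
    show "move_cost 0 t y \<le> potential y"
    proof (rule dense_ge)
      fix b assume "potential y < b"
      then have "potential y < min b (ennreal C)" using p by simp
      \<comment> \<open>A bound strictly above the infimum yields an actual path. Its last excursion
        takes at most \<open>T1\<close>, so waiting at \<open>0\<close> can extend it to duration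
        \<open>t\<close>.\<close>
      then obtain r where r: "potential y < r" "r < min b (ennreal C)" using dense by blast
      then obtain r' where r': "r = ennreal r'" "0 \<le> r'" by (cases r) auto
      have "r' \<le> \<bar>C\<bar>" using r(2) r' by (simp add: ennreal_less_iff)
      obtain t' where t': "0 \<le> t'" "move_cost 0 t' y < ennreal r'" using r(1) r'(1) potential_lessE by metis
      then obtain s where s: "0 \<le> s" "move_cost 0 s y < ennreal r'" "c * s + height g y \<le> r'"
        using move_cost_last_excursion[OF lyap, of 0 y t' r'] zero_in_orthant y by auto
      have "c * s \<le> \<bar>C\<bar>" using s(3) hg[OF y] \<open>r' \<le> \<bar>C\<bar>\<close> by linarith
      then have "s \<le> t" using T1(2)[of s] t by linarith
      then have "move_cost 0 t y \<le> move_cost 0 s y" using s(1) by (intro move_cost_0_antimono)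
      also have "\<dots> \<le> b" using s(2) r r'(1) by (simp add: less_imp_le order.strict_trans)
      finally show "move_cost 0 t y \<le> b" .
    qed
  qed
  have low: "potential y < ennreal D"
    if xy: "x \<in> orthant" "norm x \<le> R" "y \<in> orthant" and D: "move_cost x t y < ennreal D" "D \<le> \<bar>C\<bar>" and t: "T \<le> t"
    for x y t D
  proof -
    have "height g x \<le> UR"
      unfolding height_def UR_def
    proof (intro sum_mono mult_left_mono less_imp_le[OF g(1)])
      fix k show "x $ k \<le> \<bar>R\<bar>" using component_le_norm_cart[of x k] xy(2) by simp
    qed
    moreover have "c * T \<le> c * t" using t g(2) by simp
    ultimately have "D + height g x < c * t" using T(3) D(2) by linarith
    then obtain s where "0 \<le> s" "move_cost 0 s y < ennreal D"
      using move_cost_last_excursion[OF lyap, of x y t D] xy D T(1) t by auto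
    then show ?thesis using potential_le le_less_trans by blast
  qed
  have "0 \<le> t \<and> (potential y < ennreal C \<longrightarrow> move_cost x t y = potential y) \<and>
     (ennreal C \<le> potential y \<longrightarrow> ennreal C \<le> move_cost x t y)"
    if t: "T \<le> t" and x: "x \<in> orthant" "norm x \<le> R" and y: "y \<in> orthant" for t x y
  proof (intro conjI impI)
    show "0 \<le> t" using t T(1) by linarith
    show "ennreal C \<le> move_cost x t y" if "ennreal C \<le> potential y"
      using low[OF x y _ _ t, of C] that by (meson abs_ge_self not_le)
    show "move_cost x t y = potential y" if p: "potential y < ennreal C"
    proof (rule antisym)
      have "move_cost x (T0 + (t - T0)) y \<le> move_cost x T0 0 + move_cost 0 (t - T0) y"
        using T0(1) T1(1) T(2) t by (intro transfer_cost_triangle) auto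
      also have "\<dots> = potential y"
        using T0(2)[OF x order_refl] from_0[OF y p, of "t - T0"] T(2) t by simp
      finally show "move_cost x t y \<le> potential y" by simp
      obtain r where r: "potential y = ennreal r" "0 \<le> r" using p by (cases "potential y") auto
      have "r \<le> \<bar>C\<bar>" using p r by (simp add: ennreal_less_iff)
      \<comment> \<open>A smaller cost would allow \<open>low\<close> with \<open>D = r\<close>,
        which says that the potential is below itself.\<close>
      then show "potential y \<le> move_cost x t y"
        using low[OF x y _ _ t, of r] r(1) by (metis less_irrefl not_le)
    qed
  qed
  then show thesis by (rule that)
qed

end

section \<open>The stationary deviability\<close>

context jackson_network
begin

text \<open>Resting at \<open>0\<close> is free, so for a path that has come to rest there the
  infinite horizon adds nothing to the cost.\<close>

lemma action_eq_path_cost: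
  assumes q: "q \<in> skorohod_paths" "absolutely_continuous_path q" "q 0 = x" and T: "0 \<le> T"
  shows "path_cost running_cost q 0 T \<le> action x q"
    and "(\<And>t. T \<le> t \<Longrightarrow> q t = 0) \<Longrightarrow> action x q = path_cost running_cost q 0 T"
proof -
  let ?F = "\<lambda>t. e2ennreal (lagrangian (q t) (vector_derivative q (at t within {0..})))"
  have act: "action x q = (\<integral>\<^sup>+t\<in>{0..}. ?F t \<partial>lebesgue)"
    using q by (simp add: action_def)
  have F: "?F t = running_cost (q t) (vector_derivative q (at t))" if "0 < t" for t
  proof -
    have "at t within {0..} = at t" using that by (intro at_within_interior) simp
    then show ?thesis by (simp add: running_cost_def)
  qed
  show "path_cost running_cost q 0 T \<le> action x q"
    unfolding act path_cost_def
  proof (rule nn_integral_mono_AE)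
    show "AE t in lebesgue. running_cost (q t) (vector_derivative q (at t)) * indicator {0..T} t \<le> ?F t * indicator {0..} t"
      using AE_lebesgue_neq[of 0] by eventually_elim (use F in \<open>auto split: split_indicator\<close>)
  qed
  assume end0: "\<And>t. T \<le> t \<Longrightarrow> q t = 0"
  have "running_cost 0 0 = 0"
  proof -
    have "0 = arrival_rate + (transpose P - mat 1) *v throughput"
      using throughput_nth by (simp add: vec_eq_iff matrix_minus_vec)
    then have "min_rate UNIV 0 = 0"
      using throughput_nonneg throughput_less by (intro min_rate_fluid[of throughput]) (auto intro: less_imp_le)
    then show ?thesis by (simp add: running_cost_def lagrangian_eq zero_in_orthant)
  qed
  moreover have "vector_derivative q (at t) = 0" if "T < t" for t
  proof -
    have "vector_derivative q (at t) = vector_derivative (\<lambda>_. 0) (at t)"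
      by (rule vector_derivative_cong_open[of "{T<..}"]) (use that end0 in auto)
    then show ?thesis by simp
  qed
  ultimately have tail: "running_cost (q t) (vector_derivative q (at t)) = 0" if "T < t" for t
    using end0[of t] that by simp
  show "action x q = path_cost running_cost q 0 T"
    unfolding act path_cost_def
  proof (rule nn_integral_cong_AE)
    show "AE t in lebesgue. ?F t * indicator {0..} t = running_cost (q t) (vector_derivative q (at t)) * indicator {0..T} t"
      using AE_lebesgue_neq[of 0]
    proof eventually_elim
      case (elim t)
      then show ?case
        using F[of t] tail[of t] by (cases "0 < t"; cases "t \<le> T") (auto split: split_indicator)
    qed
  qed
qed

lemma skorohod_path_of_absolutely_continuous:
  assumes "absolutely_continuous_path q" "\<And>t. 0 \<le> t \<Longrightarrow> q t \<in> orthant"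
  shows "q \<in> skorohod_paths"
proof -
  have cont: "continuous (at t within {0..}) q" if "0 \<le> t" for t
  proof -
    have "continuous_on {0..t + 1} q"
      using assms(1) that absolutely_continuous_on_Icc_imp_continuous_on[of q 0 "t + 1"]
      unfolding absolutely_continuous_path_def by simp
    then have "continuous (at t within {0..t + 1}) q"
      using that by (simp add: continuous_on_eq_continuous_within)
    moreover have "at t within {0..t + 1} = at t within {0..}"
      by (rule at_within_nhd[of _ "{..<t + 1}"]) auto
    ultimately show ?thesis by simp
  qed
  have "continuous (at_right t) q" if "0 \<le> t" for t
    by (rule continuous_within_subset[OF cont[OF that]]) (use that in auto)
  moreover have "\<exists>l. (q \<longlongrightarrow> l) (at_left t)" if "0 < t" for t
  proof -
    have "at t within {0..} = at t" using that by (intro at_within_interior) simp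
    then have "(q \<longlongrightarrow> q t) (at t)" using cont[of t] that by (simp add: continuous_within)
    then have "(q \<longlongrightarrow> q t) (at_left t)" by (rule tendsto_within_subset) simp
    then show ?thesis by blast
  qed
  ultimately show ?thesis using assms(2) by (simp add: skorohod_paths_def)
qed

lemma bdd_above_exp_minus: "bdd_above ((\<lambda>q. exp_minus (f q)) ` A)"
  using exp_minus_bounds by (auto simp: bdd_above_def)

text \<open>A path on a bounded time interval is prolonged at arbitrarily small cost by draining to \<open>0\<close>.\<close>

lemma transition_eq:
  assumes x: "x \<in> orthant" and y: "y \<in> orthant" and t: "0 \<le> t"
  shows "transition x t y = exp_minus (move_cost x t y)"
proof (rule antisym)
  \<comment> \<open>The supremum in \<open>transition\<close> is one of reals, so the set of paths
    has to be shown nonempty; a constant path does.\<close>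
  have "(\<lambda>_. y) \<in> skorohod_paths"
    using y by (auto simp: skorohod_paths_def intro!: exI[of _ y])
  then have "{q \<in> skorohod_paths. q t = y} \<noteq> {}" by auto
  then show "transition x t y \<le> exp_minus (move_cost x t y)"
    unfolding transition_def
  proof (rule cSUP_least)
    fix q assume q: "q \<in> {q \<in> skorohod_paths. q t = y}"
    show "exp_minus (action x q) \<le> exp_minus (move_cost x t y)"
    proof (cases "absolutely_continuous_path q \<and> q 0 = x")
      case True
      then have "q \<in> paths_between orthant x t y"
        using q t by (auto simp: paths_between_def absolutely_continuous_path_def skorohod_paths_def)
      then have "move_cost x t y \<le> action x q"
        using action_eq_path_cost(1)[of q x t] True q t transfer_cost_le order_trans by blast
      then show ?thesis by (rule exp_minus_antimono)
    next
      case False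
      then have "action x q = \<infinity>" by (auto simp: action_def)
      then show ?thesis by (simp add: exp_minus_top exp_minus_bounds)
    qed
  qed
next
  show "exp_minus (move_cost x t y) \<le> transition x t y"
  proof (cases "move_cost x t y < \<infinity>")
    case False
    then have "exp_minus (move_cost x t y) = 0" by (simp add: exp_minus_top not_less top_unique)
    moreover have "0 \<le> transition x t y"
    proof -
      have "(\<lambda>_. y) \<in> {q \<in> skorohod_paths. q t = y}"
        using y by (auto simp: skorohod_paths_def intro!: exI[of _ y])
      then have "exp_minus (action x (\<lambda>_. y)) \<le> transition x t y"
        unfolding transition_def by (intro cSUP_upper bdd_above_exp_minus)
      then show ?thesis using exp_minus_bounds(1) order_trans by blast
    qed
    ultimately show ?thesis by simp
  next
    case True
    show ?thesis
    proof (rule field_le_epsilon)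
      fix e :: real assume "0 < e"
      then have e2: "0 < e / 2" by simp
      obtain p where p: "p \<in> paths_between orthant x t y" "path_cost running_cost p 0 t < move_cost x t y + ennreal (e / 2)"
        using less_add_ennreal[OF True e2] by (rule transfer_cost_lessE)
      obtain T where T: "0 \<le> T" "\<And>x' s. \<lbrakk>x' \<in> orthant; norm x' \<le> norm y; T \<le> s\<rbrakk> \<Longrightarrow> move_cost x' s 0 = 0"
        using move_cost_drain[of "norm y"] by blast
      then have "move_cost y T 0 < ennreal (e / 2)" using y e2 by simp
      then obtain r where r: "r \<in> paths_between orthant y T 0" "path_cost running_cost r 0 T < ennreal (e / 2)"
        by (rule transfer_cost_lessE)
      define q where "q = join_paths (join_paths p t r) (t + T) (\<lambda>_. 0)"
      have pr: "join_paths p t r \<in> paths_between orthant x (t + T) 0"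
        by (rule join_paths_between[OF p(1) r(1) t T(1)])
      have stay: "(\<lambda>_. 0) \<in> paths_between orthant 0 s (0 :: real ^ 'n)" for s
        by (auto simp: paths_between_def zero_in_orthant absolutely_continuous_on_Icc_const)
      have tT: "0 \<le> t + T" using t T by simp
      have qb: "q \<in> paths_between orthant x (t + T + s) 0" if "0 \<le> s" for s
        unfolding q_def by (rule join_paths_between[OF pr stay tT that])
      have q_orthant: "q s \<in> orthant" if "0 \<le> s" for s
        using qb[OF that] that tT by (auto simp: paths_between_def image_subset_iff)
      have q_ac: "absolutely_continuous_path q"
        unfolding absolutely_continuous_path_def
      proof (intro allI impI)
        fix s :: real assume "0 \<le> s"
        then show "absolutely_continuous_on_Icc q 0 s"
          using qb[of s] tT by (auto simp: paths_between_def intro: absolutely_continuous_on_Icc_subset)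
      qed
      have q_sk: "q \<in> skorohod_paths"
        by (rule skorohod_path_of_absolutely_continuous[OF q_ac q_orthant])
      have q0: "q 0 = x" using qb[of 0] by (simp add: paths_between_def)
      have qt: "q t = y" using p(1) T(1) by (simp add: q_def join_paths_def paths_between_def)
      have q_end: "q s = 0" if "t + T \<le> s" for s
        using that pr by (cases "s = t + T") (auto simp: q_def join_paths_def[of _ "t + T"] paths_between_def)
      have "action x q = path_cost running_cost q 0 (t + T)"
        by (rule action_eq_path_cost(2)[OF q_sk q_ac q0 tT]) (rule q_end)
      also have "\<dots> = path_cost running_cost (join_paths p t r) 0 (t + T)"
        by (rule path_cost_cong) (simp add: q_def join_paths_def[of _ "t + T"])
      also have "\<dots> = path_cost running_cost p 0 t + path_cost running_cost r 0 T"
        by (rule path_cost_join_paths[OF t T(1)])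
      also have "\<dots> \<le> (move_cost x t y + ennreal (e / 2)) + ennreal (e / 2)"
        using p(2) r(2) by (intro add_mono) auto
      also have "\<dots> = move_cost x t y + ennreal e"
        using e2 by (simp add: add.assoc flip: ennreal_plus)
      finally have "exp_minus (move_cost x t y + ennreal e) \<le> exp_minus (action x q)"
        by (rule exp_minus_antimono)
      also have "\<dots> \<le> transition x t y"
        unfolding transition_def by (intro cSUP_upper bdd_above_exp_minus) (use q_sk qt in simp)
      finally show "exp_minus (move_cost x t y) \<le> transition x t y + e"
        using exp_minus_add_ge[of e "move_cost x t y"] \<open>0 < e\<close> by simp
    qed
  qed
qed

section \<open>The limit deviability\<close>

definition limit_density :: "real ^ 'n \<Rightarrow> real" where
  "limit_density y = exp_minus (potential y)"

text \<open>The supremum is formed in \<open>ennreal\<close>, which gives the empty set the value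
  \<open>0\<close>.\<close>

definition limit_deviability :: "(real ^ 'n) set \<Rightarrow> real" where
  "limit_deviability G = enn2real (SUP v\<in>G. ennreal (limit_density v))"

lemma limit_density_bounds: "0 \<le> limit_density y" "limit_density y \<le> 1"
  by (simp_all add: limit_density_def exp_minus_bounds)

lemma limit_density_0: "limit_density 0 = 1"
  using exp_minus_ennreal[of 0] by (simp add: limit_density_def potential_0)

lemma limit_density_pos: "y \<in> orthant \<Longrightarrow> 0 < limit_density y"
  using potential_finite[of y] by (auto simp: limit_density_def exp_minus_def)

lemma SUP_limit_density_le_1: "(SUP v\<in>G. ennreal (limit_density v)) \<le> 1"
  by (intro SUP_least) (simp add: limit_density_bounds ennreal_le_1)

lemma ennreal_limit_deviability: "ennreal (limit_deviability G) = (SUP v\<in>G. ennreal (limit_density v))"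
  using SUP_limit_density_le_1[of G] unfolding limit_deviability_def
  by (intro ennreal_enn2real) (simp add: le_less_trans)

lemma limit_deviability_singleton [simp]: "limit_deviability {y} = limit_density y"
  by (simp add: limit_deviability_def limit_density_bounds)

lemma limit_density_ge_exp_iff:
  assumes "0 < \<kappa>" "\<kappa> \<le> 1"
  shows "\<kappa> \<le> limit_density y \<longleftrightarrow> potential y \<le> ennreal (- ln \<kappa>)"
proof (cases "potential y")
  case (real p)
  have "\<kappa> \<le> exp (- p) \<longleftrightarrow> ln \<kappa> \<le> - p" using exp_le_cancel_iff[of "ln \<kappa>" "- p"] assms by simp
  also have "\<dots> \<longleftrightarrow> p \<le> - ln \<kappa>" by linarith
  finally show ?thesis using real assms by (simp add: limit_density_def exp_minus_ennreal ennreal_le_iff)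
next
  case top
  then show ?thesis using assms by (simp add: limit_density_def exp_minus_top top_unique)
qed

text \<open>Its level sets are sublevel sets of the potential, bounded by coercivity and closed by
  Lipschitz continuity.\<close>

lemma limit_deviability_deviability: "deviability orthant limit_deviability"
proof -
  have "limit_deviability orthant = 1"
  proof -
    have "ennreal (limit_density 0) \<le> (SUP v\<in>orthant. ennreal (limit_density v))"
      by (rule SUP_upper) (rule zero_in_orthant)
    then have "(SUP v\<in>orthant. ennreal (limit_density v)) = 1"
      using SUP_limit_density_le_1[of orthant] by (intro antisym) (simp_all add: limit_density_0)
    then show ?thesis by (simp add: limit_deviability_def)
  qed
  moreover have "limit_deviability G \<le> 1" for G
  proof -
    have "ennreal (limit_deviability G) \<le> 1"
      unfolding ennreal_limit_deviability by (rule SUP_limit_density_le_1)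
    then show ?thesis by (simp only: ennreal_le_1)
  qed
  ultimately have "idempotent_probability orthant limit_deviability"
    unfolding idempotent_probability_def
    by (simp add: ennreal_limit_deviability) (simp add: limit_deviability_def)
  moreover have "compact {v \<in> orthant. \<kappa> \<le> limit_density v}" if \<kappa>: "\<kappa> \<in> {0<..1}" for \<kappa>
  proof -
    let ?K = "{v \<in> orthant. \<kappa> \<le> limit_density v}"
    define l where "l = - ln \<kappa>"
    have l: "0 \<le> l" using \<kappa> by (simp add: l_def)
    have K: "v \<in> ?K \<longleftrightarrow> v \<in> orthant \<and> potential v \<le> ennreal l" for v
      using limit_density_ge_exp_iff[of \<kappa> v] \<kappa> by (auto simp: l_def)
    obtain c where c: "0 < c" "\<And>y C. \<lbrakk>y \<in> orthant; potential y < ennreal C\<rbrakk> \<Longrightarrow> norm y \<le> C / c"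
      using potential_coercive by blast
    \<comment> \<open>Coercivity is stated for strict inequalities, hence
      \<open>l + 1\<close>.\<close>
    have "norm v \<le> (l + 1) / c" if "v \<in> ?K" for v
    proof (rule c(2))
      show "v \<in> orthant" using that K by blast
      have "ennreal l < ennreal (l + 1)" using l by (simp add: ennreal_less_iff)
      then show "potential v < ennreal (l + 1)" using that K le_less_trans by blast
    qed
    then have "bounded ?K" by (auto simp: bounded_iff)
    moreover have "closed ?K"
      unfolding closed_sequential_limits
    proof (intro allI impI, elim conjE)
      fix v :: "nat \<Rightarrow> real ^ 'n" and z assume v: "\<forall>n. v n \<in> ?K" "v \<longlonglongrightarrow> z"
      have "0 \<le> z $ k" for k
      proof (rule LIMSEQ_le_const[OF tendsto_vec_nth[OF v(2)]])
        show "\<exists>N. \<forall>n\<ge>N. 0 \<le> v n $ k" using v(1) by (auto simp: orthant_def)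
      qed
      then have z: "z \<in> orthant" by (simp add: orthant_def)
      obtain B where B: "0 \<le> B" "\<And>x y. \<lbrakk>x \<in> orthant; y \<in> orthant\<rbrakk> \<Longrightarrow> potential y \<le> potential x + ennreal (B * norm (y - x))"
        using potential_lipschitz by blast
      have "potential z \<le> ennreal (l + B * norm (z - v n))" for n
      proof -
        have "potential z \<le> potential (v n) + ennreal (B * norm (z - v n))"
          using v(1) z by (intro B(2)) auto
        also have "\<dots> \<le> ennreal l + ennreal (B * norm (z - v n))"
          using v(1) K by (intro add_right_mono) blast
        also have "\<dots> = ennreal (l + B * norm (z - v n))" using l B(1) by (simp flip: ennreal_plus)
        finally show ?thesis .
      qed
      moreover have "(\<lambda>n. ennreal (l + B * norm (z - v n))) \<longlonglongrightarrow> ennreal (l + B * norm (z - z))"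
        by (intro tendsto_ennrealI tendsto_intros v(2))
      ultimately have "potential z \<le> ennreal l"
        by (intro LIMSEQ_le_const[of "\<lambda>n. ennreal (l + B * norm (z - v n))"]) auto
      then show "z \<in> ?K" using K z by blast
    qed
    ultimately show ?thesis by (simp add: compact_eq_bounded_closed)
  qed
  ultimately show ?thesis by (simp add: deviability_def)
qed

lemma transition_eventually_limit:
  assumes "0 < \<kappa>" "\<kappa> < 1"
  obtains T where "\<And>t x y. \<lbrakk>T \<le> t; x \<in> orthant; norm x \<le> R; y \<in> orthant\<rbrakk> \<Longrightarrow>
     0 \<le> t \<and> (\<kappa> < limit_density y \<longrightarrow> transition x t y = limit_density y) \<and>
     (limit_density y \<le> \<kappa> \<longrightarrow> transition x t y \<le> \<kappa>)"
proof -
  define C where "C = - ln \<kappa>"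
  have C: "0 < C" "exp_minus (ennreal C) = \<kappa>" using assms by (auto simp: C_def exp_minus_ennreal)
  obtain T where T: "\<And>t x y. \<lbrakk>T \<le> t; x \<in> orthant; norm x \<le> R; y \<in> orthant\<rbrakk> \<Longrightarrow>
     0 \<le> t \<and> (potential y < ennreal C \<longrightarrow> move_cost x t y = potential y) \<and>
     (ennreal C \<le> potential y \<longrightarrow> ennreal C \<le> move_cost x t y)"
    using move_cost_eventually_potential[of R C] by blast
  have "0 \<le> t \<and> (\<kappa> < limit_density y \<longrightarrow> transition x t y = limit_density y) \<and>
     (limit_density y \<le> \<kappa> \<longrightarrow> transition x t y \<le> \<kappa>)"
    if "T \<le> t" "x \<in> orthant" "norm x \<le> R" "y \<in> orthant" for t x y
  proof -
    note * = T[OF that]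
    have tr: "transition x t y = exp_minus (move_cost x t y)" using * that by (intro transition_eq) auto
    show ?thesis
    proof (cases "potential y < ennreal C")
      case True
      then have "transition x t y = limit_density y" using * tr by (simp add: limit_density_def)
      then show ?thesis using * by auto
    next
      case False
      then have "limit_density y \<le> \<kappa>" "transition x t y \<le> \<kappa>"
        using * tr exp_minus_antimono[of "ennreal C"] C(2) by (auto simp: limit_density_def not_less)
      then show ?thesis using * by auto
    qed
  qed
  then show thesis by (rule that)
qed

section \<open>Convergence, stationarity and uniqueness\<close>

text \<open>Where the limit density exceeds \<kappa> the difference is \<open>0\<close> for large
  \<open>t\<close>; elsewhere both densities lie between \<open>0\<close> and \<kappa>.\<close>

lemma transition_converges_uniformly:
  assumes B: "B \<subseteq> orthant" "bounded B"
  shows "((\<lambda>t. SUP x\<in>B. SUP y\<in>orthant. ennreal \<bar>transition x t y - limit_density y\<bar>) \<longlongrightarrow> 0) at_top"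
proof (rule order_tendstoI)
  fix a :: ennreal assume "0 < a"
  then obtain b where b: "0 < b" "b < a" using dense by blast
  then obtain b' where b': "b = ennreal b'" by (cases b) auto
  then have "0 < b'" using b(1) by simp
  define \<kappa> where "\<kappa> = min b' (1 / 2)"
  have \<kappa>: "0 < \<kappa>" "\<kappa> < 1" "\<kappa> \<le> b'" using \<open>0 < b'\<close> by (auto simp: \<kappa>_def)
  obtain R where R: "\<And>x. x \<in> B \<Longrightarrow> norm x \<le> R" using B(2) by (auto simp: bounded_iff)
  obtain T where T: "\<And>t x y. \<lbrakk>T \<le> t; x \<in> orthant; norm x \<le> R; y \<in> orthant\<rbrakk> \<Longrightarrow>
     0 \<le> t \<and> (\<kappa> < limit_density y \<longrightarrow> transition x t y = limit_density y) \<and>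
     (limit_density y \<le> \<kappa> \<longrightarrow> transition x t y \<le> \<kappa>)"
    using transition_eventually_limit[OF \<kappa>(1,2), of R] by blast
  have "(SUP x\<in>B. SUP y\<in>orthant. ennreal \<bar>transition x t y - limit_density y\<bar>) \<le> b" if t: "T \<le> t" for t
  proof (intro SUP_least)
    fix x y :: "real ^ 'n" assume xy: "x \<in> B" "y \<in> orthant"
    then have x: "x \<in> orthant" "norm x \<le> R" using B R by auto
    note * = T[OF t x xy(2)]
    have "0 \<le> transition x t y"
      using transition_eq[OF x(1) xy(2)] * exp_minus_bounds by simp
    then have "\<bar>transition x t y - limit_density y\<bar> \<le> b'"
      using * \<kappa>(1,3) limit_density_bounds[of y] by (cases "\<kappa> < limit_density y") auto
    then show "ennreal \<bar>transition x t y - limit_density y\<bar> \<le> b"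
      unfolding b' by (rule ennreal_leI)
  qed
  then show "\<forall>\<^sub>F t in at_top. (SUP x\<in>B. SUP y\<in>orthant. ennreal \<bar>transition x t y - limit_density y\<bar>) < a"
    unfolding eventually_at_top_linorder using b(2) le_less_trans by blast
qed simp

text \<open>The potential is finite on the orthant, so the limit density at \<open>y\<close> is
  positive and half of it serves as the threshold.\<close>

lemma transition_eventually_eq:
  assumes B: "B \<subseteq> orthant" "bounded B" and y: "y \<in> orthant"
  shows "\<forall>\<^sub>F t in at_top. \<forall>x\<in>B. transition x t y = limit_density y"
proof -
  define \<kappa> where "\<kappa> = limit_density y / 2"
  have \<kappa>: "0 < \<kappa>" "\<kappa> < 1" "\<kappa> < limit_density y"
    using limit_density_pos[OF y] limit_density_bounds[of y] by (auto simp: \<kappa>_def)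
  obtain R where R: "\<And>x. x \<in> B \<Longrightarrow> norm x \<le> R" using B(2) by (auto simp: bounded_iff)
  obtain T where "\<And>t x y. \<lbrakk>T \<le> t; x \<in> orthant; norm x \<le> R; y \<in> orthant\<rbrakk> \<Longrightarrow>
     0 \<le> t \<and> (\<kappa> < limit_density y \<longrightarrow> transition x t y = limit_density y) \<and>
     (limit_density y \<le> \<kappa> \<longrightarrow> transition x t y \<le> \<kappa>)"
    using transition_eventually_limit[OF \<kappa>(1,2), of R] by blast
  then have "\<forall>x\<in>B. transition x t y = limit_density y" if "T \<le> t" for t
    using that B R y \<kappa>(3) by blast
  then show ?thesis unfolding eventually_at_top_linorder by blast
qed

lemma transition_bounds:
  assumes "x \<in> orthant" "y \<in> orthant" "0 \<le> t"
  shows "0 \<le> transition x t y" "transition x t y \<le> 1"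
  using transition_eq[OF assms] exp_minus_bounds by simp_all

text \<open>In terms of costs, \<open>potential y\<close> is the infimum over \<open>x\<close> of
  \<open>potential x + move_cost x t y\<close>. One inequality is the triangle inequality; the other
  cuts a near-optimal path from \<open>0\<close>.\<close>

lemma limit_deviability_stationary: "stationary limit_deviability"
  unfolding stationary_def limit_deviability_singleton
proof (intro ballI allI impI)
  fix y :: "real ^ 'n" and t :: real assume y: "y \<in> orthant" and t: "0 \<le> t"
  have prod: "transition x t y * limit_density x = exp_minus (potential x + move_cost x t y)" if "x \<in> orthant" for x
    using transition_eq[OF that y t] by (simp add: limit_density_def exp_minus_add)
  have le: "transition x t y * limit_density x \<le> limit_density y" if "x \<in> orthant" for x
  proof -
    have "exp_minus (potential x + move_cost x t y) \<le> limit_density y"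
      unfolding limit_density_def by (intro exp_minus_antimono potential_triangle t)
    then show ?thesis using prod[OF that] by simp
  qed
  have bdd: "bdd_above ((\<lambda>x. transition x t y * limit_density x) ` orthant)"
    using le by (auto simp: bdd_above_def)
  show "limit_density y = (SUP x\<in>orthant. transition x t y * limit_density x)"
  proof (rule antisym)
    show "(SUP x\<in>orthant. transition x t y * limit_density x) \<le> limit_density y"
      using le zero_in_orthant by (intro cSUP_least) auto
    show "limit_density y \<le> (SUP x\<in>orthant. transition x t y * limit_density x)"
    proof (rule field_le_epsilon)
      fix e :: real assume "0 < e"
      then have "potential y < potential y + ennreal e" by (intro less_add_ennreal potential_finite y)
      then obtain s where s: "0 \<le> s" "move_cost 0 s y < potential y + ennreal e" by (rule potential_lessE)
      \<comment> \<open>Waiting at \<open>0\<close> lengthens the path to duration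
        \<open>s + t\<close>, so that a final piece of duration \<open>t\<close> can be cut
        off.\<close>
      then have "move_cost 0 (s + t) y < potential y + ennreal e"
        using move_cost_0_antimono[of s "s + t" y] t by (meson le_add_same_cancel1 le_less_trans)
      then obtain z where z: "z \<in> orthant" "move_cost 0 s z + move_cost z t y < potential y + ennreal e"
        using s(1) t by (rule transfer_cost_intermediate)
      have "potential z + move_cost z t y \<le> move_cost 0 s z + move_cost z t y"
        by (intro add_right_mono potential_le s)
      then have "potential z + move_cost z t y \<le> potential y + ennreal e"
        using z(2) by (meson le_less_trans less_imp_le)
      then have "exp_minus (potential y + ennreal e) \<le> transition z t y * limit_density z"
        unfolding prod[OF z(1)] by (rule exp_minus_antimono)
      also have "\<dots> \<le> (SUP x\<in>orthant. transition x t y * limit_density x)"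
        by (rule cSUP_upper[OF z(1) bdd])
      finally show "limit_density y \<le> (SUP x\<in>orthant. transition x t y * limit_density x) + e"
        using exp_minus_add_ge[of e "potential y"] \<open>0 < e\<close> by (simp add: limit_density_def)
    qed
  qed
qed

text \<open>From below: \<open>D\<close> takes values close to \<open>1\<close>, and from such a
  point the transition density eventually equals the limit. From above: the points where
  \<open>D\<close> is at least \<open>limit_density y\<close> form a compact, hence bounded set, on
  which the transition density at \<open>y\<close> eventually equals the limit; at all other points
  the factor \<open>D {x}\<close> is small enough by itself.\<close>

lemma stationary_deviability_eq_limit:
  assumes D: "deviability orthant D" "stationary D" and y: "y \<in> orthant"
  shows "D {y} = limit_density y"
proof -
  have ip: "\<And>G. G \<subseteq> orthant \<Longrightarrow> 0 \<le> D G \<and> D G \<le> 1 \<and> ennreal (D G) = (SUP v\<in>G. ennreal (D {v}))"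
      "D orthant = 1"
    and comp: "\<And>\<kappa>. \<kappa> \<in> {0<..1} \<Longrightarrow> compact {v \<in> orthant. \<kappa> \<le> D {v}}"
    using D(1) by (auto simp: deviability_def idempotent_probability_def)
  have Db: "0 \<le> D {x}" "D {x} \<le> 1" if "x \<in> orthant" for x using ip(1)[of "{x}"] that by auto
  have st: "D {y} = (SUP x\<in>orthant. transition x t y * D {x})" if "0 \<le> t" for t
    using D(2) y that by (simp add: stationary_def)
  have prod_le: "transition x t y * D {x} \<le> transition x t y" "transition x t y * D {x} \<le> D {x}"
    if "x \<in> orthant" "0 \<le> t" for x t
    using transition_bounds[OF that(1) y that(2)] Db[OF that(1)] by (auto intro: mult_left_le mult_left_le_one_le)
  have bdd: "bdd_above ((\<lambda>x. transition x t y * D {x}) ` orthant)" if "0 \<le> t" for t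
    by (rule bdd_aboveI2[where M = 1]) (use prod_le(2)[OF _ that] Db order_trans in blast)
  show ?thesis
  proof (rule antisym)
    show "limit_density y \<le> D {y}"
    proof (rule field_le_epsilon)
      fix e :: real assume "0 < e"
      have "ennreal (1 - e) < ennreal (D orthant)"
        unfolding ip(2) using \<open>0 < e\<close> by (intro ennreal_lessI) auto
      also have "\<dots> = (SUP v\<in>orthant. ennreal (D {v}))"
        using ip(1)[OF order_refl] by blast
      finally obtain x where x: "x \<in> orthant" "ennreal (1 - e) < ennreal (D {x})" by (auto simp: less_SUP_iff)
      then have De: "1 - e \<le> D {x}" using ennreal_leI not_le by (metis less_imp_le linear)
      have "\<forall>\<^sub>F t in at_top. \<forall>x'\<in>{x}. transition x' t y = limit_density y"
        using x(1) y by (intro transition_eventually_eq) auto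
      then obtain T where "\<And>t. T \<le> t \<Longrightarrow> transition x t y = limit_density y"
        by (auto simp: eventually_at_top_linorder)
      then have t: "transition x (max 0 T) y = limit_density y" by simp
      have "limit_density y * D {x} \<le> D {y}"
        using cSUP_upper[OF x(1) bdd[of "max 0 T"]] st[of "max 0 T"] t by simp
      moreover have "limit_density y * (1 - e) \<le> limit_density y * D {x}"
        using De limit_density_bounds by (intro mult_left_mono) auto
      moreover have "limit_density y * e \<le> 1 * e"
        using \<open>0 < e\<close> limit_density_bounds by (intro mult_right_mono) auto
      ultimately show "limit_density y \<le> D {y} + e" by (simp add: algebra_simps)
    qed
    show "D {y} \<le> limit_density y"
    proof -
      define \<kappa> where "\<kappa> = limit_density y"
      have \<kappa>: "\<kappa> \<in> {0<..1}" using limit_density_pos[OF y] limit_density_bounds[of y] by (simp add: \<kappa>_def)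
      let ?B = "{v \<in> orthant. \<kappa> \<le> D {v}}"
      have "\<forall>\<^sub>F t in at_top. \<forall>x\<in>?B. transition x t y = limit_density y"
        using compact_imp_bounded[OF comp[OF \<kappa>]] y by (intro transition_eventually_eq) auto
      then obtain T where T: "\<And>t. T \<le> t \<Longrightarrow> \<forall>x\<in>?B. transition x t y = limit_density y"
        by (auto simp: eventually_at_top_linorder)
      define t where "t = max 0 T"
      have t0: "0 \<le> t" by (simp add: t_def)
      have "transition x t y * D {x} \<le> limit_density y" if x: "x \<in> orthant" for x
      proof (cases "x \<in> ?B")
        case True
        then show ?thesis using T[of t] prod_le(1)[OF x t0] by (simp add: t_def)
      next
        case False
        then show ?thesis using prod_le(2)[OF x t0] x by (simp add: \<kappa>_def)
      qed
      then show ?thesis unfolding st[OF t0] using zero_in_orthant by (intro cSUP_least) auto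
    qed
  qed
qed

lemma stationary_deviability_unique:
  assumes D: "deviability orthant D" "stationary D" and G: "G \<subseteq> orthant"
  shows "D G = limit_deviability G"
proof -
  have "ennreal (D G) = (SUP v\<in>G. ennreal (D {v}))" "0 \<le> D G"
    using D(1) G by (auto simp: deviability_def idempotent_probability_def)
  moreover have "(SUP v\<in>G. ennreal (D {v})) = (SUP v\<in>G. ennreal (limit_density v))"
    by (rule SUP_cong) (use stationary_deviability_eq_limit[OF D] G in auto)
  moreover have "0 \<le> limit_deviability G" by (simp add: limit_deviability_def)
  ultimately show ?thesis using ennreal_limit_deviability[of G] ennreal_inj by metis
qed

end

theorem theorem3p1:
  fixes M :: "'a measure"
    and \<xi> \<eta> :: "'n::finite \<Rightarrow> 'a \<Rightarrow> real"
    and P :: "real ^ 'n ^ 'n"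
  assumes "jackson_network M \<xi> \<eta> P"
  shows "\<exists>D :: (real ^ 'n) set \<Rightarrow> real.
    deviability orthant D \<and>
    (\<forall>B. B \<subseteq> orthant \<and> bounded B \<longrightarrow>
      ((\<lambda>t. SUP x\<in>B. SUP y\<in>orthant.
          ennreal \<bar>jackson_network.transition M \<xi> \<eta> P x t y - D {y}\<bar>) \<longlongrightarrow> 0) at_top) \<and>
    (\<forall>B. B \<subseteq> orthant \<and> bounded B \<longrightarrow> (\<forall>y\<in>orthant.
      eventually (\<lambda>t. \<forall>x\<in>B. jackson_network.transition M \<xi> \<eta> P x t y = D {y}) at_top)) \<and>
    jackson_network.stationary M \<xi> \<eta> P D \<and>
    (\<forall>D'. deviability orthant D' \<and> jackson_network.stationary M \<xi> \<eta> P D' \<longrightarrow>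
      (\<forall>G\<subseteq>orthant. D' G = D G))"
proof -
  interpret jackson_network M \<xi> \<eta> P by fact
  show ?thesis
  proof (intro exI[of _ limit_deviability] conjI allI ballI impI)
    show "deviability orthant limit_deviability" by (rule limit_deviability_deviability)
    show "stationary limit_deviability" by (rule limit_deviability_stationary)
  next
    fix B :: "(real ^ 'n) set" assume "B \<subseteq> orthant \<and> bounded B"
    then show "((\<lambda>t. SUP x\<in>B. SUP y\<in>orthant. ennreal \<bar>transition x t y - limit_deviability {y}\<bar>) \<longlongrightarrow> 0) at_top"
      unfolding limit_deviability_singleton by (elim conjE) (rule transition_converges_uniformly)
  next
    fix B :: "(real ^ 'n) set" and y :: "real ^ 'n"
    assume "B \<subseteq> orthant \<and> bounded B" "y \<in> orthant"
    then show "\<forall>\<^sub>F t in at_top. \<forall>x\<in>B. transition x t y = limit_deviability {y}"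
      unfolding limit_deviability_singleton by (elim conjE) (rule transition_eventually_eq)
  next
    fix D' and G :: "(real ^ 'n) set"
    assume "deviability orthant D' \<and> stationary D'" "G \<subseteq> orthant"
    then show "D' G = limit_deviability G"
      by (elim conjE) (rule stationary_deviability_unique)
  qed
qed

end
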